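(* Let $k\in\mathbb{N}$ with $k\ge 3$, $\Delta\in\mathbb{N}$ with $\Delta\ge 3$, and $w^*=1+(\log k-1)/\Delta$. Then there exists a deterministic algorithm which, given $\alpha$ satisfying $0<\alpha<\frac{2n}{e\Delta}e^{O(\log^2 k)}$ and an $n$-vertex Unique Games instance $G$ with alphabet size $k$ and maximum degree at most $\Delta$, computes a number $\xi$ satisfying $e^{-\alpha}\le Z(G;w^* )/\xi\le e^{\alpha}$ in time bounded by \[ n\exp\left(e^{O(\log^2 k)}\log\left(\frac{n\Delta}{\alpha}e^{O(\log^2 k)}\right)\log(\Delta\sqrt k)\right). \]
   Context: A Unique Games instance $G=(V,E,\pi)$ with alphabet size $k$ consists of a finite graph $(V,E)$ and, for each edge $uv\in E$ (with a fixed orientation $u\to v$), a permutation $\pi_{uv}:[k]\to[k]$. For a coloring $x\in[k]^V$, the edge $u\to v$ is satisfied if $\pi_{uv}(x_u)=x_v$. The partition function is the polynomial \[ Z(G;w)=\sum_{x\in[k]^V}\ \prod_{\substack{(u,v)\in E\\ x_v=\pi_{uv}(x_u)}} w, \] i.e. the sum over all colorings of $w^{i}$ where $i$ is the number of satisfied edges. *)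

theory Defs
  imports Complex_Main "HOL-Library.FuncSet" "HOL-Library.Landau_Symbols"
    "HOL-Combinatorics.Permutations"
begin

section \<open>Unique Games instances\<close>

text \<open>
  The vertex set is \<open>{..<ug_order G}\<close> and the alphabet \<open>[k]\<close> is \<open>{..<k}\<close>.
  A pair \<open>(u, v) \<in> ug_edges G\<close> is the edge \<open>uv\<close> of the graph together with its fixed
  orientation \<open>u \<rightarrow> v\<close>; \<open>ug_perm G u v\<close> is its permutation and is irrelevant at
  other pairs.
\<close>

record ug =
  ug_order :: nat
  ug_edges :: "(nat \<times> nat) set"
  ug_perm :: "nat \<Rightarrow> nat \<Rightarrow> nat \<Rightarrow> nat"

text \<open>The underlying graph is simple: no loops, and each edge has exactly one orientation.\<close>

definition ug_instance :: "nat \<Rightarrow> ug \<Rightarrow> bool" where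
  "ug_instance k G \<longleftrightarrow>
     ug_edges G \<subseteq> {..<ug_order G} \<times> {..<ug_order G} \<and>
     (\<forall>(u, v) \<in> ug_edges G. u \<noteq> v \<and> (v, u) \<notin> ug_edges G \<and> ug_perm G u v permutes {..<k})"

definition ug_degree :: "ug \<Rightarrow> nat \<Rightarrow> nat" where
  "ug_degree G u = card {v. (u, v) \<in> ug_edges G \<or> (v, u) \<in> ug_edges G}"

definition ug_colorings :: "nat \<Rightarrow> ug \<Rightarrow> (nat \<Rightarrow> nat) set" where
  "ug_colorings k G = {..<ug_order G} \<rightarrow>\<^sub>E {..<k}"

definition ug_satisfied :: "ug \<Rightarrow> (nat \<Rightarrow> nat) \<Rightarrow> (nat \<times> nat) set" where
  "ug_satisfied G x = {(u, v) \<in> ug_edges G. x v = ug_perm G u v (x u)}"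

definition ug_partition :: "nat \<Rightarrow> ug \<Rightarrow> real \<Rightarrow> real" where
  "ug_partition k G w = (\<Sum>x\<in>ug_colorings k G. \<Prod>e\<in>ug_satisfied G x. w)"

section \<open>Deterministic algorithms: the unit-cost real RAM\<close>

text \<open>
  An algorithm is a finite program for a random access machine with natural number registers
  and memory (for indices and combinatorial data) and real registers and memory.
  Every elementary operation and every test costs one time unit.  Two restrictions keep
  the unit-cost measure reasonable: there is no multiplication or division on natural
  numbers, and no rounding from reals to natural numbers.  Program constants are natural
  numbers only, so that no information can be hidden in a real constant; in particular
  \<open>ln k\<close> is not available as a primitive.
\<close>

record state =
  nreg :: "nat \<Rightarrow> nat"
  nmem :: "nat \<Rightarrow> nat"
  rreg :: "nat \<Rightarrow> real"
  rmem :: "nat \<Rightarrow> real"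

datatype oper =
    NConst nat nat
  | NAdd nat nat nat
  | NSub nat nat nat
  | NLoad nat nat
  | NStore nat nat
  | RNat nat nat
  | RAdd nat nat nat
  | RSub nat nat nat
  | RMul nat nat nat
  | RDiv nat nat nat
  | RLoad nat nat
  | RStore nat nat

datatype test =
    NLess nat nat
  | NLe nat nat
  | RLess nat nat
  | RLe nat nat

datatype prog =
    Skip
  | Oper oper
  | Seq prog prog
  | If test prog prog
  | While test prog

text \<open>
  The first argument of an operation is the target register, except for the two store
  operations, where it is the register holding the target address.
  Subtraction of natural numbers is truncated, and division by zero yields zero.
\<close>

fun step :: "oper \<Rightarrow> state \<Rightarrow> state" where
  "step (NConst i c) s = s\<lparr>nreg := (nreg s)(i := c)\<rparr>"
| "step (NAdd i j l) s = s\<lparr>nreg := (nreg s)(i := nreg s j + nreg s l)\<rparr>"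
| "step (NSub i j l) s = s\<lparr>nreg := (nreg s)(i := nreg s j - nreg s l)\<rparr>"
| "step (NLoad i a) s = s\<lparr>nreg := (nreg s)(i := nmem s (nreg s a))\<rparr>"
| "step (NStore a j) s = s\<lparr>nmem := (nmem s)(nreg s a := nreg s j)\<rparr>"
| "step (RNat i j) s = s\<lparr>rreg := (rreg s)(i := real (nreg s j))\<rparr>"
| "step (RAdd i j l) s = s\<lparr>rreg := (rreg s)(i := rreg s j + rreg s l)\<rparr>"
| "step (RSub i j l) s = s\<lparr>rreg := (rreg s)(i := rreg s j - rreg s l)\<rparr>"
| "step (RMul i j l) s = s\<lparr>rreg := (rreg s)(i := rreg s j * rreg s l)\<rparr>"
| "step (RDiv i j l) s = s\<lparr>rreg := (rreg s)(i := rreg s j / rreg s l)\<rparr>"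
| "step (RLoad i a) s = s\<lparr>rreg := (rreg s)(i := rmem s (nreg s a))\<rparr>"
| "step (RStore a j) s = s\<lparr>rmem := (rmem s)(nreg s a := rreg s j)\<rparr>"

fun holds :: "test \<Rightarrow> state \<Rightarrow> bool" where
  "holds (NLess i j) s \<longleftrightarrow> nreg s i < nreg s j"
| "holds (NLe i j) s \<longleftrightarrow> nreg s i \<le> nreg s j"
| "holds (RLess i j) s \<longleftrightarrow> rreg s i < rreg s j"
| "holds (RLe i j) s \<longleftrightarrow> rreg s i \<le> rreg s j"

text \<open>\<open>exec P s t s'\<close>: started in \<open>s\<close>, program \<open>P\<close> halts in \<open>s'\<close> after \<open>t\<close> time units.\<close>

inductive exec :: "prog \<Rightarrow> state \<Rightarrow> nat \<Rightarrow> state \<Rightarrow> bool" where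
  Skip: "exec Skip s 1 s"
| Oper: "exec (Oper a) s 1 (step a s)"
| Seq: "exec P s t s' \<Longrightarrow> exec Q s' t' s'' \<Longrightarrow> exec (Seq P Q) s (t + t') s''"
| IfTrue: "holds b s \<Longrightarrow> exec P s t s' \<Longrightarrow> exec (If b P Q) s (1 + t) s'"
| IfFalse: "\<not> holds b s \<Longrightarrow> exec Q s t s' \<Longrightarrow> exec (If b P Q) s (1 + t) s'"
| WhileFalse: "\<not> holds b s \<Longrightarrow> exec (While b P) s 1 s"
| WhileTrue: "holds b s \<Longrightarrow> exec P s t s' \<Longrightarrow> exec (While b P) s' t' s'' \<Longrightarrow>
    exec (While b P) s (1 + t + t') s''"

inductive_cases exec_SkipE: "exec Skip s t s'"
inductive_cases exec_OperE: "exec (Oper a) s t s'"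
inductive_cases exec_SeqE: "exec (Seq P Q) s t s'"
inductive_cases exec_IfE: "exec (If b P Q) s t s'"
inductive_cases exec_WhileE: "exec (While b P) s t s'"

lemma exec_deterministic:
  "exec P s t s' \<Longrightarrow> exec P s u r \<Longrightarrow> u = t \<and> r = s'"
proof (induction arbitrary: u r rule: exec.induct)
  case (Skip s)
  then show ?case by (rule exec_SkipE) simp
next
  case (Oper a s)
  then show ?case by (rule exec_OperE) simp
next
  case (Seq P s t s' Q t' s'')
  from Seq.prems obtain v v' q where "u = v + v'" "exec P s v q" "exec Q q v' r"
    by (rule exec_SeqE)
  with Seq.IH(1)[of v q] Seq.IH(2)[of v' r] show ?case by simp
next
  case (IfTrue b s P t s' Q)
  from IfTrue.prems obtain v where "u = Suc v" "exec P s v r"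
    by (rule exec_IfE) (simp_all add: IfTrue.hyps(1))
  with IfTrue.IH[of v r] show ?case by simp
next
  case (IfFalse b s Q t s' P)
  from IfFalse.prems obtain v where "u = Suc v" "exec Q s v r"
    by (rule exec_IfE) (simp_all add: IfFalse.hyps(1))
  with IfFalse.IH[of v r] show ?case by simp
next
  case (WhileFalse b s P)
  from WhileFalse.prems show ?case by (rule exec_WhileE) (simp_all add: WhileFalse.hyps)
next
  case (WhileTrue b s P t s' t' s'')
  from WhileTrue.prems obtain v v' q
    where "u = Suc (v + v')" "exec P s v q" "exec (While b P) q v' r"
    by (rule exec_WhileE) (simp_all add: WhileTrue.hyps(1))
  with WhileTrue.IH(1)[of v q] WhileTrue.IH(2)[of v' r] show ?case by simp
qed

section \<open>Input and output\<close>

text \<open>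
  An instance is presented by the number of vertices, the number of edges, and a list of its
  edges in an arbitrary order, each edge with the table of its permutation.
\<close>

definition edge_enumeration :: "ug \<Rightarrow> (nat \<times> nat) list \<Rightarrow> bool" where
  "edge_enumeration G es \<longleftrightarrow> distinct es \<and> set es = ug_edges G"

definition ug_encode :: "nat \<Rightarrow> ug \<Rightarrow> (nat \<times> nat) list \<Rightarrow> nat list" where
  "ug_encode k G es = ug_order G # length es #
     concat (map (\<lambda>(u, v). u # v # map (ug_perm G u v) [0..<k]) es)"

text \<open>The real input is in real register 0, the list is in the natural number memory.\<close>

definition init_state :: "real \<Rightarrow> nat list \<Rightarrow> state" where
  "init_state \<alpha> xs =
     \<lparr>nreg = (\<lambda>_. 0), nmem = (\<lambda>i. if i < length xs then xs ! i else 0),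
      rreg = (\<lambda>_. 0)(0 := \<alpha>), rmem = (\<lambda>_. 0)\<rparr>"

text \<open>
  On input \<open>(\<alpha>, xs)\<close> the program halts within time \<open>T\<close> with output \<open>\<xi>\<close>
  in real register 0.
\<close>

definition computes_within :: "prog \<Rightarrow> real \<Rightarrow> nat list \<Rightarrow> real \<Rightarrow> real \<Rightarrow> bool" where
  "computes_within P \<alpha> xs \<xi> T \<longleftrightarrow>
     (\<exists>t s. exec P (init_state \<alpha> xs) t s \<and> real t \<le> T \<and> rreg s 0 = \<xi>)"

end

theory Submission
  imports Defs
begin

text \<open>
  The proof uses decay of correlations instead of a zero-free region.  Deleting a vertex \<open>u\<close> expresses
  the law of its color through products of factors \<open>1 + (w - 1) * p\<close>, where \<open>p\<close> is a marginal of a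
  neighbor of \<open>u\<close> in a smaller instance in which some earlier neighbors are tilted towards a color.
  Since the numbers of tilts and of remaining neighbors of a vertex add up to at most \<open>\<Delta>\<close> and
  \<open>w ^ \<Delta> \<le> k / e\<close>, every marginal is at most \<open>1 / e\<close>, and one step of the recursion contracts errors by
  \<open>2 y exp (- 1 - y (1 - 1 / e)) \<le> 1 / 2\<close> with \<open>y = (w - 1) d\<close>, where \<open>d\<close> is the number of remaining
  neighbors.  Hence depth \<open>O(log (k n / \<alpha>))\<close> suffices, and the recursion tree branches at most
  \<open>k \<Delta>\<close>-fold.  The program replaces \<open>ln k\<close> by a partial sum of \<open>\<Sum>j. (1 - 1 / k) ^ j / j\<close>, which lies
  below it, so that the same bounds apply to the weight that it uses.
\<close>

section \<open>Contexts and the exact recursion\<close>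

text \<open>Contraction comes only from normalization. The logarithm of a weight can move by
  \<open>y\<close> times the error of the child marginals, and \<open>y\<close> may be as large as
  \<open>lam\<close>. What saves the argument is that the additive error of a marginal is
  proportional to a bound for the marginal itself, which is exponentially small in \<open>y\<close>.
  So children enter the recursion as normalized marginals, whereas the roots, whose unnormalized
  sums make up the partition function, are not contracted and cost one more factor close to 1 each.
  The machine has no call stack and no product of natural numbers. Hence the recursion tree of a
  root is written out in memory, contexts are linked lists with shared tails, and loops over colors
  are unrolled, \<open>k\<close> and \<open>\<Delta>\<close> being constants of the program. The
  upper bound on \<alpha> keeps the argument of the logarithm in the running time at least
  \<open>exp 1\<close>, so that this logarithm absorbs additive constants in the depth.\<close>

definition edge_map :: "ug \<Rightarrow> nat \<Rightarrow> nat \<Rightarrow> nat \<Rightarrow> nat" where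
  "edge_map G u v = (if (u, v) \<in> ug_edges G then ug_perm G u v else inv (ug_perm G v u))"

text \<open>\<open>lam\<close> is bounded instead of fixed because the program runs with a value
  that may lie below \<open>ln k - 1\<close>. \<open>N\<close> fixes an order of the neighbors: the
  contexts in which marginals are taken, and hence the estimate, depend on it.\<close>

locale ug_graph =
  fixes k \<Delta> :: nat and G :: ug and N :: "nat \<Rightarrow> nat list" and lam :: real
  assumes k3: "k \<ge> 3" and D3: "\<Delta> \<ge> 3"
    and inst: "ug_instance k G"
    and deg: "u < ug_order G \<Longrightarrow> ug_degree G u \<le> \<Delta>"
    and N_distinct: "u < ug_order G \<Longrightarrow> distinct (N u)"
    and N_set: "u < ug_order G \<Longrightarrow> set (N u) = {v. (u, v) \<in> ug_edges G \<or> (v, u) \<in> ug_edges G}"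
    and lam_nonneg: "0 \<le> lam" and lam_le: "lam \<le> ln (real k) - 1"
begin

definition w :: real where "w = 1 + lam / real \<Delta>"

text \<open>Because the inverse permutation is taken against the orientation, the condition of an
  edge reads \<open>x v = sig u v (x u)\<close> from either endpoint.\<close>

abbreviation sig :: "nat \<Rightarrow> nat \<Rightarrow> nat \<Rightarrow> nat" where "sig \<equiv> edge_map G"

text \<open>
  A context is a list of pairs: \<open>(v, c)\<close> with \<open>c < k\<close> is a factor \<open>w\<close> for each coloring
  that gives \<open>v\<close> the color \<open>c\<close>, and \<open>(v, k)\<close> deletes the vertex \<open>v\<close>.
\<close>

definition alive :: "nat \<Rightarrow> (nat \<times> nat) list \<Rightarrow> nat set" where
  "alive b L = {v. v < b \<and> (v, k) \<notin> set L}"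

definition sat :: "nat set \<Rightarrow> (nat \<Rightarrow> nat) \<Rightarrow> (nat \<times> nat) set" where
  "sat A x = ug_satisfied G x \<inter> A \<times> A"

text \<open>Entries count with multiplicity, since several deleted neighbors of one vertex may ask
  for the same color.\<close>

definition pins :: "nat set \<Rightarrow> (nat \<times> nat) list \<Rightarrow> (nat \<Rightarrow> nat) \<Rightarrow> nat" where
  "pins A L x = length (filter (\<lambda>(v, c). v \<in> A \<and> x v = c) L)"

definition wt :: "nat \<Rightarrow> (nat \<times> nat) list \<Rightarrow> (nat \<Rightarrow> nat) \<Rightarrow> real" where
  "wt b L x = w ^ (card (sat (alive b L) x) + pins (alive b L) L x)"

text \<open>Deleted vertices keep their (free) color, which only costs a power of \<open>k\<close>.\<close>

definition Zctx :: "nat \<Rightarrow> (nat \<times> nat) list \<Rightarrow> real" where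
  "Zctx b L = (\<Sum>x\<in>ug_colorings k G. wt b L x)"

definition Zctx_at :: "nat \<Rightarrow> (nat \<times> nat) list \<Rightarrow> nat \<Rightarrow> nat \<Rightarrow> real" where
  "Zctx_at b L u i = (\<Sum>x\<in>{x \<in> ug_colorings k G. x u = i}. wt b L x)"

definition marg :: "nat \<Rightarrow> (nat \<times> nat) list \<Rightarrow> nat \<Rightarrow> nat \<Rightarrow> real" where
  "marg b L u i = Zctx_at b L u i / Zctx b L"

text \<open>
  Pinning the neighbors of the deleted vertex \<open>u\<close> of color \<open>j\<close> one after the other multiplies the
  partition function by one factor for each entry \<open>(v, c, M)\<close>: the neighbor, the color that satisfies
  its edge, and the context in which its marginal is taken.
\<close>

fun steps :: "nat \<Rightarrow> nat \<Rightarrow> nat \<Rightarrow> (nat \<times> nat) list \<Rightarrow> nat list \<Rightarrow> (nat \<times> nat \<times> (nat \<times> nat) list) list" where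
  "steps b u j L [] = []"
| "steps b u j L (v # vs) =
    (if v \<in> alive b L then (v, sig u v j, L) # steps b u j ((v, sig u v j) # L) vs
     else steps b u j L vs)"

text \<open>The context reached after the last entry of \<open>steps\<close>; its partition function
  carries the mass of color \<open>j\<close> at \<open>u\<close>.\<close>

fun add_pins :: "nat \<Rightarrow> nat \<Rightarrow> nat \<Rightarrow> (nat \<times> nat) list \<Rightarrow> nat list \<Rightarrow> (nat \<times> nat) list" where
  "add_pins b u j L [] = L"
| "add_pins b u j L (v # vs) =
    (if v \<in> alive b L then add_pins b u j ((v, sig u v j) # L) vs else add_pins b u j L vs)"

text \<open>Kept unnormalized because a root contributes its whole sum, while children enter only as
  quotients. Dropping the neighbor factors at depth 0 amounts to child marginals 0.\<close>

primrec est :: "nat \<Rightarrow> nat \<Rightarrow> (nat \<times> nat) list \<Rightarrow> nat \<Rightarrow> nat \<Rightarrow> real" where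
  "est 0 = (\<lambda>b L u i. w ^ count_list L (u, i))"
| "est (Suc e) = (\<lambda>b L u i. w ^ count_list L (u, i) *
    (\<Prod>(v, c, M)\<leftarrow>steps b u i ((u, k) # L) (N u).
       1 + (w - 1) * (est e b M v c / (\<Sum>j<k. est e b M v j))))"

definition est_marg :: "nat \<Rightarrow> nat \<Rightarrow> (nat \<times> nat) list \<Rightarrow> nat \<Rightarrow> nat \<Rightarrow> real" where
  "est_marg e b L u i = est e b L u i / (\<Sum>j<k. est e b L u j)"

lemma est_Suc: "est (Suc e) b L u i = w ^ count_list L (u, i) *
    (\<Prod>(v, c, M)\<leftarrow>steps b u i ((u, k) # L) (N u). 1 + (w - 1) * est_marg e b M v c)"
  by (simp add: est_marg_def)

section \<open>Neighbors and colorings\<close>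

lemma w_ge1: "1 \<le> w"
  using lam_nonneg by (simp add: w_def)

lemma edgeD:
  assumes "(u, v) \<in> ug_edges G"
  shows "u < ug_order G" "v < ug_order G" "u \<noteq> v" "(v, u) \<notin> ug_edges G" "ug_perm G u v permutes {..<k}"
  using inst assms by (auto simp: ug_instance_def)

lemma finite_edges: "finite (ug_edges G)"
  using inst by (auto simp: ug_instance_def intro: finite_subset)

lemma N_bound: "u < ug_order G \<Longrightarrow> v \<in> set (N u) \<Longrightarrow> v < ug_order G \<and> v \<noteq> u \<and> u \<in> set (N v)"
  using N_set[of u] N_set[of v] edgeD by (auto dest: edgeD(3))

lemma N_length: "u < ug_order G \<Longrightarrow> length (N u) \<le> \<Delta>"
  using deg[of u] N_set[of u] distinct_card[OF N_distinct[of u]] by (simp add: ug_degree_def)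

lemma sig_less:
  assumes "u < ug_order G" "v \<in> set (N u)" "j < k" shows "sig u v j < k"
proof -
  have "sig u v permutes {..<k}"
    using assms(1,2) N_set[of u] edgeD(5) permutes_inv[OF edgeD(5)] by (auto simp: edge_map_def)
  then show ?thesis using assms(3) permutes_in_image[of "sig u v" "{..<k}" j] by simp
qed

lemma finite_colorings: "finite (ug_colorings k G)"
  by (simp add: ug_colorings_def finite_PiE)

lemma coloring_less: "x \<in> ug_colorings k G \<Longrightarrow> u < ug_order G \<Longrightarrow> x u < k"
  by (auto simp: ug_colorings_def)

lemma coloring_upd: "x \<in> ug_colorings k G \<Longrightarrow> u < ug_order G \<Longrightarrow> i < k \<Longrightarrow> x(u := i) \<in> ug_colorings k G"
  unfolding ug_colorings_def by (rule PiE_I) (auto simp: PiE_def extensional_def Pi_def)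

text \<open>Recoloring \<open>u\<close> is a bijection between any two color classes and leaves
  \<open>F\<close> unchanged, so each class has an equal share. This accounts for the free color
  that a deleted vertex keeps.\<close>

lemma sum_fixed_color:
  fixes F :: "(nat \<Rightarrow> nat) \<Rightarrow> real"
  assumes u: "u < ug_order G" and i: "i < k"
    and F: "\<And>x j. x \<in> ug_colorings k G \<Longrightarrow> j < k \<Longrightarrow> F (x(u := j)) = F x"
  shows "(\<Sum>x\<in>{x \<in> ug_colorings k G. x u = i}. F x) = (\<Sum>x\<in>ug_colorings k G. F x) / real k"
proof -
  let ?S = "\<lambda>j. \<Sum>x\<in>{x \<in> ug_colorings k G. x u = j}. F x"
  have eq: "?S j = ?S i" if "j < k" for j
    by (rule sum.reindex_bij_witness[where i = "\<lambda>x. x(u := j)" and j = "\<lambda>x. x(u := i)"])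
       (use that i u F coloring_upd in \<open>auto simp: fun_upd_idem\<close>)
  have "(\<Sum>x\<in>ug_colorings k G. F x) = (\<Sum>j<k. ?S j)"
    by (rule sum.group[symmetric]) (use finite_colorings coloring_less u in auto)
  also have "\<dots> = real k * ?S i" using eq by simp
  finally show ?thesis using i by simp
qed

section \<open>Weights under deletion and pinning\<close>

lemma alive_Cons: "c \<noteq> k \<Longrightarrow> alive b ((v, c) # L) = alive b L"
  by (auto simp: alive_def)

lemma alive_delete: "alive b ((u, k) # L) = alive b L - {u}"
  by (auto simp: alive_def)

lemma finite_sat: "finite (sat A x)"
  by (rule finite_subset[OF _ finite_edges]) (auto simp: sat_def ug_satisfied_def)

text \<open>A satisfied edge in \<open>A\<close> either avoids \<open>u\<close> or is determined by
  its other endpoint; \<open>?f\<close> restores its orientation, and it is injective since the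
  graph is simple.\<close>

lemma card_sat_delete:
  assumes u: "u \<in> A" "u < ug_order G"
  shows "card (sat A x) = card (sat (A - {u}) x) + card {v \<in> set (N u). v \<in> A \<and> x v = sig u v (x u)}"
proof -
  let ?f = "\<lambda>v. if (u, v) \<in> ug_edges G then (u, v) else (v, u)"
  let ?V = "{v \<in> set (N u). v \<in> A \<and> x v = sig u v (x u)}"
  have inv_iff: "x u = ug_perm G v u (x v) \<longleftrightarrow> x v = inv (ug_perm G v u) (x u)" if "(v, u) \<in> ug_edges G" for v
    using permutes_inverses[OF edgeD(5)[OF that]] by metis
  have "sat A x = sat (A - {u}) x \<union> ?f ` ?V" (is "_ = ?B \<union> ?C")
  proof (intro set_eqI iffI)
    fix p assume p: "p \<in> sat A x"
    obtain a c where [simp]: "p = (a, c)" by (cases p)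
    have ac: "(a, c) \<in> ug_edges G" "x c = ug_perm G a c (x a)" "a \<in> A" "c \<in> A"
      using p by (auto simp: sat_def ug_satisfied_def)
    consider "a = u" | "c = u" | "a \<noteq> u" "c \<noteq> u" by blast
    then show "p \<in> ?B \<union> ?C"
    proof cases
      case 1
      then have "c \<in> ?V" "?f c = p" using ac N_set[OF u(2)] by (simp_all add: edge_map_def)
      then show ?thesis by (intro UnI2 image_eqI[of _ _ c]) simp_all
    next
      case 2
      then have "(u, a) \<notin> ug_edges G" using ac(1) edgeD(4) by blast
      then have "a \<in> ?V" "?f a = p" using 2 ac N_set[OF u(2)] inv_iff[of a] by (simp_all add: edge_map_def)
      then show ?thesis by (intro UnI2 image_eqI[of _ _ a]) simp_all
    next
      case 3
      then show ?thesis using p by (simp add: sat_def)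
    qed
  next
    fix p assume "p \<in> ?B \<union> ?C"
    then show "p \<in> sat A x"
    proof
      assume "p \<in> ?C"
      then obtain v where v: "v \<in> set (N u)" "v \<in> A" "x v = sig u v (x u)" "p = ?f v" by blast
      show ?thesis
      proof (cases "(u, v) \<in> ug_edges G")
        case True
        then show ?thesis using v u by (simp add: sat_def ug_satisfied_def edge_map_def)
      next
        case False
        then have "(v, u) \<in> ug_edges G" using v N_set[OF u(2)] by simp
        then show ?thesis using False v u inv_iff[of v] by (simp add: sat_def ug_satisfied_def edge_map_def)
      qed
    qed (auto simp: sat_def)
  qed
  moreover have "?B \<inter> ?C = {}" by (auto simp: sat_def)
  moreover have "card ?C = card ?V"
    by (rule card_image) (auto simp: inj_on_def split: if_splits)
  moreover have "finite ?B" "finite ?C" by (simp_all add: finite_sat)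
  ultimately show ?thesis by (simp add: card_Un_disjoint)
qed

lemma pins_delete:
  assumes "u \<in> A"
  shows "pins A L x = count_list L (u, x u) + pins (A - {u}) L x"
  using assms by (induction L) (auto simp: pins_def)

text \<open>Once the color of \<open>u\<close> is known, a satisfied edge at \<open>u\<close> is a
  satisfied pin on the other endpoint, and the pins on \<open>u\<close> itself are a constant. So
  \<open>u\<close> can be deleted.\<close>

lemma wt_fixed_color:
  assumes x: "x \<in> ug_colorings k G" and u: "u \<in> alive b L" "u < ug_order G"
  shows "wt b L x = w ^ count_list L (u, x u) * (wt b ((u, k) # L) x *
    w ^ length (filter (\<lambda>v. v \<in> alive b ((u, k) # L) \<and> x v = sig u v (x u)) (N u)))"
proof -
  have 1: "pins (A - {u}) ((u, k) # L) x = pins (A - {u}) L x" for A by (simp add: pins_def)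
  have "length (filter (\<lambda>v. v \<in> alive b ((u, k) # L) \<and> x v = sig u v (x u)) (N u))
      = card {v \<in> set (N u). v \<in> alive b ((u, k) # L) \<and> x v = sig u v (x u)}"
    using distinct_card[OF distinct_filter[OF N_distinct[OF u(2)]]] by (metis set_filter)
  also have "{v \<in> set (N u). v \<in> alive b ((u, k) # L) \<and> x v = sig u v (x u)}
      = {v \<in> set (N u). v \<in> alive b L \<and> x v = sig u v (x u)}"
    using N_bound[OF u(2)] by (auto simp: alive_delete)
  finally show ?thesis
    unfolding wt_def card_sat_delete[OF u] pins_delete[OF u(1)] alive_delete 1
    by (simp add: power_add)
qed

lemma wt_pin:
  assumes "v \<in> alive b L" "c \<noteq> k"
  shows "wt b ((v, c) # L) x = wt b L x * (if x v = c then w else 1)"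
  using assms by (simp add: wt_def alive_Cons pins_def)

lemma wt_add_pins:
  assumes "\<And>v. v \<in> set vs \<Longrightarrow> sig u v j < k"
  shows "wt b (add_pins b u j L vs) x =
    wt b L x * w ^ length (filter (\<lambda>v. v \<in> alive b L \<and> x v = sig u v j) vs)"
  using assms
proof (induction vs arbitrary: L)
  case (Cons v vs)
  from Cons.prems have "sig u v j \<noteq> k" by fastforce
  then show ?case using Cons by (simp add: wt_pin alive_Cons)
qed simp

lemma wt_pos: "0 < wt b L x"
  using w_ge1 by (simp add: wt_def)

lemma Zctx_pos: "0 < Zctx b L"
proof -
  have "(\<lambda>v\<in>{..<ug_order G}. 0) \<in> ug_colorings k G" using k3 by (auto simp: ug_colorings_def)
  then show ?thesis unfolding Zctx_def using finite_colorings wt_pos by (intro sum_pos) auto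
qed

text \<open>A pin multiplies the weight of \<open>x\<close> by 1 plus \<open>w - 1\<close> times the
  indicator of \<open>x v = c\<close>, so the ratio of the partition functions is an expectation.
  This is the origin of the factors \<open>1 + (w - 1) * p\<close>.\<close>

lemma Zctx_pin:
  assumes "v \<in> alive b L" "c < k"
  shows "Zctx b ((v, c) # L) = Zctx b L * (1 + (w - 1) * marg b L v c)"
proof -
  have "Zctx b ((v, c) # L) = (\<Sum>x\<in>ug_colorings k G. wt b L x + (w - 1) * (if x v = c then wt b L x else 0))"
    unfolding Zctx_def using assms by (intro sum.cong) (auto simp: wt_pin algebra_simps)
  also have "\<dots> = Zctx b L + (w - 1) * Zctx_at b L v c"
    by (simp add: sum.distrib Zctx_def Zctx_at_def sum_distrib_left[symmetric] sum.inter_filter finite_colorings)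
  finally show ?thesis using Zctx_pos[of b L] by (simp add: marg_def distrib_left)
qed

lemma Zctx_add_pins:
  assumes "\<And>v. v \<in> set vs \<Longrightarrow> sig u v j < k"
  shows "Zctx b (add_pins b u j L vs) =
    Zctx b L * (\<Prod>(v, c, M)\<leftarrow>steps b u j L vs. 1 + (w - 1) * marg b M v c)"
  using assms
proof (induction vs arbitrary: L)
  case (Cons v vs)
  then show ?case by (simp add: Zctx_pin)
qed simp

lemma add_pins_deleted: "u \<notin> alive b L \<Longrightarrow> u \<notin> alive b (add_pins b u j L vs)"
  by (induction vs arbitrary: L) (auto simp: alive_def)

lemma wt_upd_deleted:
  assumes "u \<notin> alive b L" shows "wt b L (x(u := i)) = wt b L x"
proof -
  have "sat (alive b L) (x(u := i)) = sat (alive b L) x" "pins (alive b L) L (x(u := i)) = pins (alive b L) L x"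
    using assms by (auto simp: sat_def ug_satisfied_def pins_def intro!: arg_cong[where f = length] filter_cong)
  then show ?thesis by (simp add: wt_def)
qed

section \<open>Marginals and the product formula for the partition function\<close>

definition marg_weight :: "nat \<Rightarrow> (nat \<times> nat) list \<Rightarrow> nat \<Rightarrow> nat \<Rightarrow> real" where
  "marg_weight b L u i = w ^ count_list L (u, i) *
    (\<Prod>(v, c, M)\<leftarrow>steps b u i ((u, k) # L) (N u). 1 + (w - 1) * marg b M v c)"

text \<open>The factor in front of \<open>marg_weight\<close> is the same for all colors, so it
  cancels in a marginal. Its \<open>1 / real k\<close> compensates for the free color of the deleted
  \<open>u\<close>.\<close>

lemma Zctx_at_eq:
  assumes u: "u \<in> alive b L" "u < ug_order G" and i: "i < k"
  shows "Zctx_at b L u i = Zctx b ((u, k) # L) / real k * marg_weight b L u i"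
proof -
  have sig: "\<And>v. v \<in> set (N u) \<Longrightarrow> sig u v i < k" using sig_less u(2) i by blast
  let ?M = "add_pins b u i ((u, k) # L) (N u)"
  have "Zctx_at b L u i = (\<Sum>x\<in>{x \<in> ug_colorings k G. x u = i}. w ^ count_list L (u, i) * wt b ?M x)"
    unfolding Zctx_at_def using u sig by (intro sum.cong) (auto simp: wt_fixed_color wt_add_pins)
  also have "\<dots> = w ^ count_list L (u, i) * (\<Sum>x\<in>{x \<in> ug_colorings k G. x u = i}. wt b ?M x)"
    by (simp add: sum_distrib_left)
  also have "(\<Sum>x\<in>{x \<in> ug_colorings k G. x u = i}. wt b ?M x) = Zctx b ?M / real k"
    unfolding Zctx_def using u(2) i add_pins_deleted[of u b "(u, k) # L" i "N u"]
    by (intro sum_fixed_color wt_upd_deleted) (auto simp: alive_def)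
  finally show ?thesis using Zctx_add_pins[of "N u" u i b "(u, k) # L"] sig by (simp add: marg_weight_def)
qed

lemma Zctx_eq:
  assumes u: "u \<in> alive b L" "u < ug_order G"
  shows "Zctx b L = Zctx b ((u, k) # L) / real k * (\<Sum>i<k. marg_weight b L u i)"
proof -
  have "Zctx b L = (\<Sum>i<k. Zctx_at b L u i)" unfolding Zctx_def Zctx_at_def
    by (rule sum.group[symmetric]) (use finite_colorings coloring_less u in auto)
  then show ?thesis using Zctx_at_eq[OF u] by (simp add: sum_distrib_left)
qed

lemma marg_eq:
  assumes "u \<in> alive b L" "u < ug_order G" "i < k"
  shows "marg b L u i = marg_weight b L u i / (\<Sum>j<k. marg_weight b L u j)"
  using Zctx_at_eq[OF assms] Zctx_eq[OF assms(1,2)] Zctx_pos[of b "(u, k) # L"] k3 by (simp add: marg_def)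

text \<open>Deleting the largest vertex \<open>r\<close> and lowering the bound from
  \<open>Suc r\<close> to \<open>r\<close> leave the same vertices alive. Vertices can thus be
  peeled off by decreasing index, each time starting from an empty context.\<close>

lemma Zctx_Suc:
  assumes "r < ug_order G" shows "Zctx (Suc r) [] = Zctx r [] * ((\<Sum>i<k. marg_weight (Suc r) [] r i) / real k)"
proof -
  have "alive (Suc r) [(r, k)] = alive r []" by (auto simp: alive_def)
  moreover have "r \<notin> alive r []" by (auto simp: alive_def)
  ultimately have "wt (Suc r) [(r, k)] x = wt r [] x" for x by (simp add: wt_def pins_def)
  then have "Zctx (Suc r) [(r, k)] = Zctx r []" by (simp add: Zctx_def)
  then show ?thesis using Zctx_eq[of r "Suc r" "[]"] assms by (simp add: alive_def)
qed

lemma Zctx_prod: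
  assumes "r \<le> ug_order G"
  shows "Zctx r [] = real k ^ ug_order G * (\<Prod>i<r. (\<Sum>j<k. marg_weight (Suc i) [] i j) / real k)"
  using assms
proof (induction r)
  case 0
  have "wt 0 [] x = 1" for x by (simp add: wt_def alive_def sat_def pins_def)
  then show ?case by (simp add: Zctx_def ug_colorings_def card_PiE)
next
  case (Suc r)
  then show ?case by (simp add: Zctx_Suc)
qed

text \<open>At bound 0 every color is free, and \<open>k ^ ug_order G\<close> cancels against the
  factors \<open>1 / k\<close> of the peeled vertices.\<close>

lemma partition_eq: "ug_partition k G w = (\<Prod>i<ug_order G. \<Sum>j<k. marg_weight (Suc i) [] i j)"
proof -
  have "sat (alive (ug_order G) []) x = ug_satisfied G x" for x
    using edgeD by (auto simp: sat_def alive_def ug_satisfied_def)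
  then have "wt (ug_order G) [] x = (\<Prod>e\<in>ug_satisfied G x. w)" for x by (simp add: wt_def pins_def)
  then have "ug_partition k G w = Zctx (ug_order G) []" by (simp add: ug_partition_def Zctx_def)
  then show ?thesis using k3 by (simp add: Zctx_prod prod_dividef)
qed

end

section \<open>Decay of correlations\<close>

lemma prod_list_bounds:
  fixes p :: "'a \<Rightarrow> real"
  assumes "0 \<le> t" "\<And>x. x \<in> set xs \<Longrightarrow> 0 \<le> p x \<and> p x \<le> q"
  shows "1 \<le> (\<Prod>x\<leftarrow>xs. 1 + t * p x) \<and> (\<Prod>x\<leftarrow>xs. 1 + t * p x) \<le> exp (t * q * real (length xs))"
  using assms(2)
proof (induction xs)
  case (Cons x xs)
  have px: "0 \<le> p x" "p x \<le> q" using Cons.prems by simp_all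
  have IH: "1 \<le> (\<Prod>x\<leftarrow>xs. 1 + t * p x)" "(\<Prod>x\<leftarrow>xs. 1 + t * p x) \<le> exp (t * q * real (length xs))"
    using Cons.IH Cons.prems by simp_all
  have 1: "0 \<le> t * p x" using assms(1) px by simp
  have "1 + t * p x \<le> 1 + t * q" using assms(1) px by (simp add: mult_left_mono)
  also have "\<dots> \<le> exp (t * q)" by (rule exp_ge_add_one_self)
  finally have 2: "1 + t * p x \<le> exp (t * q)" .
  have "1 * 1 \<le> (1 + t * p x) * (\<Prod>x\<leftarrow>xs. 1 + t * p x)" using 1 IH by (intro mult_mono) auto
  moreover have "(1 + t * p x) * (\<Prod>x\<leftarrow>xs. 1 + t * p x) \<le> exp (t * q) * exp (t * q * real (length xs))"
    using 1 2 IH by (intro mult_mono) auto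
  ultimately show ?case by (simp add: algebra_simps exp_add)
qed simp

text \<open>An additive error of a marginal becomes a multiplicative one, since
  \<open>1 + t * (p' + \<epsilon>)\<close> is at most
  \<open>(1 + t * \<epsilon>) * (1 + t * p')\<close>. Nonnegativity is carried along for the
  induction.\<close>

lemma prod_list_close:
  fixes p p' :: "'a \<Rightarrow> real"
  assumes "0 \<le> t" "0 \<le> \<epsilon>" "\<And>x. x \<in> set xs \<Longrightarrow> 0 \<le> p x \<and> 0 \<le> p' x \<and> p x \<le> p' x + \<epsilon>"
  shows "(\<Prod>x\<leftarrow>xs. 1 + t * p x) \<le> exp (t * \<epsilon> * real (length xs)) * (\<Prod>x\<leftarrow>xs. 1 + t * p' x) \<and>
    0 \<le> (\<Prod>x\<leftarrow>xs. 1 + t * p x)"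
  using assms(3)
proof (induction xs)
  case (Cons x xs)
  have px: "0 \<le> p x" "0 \<le> p' x" "p x \<le> p' x + \<epsilon>" using Cons.prems by simp_all
  have IH: "0 \<le> (\<Prod>x\<leftarrow>xs. 1 + t * p x)"
    "(\<Prod>x\<leftarrow>xs. 1 + t * p x) \<le> exp (t * \<epsilon> * real (length xs)) * (\<Prod>x\<leftarrow>xs. 1 + t * p' x)"
    using Cons.IH Cons.prems by simp_all
  have nn: "0 \<le> 1 + t * p x" using assms(1) px by simp
  have nn': "0 \<le> t * p' x" using assms(1) px by simp
  have "1 + t * p x \<le> 1 + t * (p' x + \<epsilon>)" using assms(1) px by (simp add: mult_left_mono)
  also have "\<dots> \<le> (1 + t * \<epsilon>) * (1 + t * p' x)" using assms(1,2) nn' by (simp add: algebra_simps)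
  also have "\<dots> \<le> exp (t * \<epsilon>) * (1 + t * p' x)"
    using nn' exp_ge_add_one_self[of "t * \<epsilon>"] by (intro mult_right_mono) auto
  finally have "1 + t * p x \<le> exp (t * \<epsilon>) * (1 + t * p' x)" .
  with nn IH have "(1 + t * p x) * (\<Prod>x\<leftarrow>xs. 1 + t * p x)
     \<le> (exp (t * \<epsilon>) * (1 + t * p' x)) * (exp (t * \<epsilon> * real (length xs)) * (\<Prod>x\<leftarrow>xs. 1 + t * p' x))"
    by (intro mult_mono) auto
  moreover have "0 \<le> (1 + t * p x) * (\<Prod>x\<leftarrow>xs. 1 + t * p x)" using nn IH by simp
  moreover have "exp (t * \<epsilon> * real (length (x # xs))) = exp (t * \<epsilon>) * exp (t * \<epsilon> * real (length xs))"
    by (simp add: exp_add[symmetric] algebra_simps)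
  ultimately show ?case by (simp add: mult_ac del: of_nat_Suc)
qed simp


text \<open>Numerator and denominator each move by a factor of at most \<open>exp \<eta>\<close>,
  and \<open>1 - 2 * \<eta>\<close> is at most \<open>exp (- (2 * \<eta>))\<close>. The resulting
  error is relative, hence the factor \<open>P\<close>, which is what makes the recursion
  contract.\<close>

lemma normalized_close:
  fixes a b :: "nat \<Rightarrow> real"
  assumes pos: "\<And>i. i < k \<Longrightarrow> 0 < a i \<and> 0 < b i"
    and close: "\<And>i. i < k \<Longrightarrow> a i \<le> exp \<eta> * b i \<and> b i \<le> exp \<eta> * a i"
    and P: "a i / (\<Sum>j<k. a j) \<le> P" and i: "i < k" and \<eta>: "0 \<le> \<eta>"
  shows "a i / (\<Sum>j<k. a j) \<le> b i / (\<Sum>j<k. b j) + 2 * \<eta> * P"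
proof -
  let ?A = "\<Sum>j<k. a j" and ?B = "\<Sum>j<k. b j"
  have "?A > 0" "?B > 0" using i pos by (auto intro!: sum_pos)
  have "?B \<le> exp \<eta> * ?A" using close by (auto simp: sum_distrib_left intro!: sum_mono)
  then have "a i * ?B \<le> (exp \<eta> * b i) * (exp \<eta> * ?A)"
    using close[OF i] pos[OF i] \<open>?B > 0\<close> by (intro mult_mono) auto
  then have "a i \<le> (exp \<eta> * b i) * (exp \<eta> * ?A) / ?B"
    using \<open>?B > 0\<close> by (simp only: pos_le_divide_eq)
  also have "\<dots> = exp (2 * \<eta>) * (b i / ?B) * ?A"
    unfolding mult_2 exp_add by simp
  finally have "a i / ?A \<le> exp (2 * \<eta>) * (b i / ?B)"
    using \<open>?A > 0\<close> by (simp only: pos_divide_le_eq)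
  then have "exp (- (2 * \<eta>)) * (a i / ?A) \<le> exp (- (2 * \<eta>)) * (exp (2 * \<eta>) * (b i / ?B))"
    by (rule mult_left_mono) simp
  also have "\<dots> = b i / ?B" unfolding mult.assoc[symmetric] exp_add[symmetric] by simp
  finally have "exp (- (2 * \<eta>)) * (a i / ?A) \<le> b i / ?B" .
  moreover have "(1 - 2 * \<eta>) * (a i / ?A) \<le> exp (- (2 * \<eta>)) * (a i / ?A)"
    using exp_ge_add_one_self[of "- (2 * \<eta>)"] pos[OF i] \<open>?A > 0\<close> by (intro mult_right_mono) auto
  moreover have "2 * \<eta> * (a i / ?A) \<le> 2 * \<eta> * P" using P \<eta> by (intro mult_left_mono) auto
  ultimately show ?thesis unfolding left_diff_distrib mult_1_left by linarith
qed

text \<open>With \<open>c = 1 - 1 / e\<close>, the inequality \<open>z \<le> exp (z - 1)\<close> at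
  \<open>z = c * y\<close> bounds \<open>y * exp (- c * y)\<close> by \<open>1 / (c * e)\<close>.
  The left side is therefore at most \<open>2 / (c * e ^ 2)\<close>, which is about 0.43.\<close>

lemma contraction_constant:
  fixes y :: real
  shows "2 * y * exp (- 1 - y * (1 - exp (- 1))) \<le> 1 / 2"
proof -
  let ?c = "1 - exp (- 1) :: real"
  \<comment> \<open>The Taylor bound 1.625 for the square root of \<open>e\<close> yields 2.64 for
    \<open>e\<close>; the cruder bound 2 would be too weak for the last estimate.\<close>
  have "exp (1/2::real) \<ge> 1 + 1/2 + (1/2)^2 / 2" using exp_lower_Taylor_quadratic[of "1/2"] by simp
  then have "exp (1/2::real) ^ 2 \<ge> (1 + 1/2 + (1/2)^2 / 2)^2" by (intro power_mono) auto
  then have e: "exp (1::real) \<ge> 264/100" by (simp add: power2_eq_square exp_add[symmetric])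
  have c0: "?c > 0" by simp
  have "?c * y \<le> exp (?c * y - 1)" using exp_ge_add_one_self[of "?c * y - 1"] by simp
  then have "?c * y * exp (- 1 - y * ?c) \<le> exp (?c * y - 1) * exp (- 1 - y * ?c)"
    by (intro mult_right_mono) auto
  also have "\<dots> = exp (- 1) * exp (- 1)" by (simp add: exp_add[symmetric] algebra_simps)
  also have "\<dots> \<le> ?c / 4"
  proof -
    have "exp (- 1) \<le> (100 / 264 :: real)" using e by (simp add: exp_minus field_simps)
    then have "4 * (exp (- 1) * exp (- 1)) \<le> (4 * (100/264) * (100/264) :: real)"
      using mult_mono[of "exp (- 1)" "100/264" "exp (- 1)" "100/264::real"] by simp
    also have "\<dots> \<le> 1 - 100/264" by simp
    finally show ?thesis using \<open>exp (- 1) \<le> (100 / 264 :: real)\<close> by simp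
  qed
  finally have "?c * (2 * y * exp (- 1 - y * ?c)) \<le> ?c * (1 / 2)" by simp
  then show ?thesis using c0 by (simp add: mult_le_cancel_left_pos)
qed

section \<open>The slack invariant of contexts\<close>

context ug_graph begin

text \<open>In the contexts that the recursion reaches, each pin on \<open>v\<close> comes from a
  deleted neighbor of \<open>v\<close>, so pins and remaining neighbors together never exceed the
  degree.\<close>

definition slack :: "nat \<Rightarrow> (nat \<times> nat) list \<Rightarrow> nat \<Rightarrow> nat" where
  "slack b L v = length (filter (\<lambda>p. fst p = v) L) + length (filter (\<lambda>v'. v' \<in> alive b L) (N v))"

definition good :: "nat \<Rightarrow> (nat \<times> nat) list \<Rightarrow> bool" where
  "good b L \<longleftrightarrow> b \<le> ug_order G \<and> (\<forall>v\<in>alive b L. slack b L v \<le> \<Delta>)"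

lemma alive_bound: "good b L \<Longrightarrow> v \<in> alive b L \<Longrightarrow> v < ug_order G"
  by (auto simp: good_def alive_def)

lemma good_Nil: "b \<le> ug_order G \<Longrightarrow> good b []"
  using N_length by (force simp: good_def slack_def alive_def intro: order_trans[OF length_filter_le])

lemma slack_pin: "c \<noteq> k \<Longrightarrow> slack b ((v, c) # L) v' = slack b L v' + of_bool (v' = v)"
  by (simp add: slack_def alive_Cons)

text \<open>Deleting \<open>u\<close> costs each of its neighbors one alive neighbor, which makes
  room for exactly the one pin that \<open>u\<close> will put on it.\<close>

lemma slack_delete_nbr:
  assumes g: "good b L" and u: "u \<in> alive b L" and v: "v \<in> alive b ((u, k) # L)"
  shows "slack b ((u, k) # L) v + of_bool (v \<in> set (N u)) \<le> \<Delta>"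
proof -
  have vu: "v \<in> alive b L" "v \<noteq> u" using v by (auto simp: alive_delete)
  have n: "v < ug_order G" "u < ug_order G" using g u vu alive_bound by auto
  have len: "length (filter P (N v)) = card {x \<in> set (N v). P x}" for P
    using distinct_card[OF distinct_filter[OF N_distinct[OF n(1)]]] by (metis set_filter)
  have "length (filter (\<lambda>v'. v' \<in> alive b ((u, k) # L)) (N v)) + of_bool (v \<in> set (N u))
      \<le> length (filter (\<lambda>v'. v' \<in> alive b L) (N v))"
  proof (cases "v \<in> set (N u)")
    case True
    then have "u \<in> set (N v)" using N_bound n by blast
    then have "{x \<in> set (N v). x \<in> alive b ((u, k) # L)} \<subset> {x \<in> set (N v). x \<in> alive b L}"
      using u by (auto simp: alive_delete)
    then have "card {x \<in> set (N v). x \<in> alive b ((u, k) # L)} < card {x \<in> set (N v). x \<in> alive b L}"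
      by (intro psubset_card_mono) auto
    then show ?thesis using True by (simp add: len)
  next
    case False
    then show ?thesis by (auto simp: len alive_delete intro!: card_mono)
  qed
  moreover have "slack b L v \<le> \<Delta>" using g vu by (simp add: good_def)
  ultimately show ?thesis using vu by (simp add: slack_def)
qed

text \<open>Each neighbor still to be pinned has a spare unit of slack, and distinctness of
  \<open>vs\<close> ensures that pinning one of them does not use up the unit of another. The strict
  length bound later absorbs the entry that deletes \<open>u\<close>.\<close>

lemma steps_good_aux:
  assumes "good b L" "distinct vs" "\<And>v. v \<in> set vs \<Longrightarrow> v \<in> alive b L \<Longrightarrow> slack b L v < \<Delta>"
    and "\<And>v. v \<in> set vs \<Longrightarrow> sig u v j < k"
    and "(v, c, M) \<in> set (steps b u j L vs)"
  shows "good b M \<and> v \<in> alive b M \<and> c < k \<and> length M < length L + length vs"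
  using assms
proof (induction vs arbitrary: L)
  case (Cons x vs)
  have s: "sig u x j \<noteq> k" using Cons.prems(4)[of x] by auto
  show ?case
  proof (cases "x \<in> alive b L")
    case True
    let ?L = "(x, sig u x j) # L"
    have g: "good b ?L" using Cons.prems(1) Cons.prems(3)[of x] True s by (fastforce simp: good_def alive_Cons slack_pin)
    consider "(v, c, M) = (x, sig u x j, L)" | "(v, c, M) \<in> set (steps b u j ?L vs)"
      using Cons.prems(5) True by auto
    then show ?thesis
    proof cases
      case 1
      then show ?thesis using Cons.prems True by auto
    next
      case 2
      have "good b M \<and> v \<in> alive b M \<and> c < k \<and> length M < length ?L + length vs"
        by (rule Cons.IH[OF g _ _ _ 2])
           (use Cons.prems(2,3,4) s in \<open>auto simp: alive_Cons slack_pin\<close>)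
      then show ?thesis by simp
    qed
  next
    case False
    then show ?thesis using Cons.IH[OF Cons.prems(1)] Cons.prems by fastforce
  qed
qed simp

lemma steps_good:
  assumes g: "good b L" and u: "u \<in> alive b L" and j: "j < k"
    and m: "(v, c, M) \<in> set (steps b u j ((u, k) # L) (N u))"
  shows "good b M" "v \<in> alive b M" "c < k" "length M \<le> length L + \<Delta>"
proof -
  have n: "u < ug_order G" using g u by (rule alive_bound)
  have "good b ((u, k) # L)"
    using slack_delete_nbr[OF g u] g by (fastforce simp: good_def)
  then have "good b M \<and> v \<in> alive b M \<and> c < k \<and> length M < length ((u, k) # L) + length (N u)"
    by (rule steps_good_aux[OF _ N_distinct[OF n] _ _ m])
       (use slack_delete_nbr[OF g u] sig_less[OF n _ j] in fastforce)+
  then show "good b M" "v \<in> alive b M" "c < k" "length M \<le> length L + \<Delta>"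
    using N_length[OF n] by auto
qed

section \<open>Bounds for weights and marginals\<close>

lemma length_steps:
  assumes "\<And>v. v \<in> set vs \<Longrightarrow> sig u v j < k"
  shows "length (steps b u j L vs) = length (filter (\<lambda>v. v \<in> alive b L) vs)"
  using assms
proof (induction vs arbitrary: L)
  case (Cons v vs)
  then have "sig u v j \<noteq> k" by fastforce
  then show ?case using Cons by (simp add: alive_Cons)
qed simp

text \<open>The exact weights and the estimates differ only in the numbers \<open>q\<close> used as
  child marginals; with \<open>q\<close> abstract, bounds and contraction are proved once for
  both.\<close>

definition kid_weight :: "(nat \<times> nat \<times> (nat \<times> nat) list \<Rightarrow> real) \<Rightarrow> nat \<Rightarrow> (nat \<times> nat) list \<Rightarrow> nat \<Rightarrow> nat \<Rightarrow> real" where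
  "kid_weight q b L u i = w ^ count_list L (u, i) *
     (\<Prod>x\<leftarrow>steps b u i ((u, k) # L) (N u). 1 + (w - 1) * q x)"

lemma marg_weight_eq: "marg_weight b L u i = kid_weight (\<lambda>(v, c, M). marg b M v c) b L u i"
  unfolding marg_weight_def kid_weight_def by (simp add: case_prod_unfold)

lemma est_Suc_kid_weight: "est (Suc e) b L u i = kid_weight (\<lambda>(v, c, M). est_marg e b M v c) b L u i"
  unfolding est_Suc kid_weight_def by (simp add: case_prod_unfold)

lemma est_0_kid_weight: "est 0 b L u i = kid_weight (\<lambda>_. 0) b L u i"
  by (simp add: kid_weight_def map_replicate_const prod_list_replicate)

text \<open>The upper bound on \<open>lam\<close> enters here: the largest conceivable weight
  \<open>exp lam\<close> is below the number of colors by a factor of at least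
  \<open>e\<close>.\<close>

lemma exp_lam_le: "exp lam / real k \<le> exp (- 1)"
proof -
  have "exp lam \<le> exp (ln (real k) - 1)" using lam_le by simp
  also have "\<dots> = real k * exp (- 1)" using k3 by (simp add: exp_diff exp_minus field_simps)
  finally show ?thesis using k3 by (simp add: field_simps)
qed

text \<open>
  A vertex with \<open>d\<close> free neighbors has at most \<open>\<Delta> - d\<close> pins; this trade-off gives the
  exponential decay in \<open>lam * d / \<Delta>\<close>.
\<close>

lemma kid_weight_bounds:
  assumes g: "good b L" and u: "u \<in> alive b L" and i: "i < k"
    and q: "\<And>x. x \<in> set (steps b u i ((u, k) # L) (N u)) \<Longrightarrow> 0 \<le> q x \<and> q x \<le> Q"
    and d: "d = length (filter (\<lambda>v. v \<in> alive b L) (N u))"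
  shows "1 \<le> kid_weight q b L u i" "kid_weight q b L u i \<le> exp (lam - lam * real d / real \<Delta> * (1 - Q))" "d \<le> \<Delta>"
    and "length (steps b u i ((u, k) # L) (N u)) = d"
proof -
  have n: "u < ug_order G" using g u by (rule alive_bound)
  have "length (steps b u i ((u, k) # L) (N u)) = length (filter (\<lambda>v. v \<in> alive b ((u, k) # L)) (N u))"
    using sig_less n i by (intro length_steps) auto
  also have "\<dots> = d" unfolding d using N_bound[OF n] by (auto simp: alive_delete intro!: arg_cong[where f = length] filter_cong)
  finally show l: "length (steps b u i ((u, k) # L) (N u)) = d" .
  have "count_list L (u, i) \<le> length (filter (\<lambda>p. fst p = u) L)" by (induction L) auto
  moreover have sl: "length (filter (\<lambda>p. fst p = u) L) + d \<le> \<Delta>"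
    using g u by (simp add: good_def slack_def d)
  ultimately have cnt: "count_list L (u, i) + d \<le> \<Delta>" by simp
  then show "d \<le> \<Delta>" by simp
  have t: "0 \<le> w - 1" using w_ge1 by simp
  note pb = prod_list_bounds[of "w - 1" "steps b u i ((u, k) # L) (N u)" q Q, OF t q]
  have 1: "1 \<le> w ^ count_list L (u, i)" using w_ge1 by simp
  have "w \<le> exp (lam / real \<Delta>)" unfolding w_def by (rule exp_ge_add_one_self)
  then have "w ^ count_list L (u, i) \<le> exp (lam / real \<Delta>) ^ count_list L (u, i)"
    using w_ge1 by (intro power_mono) auto
  also have "\<dots> \<le> exp (lam / real \<Delta>) ^ (\<Delta> - d)"
    using cnt lam_nonneg by (intro power_increasing) auto
  also have "\<dots> = exp (lam - lam * real d / real \<Delta>)"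
    using \<open>d \<le> \<Delta>\<close> D3 by (simp add: exp_of_nat_mult[symmetric] of_nat_diff field_simps)
  finally have 2: "w ^ count_list L (u, i) \<le> exp (lam - lam * real d / real \<Delta>)" .
  have "1 * 1 \<le> kid_weight q b L u i" unfolding kid_weight_def using 1 pb by (intro mult_mono) auto
  then show "1 \<le> kid_weight q b L u i" by simp
  have "kid_weight q b L u i \<le> exp (lam - lam * real d / real \<Delta>) * exp ((w - 1) * Q * real d)"
    unfolding kid_weight_def using pb 2 l 1 by (intro mult_mono) auto
  also have "\<dots> = exp (lam - lam * real d / real \<Delta> * (1 - Q))"
    unfolding exp_add[symmetric] by (simp add: w_def right_diff_distrib diff_divide_distrib mult_ac)
  finally show "kid_weight q b L u i \<le> exp (lam - lam * real d / real \<Delta> * (1 - Q))" .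
qed

text \<open>All weights are at least 1, so the denominator is at least \<open>k\<close>, while the
  numerator obeys the upper bound of \<open>kid_weight_bounds\<close>.\<close>

lemma kid_weight_normalized:
  assumes g: "good b L" and u: "u \<in> alive b L" and i: "i < k"
    and q: "\<And>x j. j < k \<Longrightarrow> x \<in> set (steps b u j ((u, k) # L) (N u)) \<Longrightarrow> 0 \<le> q x \<and> q x \<le> Q"
    and d: "d = length (filter (\<lambda>v. v \<in> alive b L) (N u))"
  shows "0 \<le> kid_weight q b L u i / (\<Sum>j<k. kid_weight q b L u j)"
    and "kid_weight q b L u i / (\<Sum>j<k. kid_weight q b L u j) \<le> exp (- 1 - lam * real d / real \<Delta> * (1 - Q))"
proof -
  have gb: "1 \<le> kid_weight q b L u j" "kid_weight q b L u j \<le> exp (lam - lam * real d / real \<Delta> * (1 - Q))" if "j < k" for j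
    using kid_weight_bounds(1,2)[OF g u that _ d, of q Q] q[OF that] by blast+
  have "(\<Sum>j<k. 1) \<le> (\<Sum>j<k. kid_weight q b L u j)" using gb(1) by (intro sum_mono) auto
  then have S: "real k \<le> (\<Sum>j<k. kid_weight q b L u j)" by simp
  then show "0 \<le> kid_weight q b L u i / (\<Sum>j<k. kid_weight q b L u j)" using gb(1)[OF i] i by simp
  have "kid_weight q b L u i / (\<Sum>j<k. kid_weight q b L u j) \<le> exp (lam - lam * real d / real \<Delta> * (1 - Q)) / real k"
    using gb(1,2)[OF i] S i by (intro frac_le) auto
  also have "\<dots> = exp lam / real k * exp (- (lam * real d / real \<Delta> * (1 - Q)))"
    by (simp add: exp_diff exp_minus field_simps)
  also have "\<dots> \<le> exp (- 1) * exp (- (lam * real d / real \<Delta> * (1 - Q)))"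
    using exp_lam_le by (intro mult_right_mono) auto
  also have "\<dots> = exp (- 1 - lam * real d / real \<Delta> * (1 - Q))"
    unfolding exp_add[symmetric] by simp
  finally show "kid_weight q b L u i / (\<Sum>j<k. kid_weight q b L u j) \<le> exp (- 1 - lam * real d / real \<Delta> * (1 - Q))" .
qed

text \<open>Bootstrap: the trivial bound \<open>Q = 1\<close> for the child marginals already gives
  \<open>exp (- 1)\<close> one level up, and \<open>Q = exp (- 1)\<close> is then available for the
  contraction.\<close>

lemma kid_weight_normalized_01:
  assumes "good b L" "u \<in> alive b L" "i < k"
    and "\<And>x j. j < k \<Longrightarrow> x \<in> set (steps b u j ((u, k) # L) (N u)) \<Longrightarrow> 0 \<le> q x \<and> q x \<le> 1"
  shows "0 \<le> kid_weight q b L u i / (\<Sum>j<k. kid_weight q b L u j)" "kid_weight q b L u i / (\<Sum>j<k. kid_weight q b L u j) \<le> exp (- 1)"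
  using kid_weight_normalized[OF assms refl] by auto

lemma marg_01: "0 \<le> marg b L u i" "marg b L u i \<le> 1"
proof -
  have "0 \<le> Zctx_at b L u i" unfolding Zctx_at_def by (intro sum_nonneg) (simp add: wt_pos less_imp_le)
  moreover have "Zctx_at b L u i \<le> Zctx b L" unfolding Zctx_at_def Zctx_def
    by (intro sum_mono2) (auto simp: finite_colorings wt_pos less_imp_le)
  ultimately show "0 \<le> marg b L u i" "marg b L u i \<le> 1" using Zctx_pos[of b L] by (simp_all add: marg_def)
qed

lemma marg_kid_weight:
  assumes "good b L" "u \<in> alive b L" "i < k"
  shows "marg b L u i = kid_weight (\<lambda>(v, c, M). marg b M v c) b L u i / (\<Sum>j<k. kid_weight (\<lambda>(v, c, M). marg b M v c) b L u j)"
  using marg_eq[OF assms(2) alive_bound[OF assms(1,2)] assms(3)] by (simp add: marg_weight_eq)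

lemma marg_le:
  assumes "good b L" "u \<in> alive b L" "i < k"
  shows "marg b L u i \<le> exp (- 1)"
  unfolding marg_kid_weight[OF assms] by (rule kid_weight_normalized_01(2)[OF assms]) (auto simp: marg_01)

lemma est_marg_bounds:
  assumes "good b L" "u \<in> alive b L" "i < k"
  shows "0 \<le> est_marg e b L u i \<and> est_marg e b L u i \<le> exp (- 1)"
  using assms
proof (induction e arbitrary: L u i)
  case 0
  show ?case unfolding est_marg_def est_0_kid_weight using kid_weight_normalized_01[OF 0] by simp
next
  case (Suc e)
  let ?q = "\<lambda>(v, c, M). est_marg e b M v c"
  have q: "0 \<le> ?q x \<and> ?q x \<le> 1" if "j < k" "x \<in> set (steps b u j ((u, k) # L) (N u))" for x j
  proof -
    obtain v c M where x: "x = (v, c, M)" by (cases x)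
    have "exp (- 1 :: real) \<le> 1" by simp
    then show ?thesis
      using Suc.IH[OF steps_good(1-3)[OF Suc.prems(1,2) that(1) that(2)[unfolded x]]] unfolding x
      by (simp del: exp_le_one_iff)
  qed
  show ?case unfolding est_marg_def[of "Suc e"] est_Suc_kid_weight using kid_weight_normalized_01[OF Suc.prems, of ?q] q by simp
qed

section \<open>Contraction and accuracy of the estimates\<close>

lemma kid_weight_close:
  assumes g: "good b L" and u: "u \<in> alive b L" and i: "i < k" and \<epsilon>: "0 \<le> \<epsilon>"
    and q: "\<And>x. x \<in> set (steps b u i ((u, k) # L) (N u)) \<Longrightarrow> 0 \<le> q x \<and> 0 \<le> q' x \<and> q x \<le> q' x + \<epsilon>"
    and d: "d = length (filter (\<lambda>v. v \<in> alive b L) (N u))"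
  shows "kid_weight q b L u i \<le> exp (lam * real d / real \<Delta> * \<epsilon>) * kid_weight q' b L u i"
proof -
  have "(\<Prod>x\<leftarrow>steps b u i ((u, k) # L) (N u). 1 + (w - 1) * q x) \<le>
      exp ((w - 1) * \<epsilon> * real (length (steps b u i ((u, k) # L) (N u)))) *
        (\<Prod>x\<leftarrow>steps b u i ((u, k) # L) (N u). 1 + (w - 1) * q' x)"
    using prod_list_close[of "w - 1" \<epsilon> "steps b u i ((u, k) # L) (N u)" q q'] w_ge1 \<epsilon> q by simp
  moreover have "length (steps b u i ((u, k) # L) (N u)) = d"
    using kid_weight_bounds(4)[OF g u i _ d, of "\<lambda>_. 0" 0] by simp
  moreover have "(w - 1) * \<epsilon> * real d = lam * real d / real \<Delta> * \<epsilon>" by (simp add: w_def)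
  ultimately show ?thesis using w_ge1 by (simp add: kid_weight_def mult.left_commute)
qed

text \<open>The same \<open>?y\<close> measures how strongly a weight reacts to errors
  (\<open>\<eta> = ?y * \<epsilon>\<close>) and how small the marginal is forced to be. The product
  of both effects is at most 1/2, whatever the number \<open>d\<close> of free neighbors is.\<close>

lemma kid_weight_contraction:
  assumes g: "good b L" and u: "u \<in> alive b L" and i: "i < k" and \<epsilon>: "0 \<le> \<epsilon>"
    and q: "\<And>x j. j < k \<Longrightarrow> x \<in> set (steps b u j ((u, k) # L) (N u)) \<Longrightarrow>
      0 \<le> q x \<and> q x \<le> exp (- 1) \<and> 0 \<le> q' x \<and> q' x \<le> exp (- 1) \<and> q x \<le> q' x + \<epsilon> \<and> q' x \<le> q x + \<epsilon>"
  shows "kid_weight q b L u i / (\<Sum>j<k. kid_weight q b L u j) \<le> kid_weight q' b L u i / (\<Sum>j<k. kid_weight q' b L u j) + \<epsilon> / 2"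
proof -
  define d where d: "d = length (filter (\<lambda>v. v \<in> alive b L) (N u))"
  let ?y = "lam * real d / real \<Delta>"
  have "kid_weight q b L u i / (\<Sum>j<k. kid_weight q b L u j) \<le> kid_weight q' b L u i / (\<Sum>j<k. kid_weight q' b L u j)
      + 2 * (?y * \<epsilon>) * exp (- 1 - ?y * (1 - exp (- 1)))"
  proof (rule normalized_close)
    fix j assume j: "j < k"
    show "0 < kid_weight q b L u j \<and> 0 < kid_weight q' b L u j"
      using kid_weight_bounds(1)[OF g u j _ d, of q "exp (- 1)"] kid_weight_bounds(1)[OF g u j _ d, of q' "exp (- 1)"] q[OF j] by fastforce
    show "kid_weight q b L u j \<le> exp (?y * \<epsilon>) * kid_weight q' b L u j \<and> kid_weight q' b L u j \<le> exp (?y * \<epsilon>) * kid_weight q b L u j"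
      using kid_weight_close[OF g u j \<epsilon> _ d, of q q'] kid_weight_close[OF g u j \<epsilon> _ d, of q' q] q[OF j] by blast
  qed (use kid_weight_normalized(2)[OF g u i _ d] q i \<epsilon> lam_nonneg in auto)
  also have "2 * (?y * \<epsilon>) * exp (- 1 - ?y * (1 - exp (- 1))) = \<epsilon> * (2 * ?y * exp (- 1 - ?y * (1 - exp (- 1))))"
    by simp
  also have "\<dots> \<le> \<epsilon> * (1 / 2)" using \<epsilon> by (intro mult_left_mono contraction_constant) auto
  finally show ?thesis by simp
qed

lemma est_marg_close:
  assumes "good b L" "u \<in> alive b L" "i < k"
  shows "marg b L u i \<le> est_marg e b L u i + (1 / 2) ^ e \<and> est_marg e b L u i \<le> marg b L u i + (1 / 2) ^ e"
  using assms
proof (induction e arbitrary: L u i)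
  case 0
  have "exp (- 1 :: real) \<le> 1" by simp
  then show ?case using marg_le[OF 0] est_marg_bounds[OF 0, of 0] marg_01[of b L u i]
    by (simp del: exp_le_one_iff)
next
  case (Suc e)
  let ?q = "\<lambda>(v, c, M). marg b M v c" and ?q' = "\<lambda>(v, c, M). est_marg e b M v c"
  have q: "0 \<le> ?q x \<and> ?q x \<le> exp (- 1) \<and> 0 \<le> ?q' x \<and> ?q' x \<le> exp (- 1) \<and>
      ?q x \<le> ?q' x + (1 / 2) ^ e \<and> ?q' x \<le> ?q x + (1 / 2) ^ e"
    if "j < k" "x \<in> set (steps b u j ((u, k) # L) (N u))" for x j
  proof -
    obtain v c M where x: "x = (v, c, M)" by (cases x)
    note st = steps_good(1-3)[OF Suc.prems(1,2) that(1) that(2)[unfolded x]]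
    show ?thesis unfolding x using Suc.IH[OF st] marg_le[OF st] marg_01 est_marg_bounds[OF st] by simp
  qed
  show ?case
    using kid_weight_contraction[OF Suc.prems, of "(1 / 2) ^ e" ?q ?q'] q
      kid_weight_contraction[OF Suc.prems, of "(1 / 2) ^ e" ?q' ?q]
    unfolding marg_kid_weight[OF Suc.prems] est_marg_def[of "Suc e"] est_Suc_kid_weight by simp
qed

text \<open>Without normalization the child errors are only scaled, by at most \<open>lam\<close>.
  Writing the child error as \<open>2 * (1 / 2) ^ e\<close> covers both cases: for
  \<open>e = Suc e'\<close> it is \<open>(1 / 2) ^ e'\<close>, and for \<open>e = 0\<close> it
  exceeds the trivial distance 1 from the child value 0.\<close>

lemma root_close:
  assumes r: "r < ug_order G" and i: "i < k"
  shows "marg_weight (Suc r) [] r i \<le> exp (lam * 2 * (1 / 2) ^ e) * est e (Suc r) [] r i \<and>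
    est e (Suc r) [] r i \<le> exp (lam * 2 * (1 / 2) ^ e) * marg_weight (Suc r) [] r i \<and> 0 < est e (Suc r) [] r i"
proof -
  have g: "good (Suc r) []" using r by (intro good_Nil) simp
  have u: "r \<in> alive (Suc r) []" by (simp add: alive_def)
  define d where d: "d = length (filter (\<lambda>v. v \<in> alive (Suc r) []) (N r))"
  define q' where "q' = (case e of 0 \<Rightarrow> \<lambda>_. 0 | Suc e' \<Rightarrow> \<lambda>(v, c, M). est_marg e' (Suc r) M v c)"
  let ?q = "\<lambda>(v, c, M). marg (Suc r) M v c"
  have est: "est e (Suc r) [] r i = kid_weight q' (Suc r) [] r i"
    by (cases e) (simp_all only: q'_def est_0_kid_weight est_Suc_kid_weight nat.case)
  have q: "0 \<le> ?q x \<and> 0 \<le> q' x \<and> q' x \<le> 1 \<and> ?q x \<le> q' x + 2 * (1 / 2) ^ e \<and> q' x \<le> ?q x + 2 * (1 / 2) ^ e"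
    if "x \<in> set (steps (Suc r) r i [(r, k)] (N r))" for x
  proof -
    obtain v c M where x: "x = (v, c, M)" by (cases x)
    note st = steps_good(1-3)[OF g u i that[unfolded x]]
    show ?thesis
    proof (cases e)
      case 0
      show ?thesis unfolding x q'_def 0 using marg_01[of "Suc r" M v c] by simp
    next
      case (Suc e')
      have "exp (- 1 :: real) \<le> 1" by simp
      then show ?thesis unfolding x q'_def Suc using marg_01 est_marg_close[OF st, of e'] est_marg_bounds[OF st, of e']
        by (simp del: exp_le_one_iff)
    qed
  qed
  have "d \<le> \<Delta>" using kid_weight_bounds(3)[OF g u i _ d, of "\<lambda>_. 0" 0] by simp
  then have "lam * real d / real \<Delta> * (2 * (1 / 2) ^ e) \<le> lam * 2 * (1 / 2) ^ e"
    using lam_nonneg D3 by (simp add: field_simps mult_left_mono)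
  then have ex: "exp (lam * real d / real \<Delta> * (2 * (1 / 2) ^ e)) \<le> exp (lam * 2 * (1 / 2) ^ e)" by simp
  have pos: "0 < kid_weight ?q (Suc r) [] r i" "0 < kid_weight q' (Suc r) [] r i"
    using kid_weight_bounds(1)[OF g u i _ d, of ?q 1] kid_weight_bounds(1)[OF g u i _ d, of q' 1] q marg_01
    by (force simp: split_beta)+
  have "kid_weight ?q (Suc r) [] r i \<le> exp (lam * real d / real \<Delta> * (2 * (1 / 2) ^ e)) * kid_weight q' (Suc r) [] r i"
    by (rule kid_weight_close[OF g u i _ _ d]) (use q in auto)
  moreover have "kid_weight q' (Suc r) [] r i \<le> exp (lam * real d / real \<Delta> * (2 * (1 / 2) ^ e)) * kid_weight ?q (Suc r) [] r i"
    by (rule kid_weight_close[OF g u i _ _ d]) (use q in auto)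
  ultimately show ?thesis unfolding est marg_weight_eq using pos mult_right_mono[OF ex] by (smt (verit))
qed

definition approx :: "nat \<Rightarrow> real" where
  "approx e = (\<Prod>r<ug_order G. \<Sum>j<k. est e (Suc r) [] r j)"

lemma approx_close:
  shows "ug_partition k G w \<le> exp (real (ug_order G) * (lam * 2 * (1 / 2) ^ e)) * approx e"
    and "approx e \<le> exp (real (ug_order G) * (lam * 2 * (1 / 2) ^ e)) * ug_partition k G w"
    and "0 < approx e"
proof -
  let ?c = "exp (lam * 2 * (1 / 2) ^ e)" and ?n = "ug_order G"
  have ex: "exp (real ?n * (lam * 2 * (1 / 2) ^ e)) = (\<Prod>r<?n. ?c)"
    by (simp add: exp_of_nat_mult)
  have pos: "0 < (\<Sum>j<k. marg_weight (Suc r) [] r j)" "0 < (\<Sum>j<k. est e (Suc r) [] r j)" if "r < ?n" for r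
  proof -
    show "0 < (\<Sum>j<k. est e (Suc r) [] r j)" using root_close[OF that] k3 by (intro sum_pos) (auto simp: lessThan_empty_iff)
    have "0 < marg_weight (Suc r) [] r j" if "j < k" for j
      using root_close[OF \<open>r < ?n\<close> that, of e] by (smt (verit) exp_gt_zero zero_less_mult_pos)
    then show "0 < (\<Sum>j<k. marg_weight (Suc r) [] r j)" using k3 by (intro sum_pos) (auto simp: lessThan_empty_iff)
  qed
  show "0 < approx e" unfolding approx_def using pos by (intro prod_pos) auto
  show "ug_partition k G w \<le> exp (real ?n * (lam * 2 * (1 / 2) ^ e)) * approx e"
    unfolding partition_eq approx_def ex prod.distrib[symmetric] 
    using root_close pos by (intro prod_mono) (auto simp: sum_distrib_left less_imp_le intro!: sum_mono)
  show "approx e \<le> exp (real ?n * (lam * 2 * (1 / 2) ^ e)) * ug_partition k G w"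
    unfolding partition_eq approx_def ex prod.distrib[symmetric] 
    using root_close pos by (intro prod_mono) (auto simp: sum_distrib_left less_imp_le intro!: sum_mono)
qed

section \<open>Dependence of the partition function on the edge weight\<close>

lemma card_edges: "card (ug_edges G) \<le> ug_order G * \<Delta>"
proof -
  have "ug_edges G \<subseteq> (SIGMA u:{..<ug_order G}. set (N u))"
    using N_set edgeD by auto
  then have "card (ug_edges G) \<le> card (SIGMA u:{..<ug_order G}. set (N u))" by (intro card_mono) auto
  also have "\<dots> = (\<Sum>u<ug_order G. card (set (N u)))" by simp
  also have "\<dots> \<le> (\<Sum>u<ug_order G. \<Delta>)"
    using N_length card_length le_trans by (intro sum_mono) blast
  finally show ?thesis by simp
qed

text \<open>Carries the estimate over from the weight that the program uses to the prescribed one.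
  For \<open>y\<close> at least 1, replacing \<open>y\<close> by \<open>z\<close> changes each
  factor by at most \<open>exp (z - y)\<close>, and a coloring has at most
  \<open>ug_order G * \<Delta>\<close> factors.\<close>

lemma partition_mono:
  fixes y z :: real
  assumes "1 \<le> y" "y \<le> z"
  shows "0 < ug_partition k G y" "ug_partition k G y \<le> ug_partition k G z"
    and "ug_partition k G z \<le> exp (real (ug_order G) * real \<Delta> * (z - y)) * ug_partition k G y"
proof -
  have c: "card (ug_satisfied G x) \<le> ug_order G * \<Delta>" for x
    by (rule order_trans[OF card_mono card_edges]) (auto simp: finite_edges ug_satisfied_def)
  show "ug_partition k G y \<le> ug_partition k G z"
    unfolding ug_partition_def using assms by (intro sum_mono) (auto intro!: power_mono)
  have "(\<lambda>v\<in>{..<ug_order G}. 0) \<in> ug_colorings k G" using k3 by (auto simp: ug_colorings_def)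
  then show "0 < ug_partition k G y"
    unfolding ug_partition_def using finite_colorings assms by (intro sum_pos) auto
  have "z \<le> y * (1 + (z - y))" using assms mult_right_mono[of 1 y "z - y"] by (simp add: algebra_simps)
  also have "\<dots> \<le> y * exp (z - y)" using assms exp_ge_add_one_self[of "z - y"] by (intro mult_left_mono) auto
  finally have z: "z \<le> y * exp (z - y)" .
  have "z ^ m \<le> exp (real (ug_order G) * real \<Delta> * (z - y)) * y ^ m" if "m \<le> ug_order G * \<Delta>" for m
  proof -
    have "z ^ m \<le> (y * exp (z - y)) ^ m" using z assms by (intro power_mono) auto
    also have "\<dots> = y ^ m * exp (z - y) ^ m" by (simp add: power_mult_distrib)
    also have "exp (z - y) ^ m \<le> exp (z - y) ^ (ug_order G * \<Delta>)" using assms that by (intro power_increasing) auto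
    also have "exp (z - y) ^ (ug_order G * \<Delta>) = exp (real (ug_order G) * real \<Delta> * (z - y))"
      by (simp add: exp_of_nat_mult[symmetric])
    finally show ?thesis using assms by (simp add: mult.commute)
  qed
  then show "ug_partition k G z \<le> exp (real (ug_order G) * real \<Delta> * (z - y)) * ug_partition k G y"
    unfolding ug_partition_def using c by (auto simp: sum_distrib_left intro!: sum_mono)
qed

end

section \<open>Weakest preconditions with time\<close>

text \<open>The final state and total time satisfy \<open>Q\<close> if \<open>c\<close> starts in \<open>s\<close> after \<open>t\<close> time units.\<close>

definition wp :: "prog \<Rightarrow> (state \<Rightarrow> nat \<Rightarrow> bool) \<Rightarrow> state \<Rightarrow> nat \<Rightarrow> bool" where
  "wp c Q s t \<longleftrightarrow> (\<exists>t' s'. exec c s t' s' \<and> Q s' (t + t'))"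

text \<open>Determinism makes this rule, like the next ones, an equivalence, so straight-line code
  is executed symbolically by rewriting. Loops are treated by induction with one-sided
  rules.\<close>

lemma wp_Skip: "wp Skip Q s t \<longleftrightarrow> Q s (t + 1)"
  unfolding wp_def by (metis exec.Skip exec_deterministic)

lemma wp_Oper: "wp (Oper a) Q s t \<longleftrightarrow> Q (step a s) (t + 1)"
  unfolding wp_def by (metis exec.Oper exec_deterministic)

lemma wp_Seq: "wp (Seq c d) Q s t \<longleftrightarrow> wp c (wp d Q) s t"
proof
  assume "wp (Seq c d) Q s t"
  then show "wp c (wp d Q) s t"
    unfolding wp_def by (fastforce elim!: exec_SeqE simp: add.assoc)
next
  assume "wp c (wp d Q) s t"
  then show "wp (Seq c d) Q s t"
    unfolding wp_def by (metis exec.Seq add.assoc)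
qed

lemma wp_If: "wp (If b c d) Q s t \<longleftrightarrow> (if holds b s then wp c Q s (t + 1) else wp d Q s (t + 1))"
proof (cases "holds b s")
  case True
  show ?thesis
  proof
    assume "wp (If b c d) Q s t"
    then show "if holds b s then wp c Q s (t + 1) else wp d Q s (t + 1)"
      using True unfolding wp_def by (fastforce elim!: exec_IfE)
  next
    assume "if holds b s then wp c Q s (t + 1) else wp d Q s (t + 1)"
    then show "wp (If b c d) Q s t" using True unfolding wp_def by (metis exec.IfTrue add.assoc)
  qed
next
  case False
  show ?thesis
  proof
    assume "wp (If b c d) Q s t"
    then show "if holds b s then wp c Q s (t + 1) else wp d Q s (t + 1)"
      using False unfolding wp_def by (fastforce elim!: exec_IfE)
  next
    assume "if holds b s then wp c Q s (t + 1) else wp d Q s (t + 1)"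
    then show "wp (If b c d) Q s t" using False unfolding wp_def by (metis exec.IfFalse add.assoc)
  qed
qed

lemma wp_While_True: "holds b s \<Longrightarrow> wp c (wp (While b c) Q) s (t + 1) \<Longrightarrow> wp (While b c) Q s t"
  unfolding wp_def by (metis (no_types, lifting) exec.WhileTrue add.assoc)

lemma wp_While_False: "\<not> holds b s \<Longrightarrow> Q s (t + 1) \<Longrightarrow> wp (While b c) Q s t"
  unfolding wp_def by (metis exec.WhileFalse)

lemma wp_mono: "wp c Q s t \<Longrightarrow> (\<And>s' t'. Q s' t' \<Longrightarrow> Q' s' t') \<Longrightarrow> wp c Q' s t"
  unfolding wp_def by blast

fun seqs :: "prog list \<Rightarrow> prog" where
  "seqs [] = Skip"
| "seqs (c # cs) = Seq c (seqs cs)"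

text \<open>Access at a constant offset from an address register; register 9 is scratch.\<close>

definition ld :: "nat \<Rightarrow> nat \<Rightarrow> nat \<Rightarrow> prog" where
  "ld x a c = seqs [Oper (NConst 9 c), Oper (NAdd 9 a 9), Oper (NLoad x 9)]"

definition st :: "nat \<Rightarrow> nat \<Rightarrow> nat \<Rightarrow> prog" where
  "st a c x = seqs [Oper (NConst 9 c), Oper (NAdd 9 a 9), Oper (NStore 9 x)]"

definition rld :: "nat \<Rightarrow> nat \<Rightarrow> nat \<Rightarrow> prog" where
  "rld x a c = seqs [Oper (NConst 9 c), Oper (NAdd 9 a 9), Oper (RLoad x 9)]"

definition rst :: "nat \<Rightarrow> nat \<Rightarrow> nat \<Rightarrow> prog" where
  "rst a c x = seqs [Oper (NConst 9 c), Oper (NAdd 9 a 9), Oper (RStore 9 x)]"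

lemma wp_ld: "a \<noteq> 9 \<Longrightarrow> wp (ld x a c) Q s t \<longleftrightarrow>
    Q (s\<lparr>nreg := (nreg s)(9 := nreg s a + c, x := nmem s (nreg s a + c))\<rparr>) (t + 4)"
  by (simp add: ld_def wp_Skip wp_Oper wp_Seq add.commute[of t] eval_nat_numeral)

lemma wp_st: "a \<noteq> 9 \<Longrightarrow> x \<noteq> 9 \<Longrightarrow> wp (st a c x) Q s t \<longleftrightarrow>
    Q (s\<lparr>nreg := (nreg s)(9 := nreg s a + c), nmem := (nmem s)(nreg s a + c := nreg s x)\<rparr>) (t + 4)"
  by (simp add: st_def wp_Skip wp_Oper wp_Seq add.commute[of t] eval_nat_numeral)

lemma wp_rld: "a \<noteq> 9 \<Longrightarrow> wp (rld x a c) Q s t \<longleftrightarrow>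
    Q (s\<lparr>nreg := (nreg s)(9 := nreg s a + c), rreg := (rreg s)(x := rmem s (nreg s a + c))\<rparr>) (t + 4)"
  by (simp add: rld_def wp_Skip wp_Oper wp_Seq add.commute[of t] eval_nat_numeral)

lemma wp_rst: "a \<noteq> 9 \<Longrightarrow> wp (rst a c x) Q s t \<longleftrightarrow>
    Q (s\<lparr>nreg := (nreg s)(9 := nreg s a + c), rmem := (rmem s)(nreg s a + c := rreg s x)\<rparr>) (t + 4)"
  by (simp add: rst_def wp_Skip wp_Oper wp_Seq add.commute[of t] eval_nat_numeral)

lemmas wp_simps = seqs.simps wp_Skip wp_Oper wp_Seq wp_If wp_ld wp_st wp_rld wp_rst

text \<open>Stands in for a loop over the \<open>k\<close> colors: the code of iteration
  \<open>i\<close> may contain \<open>i\<close> as a constant, which replaces a counter and address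
  arithmetic.\<close>

lemma wp_unrolled:
  assumes "\<And>i s t. i < m \<Longrightarrow> I i s \<Longrightarrow> wp (body i) (\<lambda>s' t'. I (Suc i) s' \<and> t' \<le> t + T) s t"
    and "I 0 s"
  shows "wp (seqs (map body [0..<m])) (\<lambda>s' t'. I m s' \<and> t' \<le> t + m * T + 1) s t"
proof -
  have "I i s \<Longrightarrow> i \<le> m \<Longrightarrow> wp (seqs (map body [i..<m])) (\<lambda>s' t'. I m s' \<and> t' \<le> t + (m - i) * T + 1) s t" for i s t
  proof (induction "m - i" arbitrary: i s t)
    case 0
    then show ?case by (simp add: wp_Skip)
  next
    case (Suc d)
    then have i: "i < m" "d = m - Suc i" by simp_all
    have "(m - i) * T = T + (m - Suc i) * T" using i by (metis Suc.hyps(2) mult_Suc)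
    then show ?case unfolding upt_conv_Cons[OF i(1)]
      using assms(1)[OF i(1) Suc.prems(1), of t] i
      by (auto simp: wp_Seq intro!: wp_mono[OF assms(1)[OF i(1) Suc.prems(1), of t]] wp_mono[OF Suc.hyps(1)[OF i(2)]])
  qed
  from this[of 0 s t] assms(2) show ?thesis by simp
qed

text \<open>Address 0 holds the number of vertices and serves as the end marker of linked lists.\<close>

fun is_ctx :: "nat \<Rightarrow> nat \<Rightarrow> (nat \<Rightarrow> nat) \<Rightarrow> nat \<Rightarrow> (nat \<times> nat) list \<Rightarrow> bool" where
  "is_ctx k b mem p [] \<longleftrightarrow> p = 0"
| "is_ctx k b mem p ((v, c) # L) \<longleftrightarrow> 0 < p \<and> p + 2 < b \<and> mem p = v \<and> mem (p + 1) = c \<and> c \<le> k \<and>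
    is_ctx k b mem (mem (p + 2)) L"

text \<open>A context uses cells below \<open>b\<close> only, so records appended at
  \<open>b\<close> or later leave it intact.\<close>

lemma is_ctx_cong:
  "is_ctx k b mem p L \<Longrightarrow> (\<And>x. x < b \<Longrightarrow> mem' x = mem x) \<Longrightarrow> b \<le> b' \<Longrightarrow> is_ctx k b' mem' p L"
proof (induction L arbitrary: p)
  case (Cons a L)
  then show ?case by (cases a) auto
qed simp

definition same :: "nat set \<Rightarrow> state \<Rightarrow> state \<Rightarrow> bool" where
  "same X s s' \<longleftrightarrow> (\<forall>i. i \<notin> X \<longrightarrow> nreg s' i = nreg s i)"

text \<open>
  Registers: 0, 1 and 2 hold the constants 0, 1 and \<open>k\<close>, 22 the size \<open>k + 9\<close> of a node record and 25 the
  size \<open>k + 2\<close> of an edge record; 3 the root, 4 the base of the node area (while the input is read, the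
  next free address), 5 the end of the node area, 6 the current node, 7 the address of the adjacency
  heads, 8 the tree depth, 23 the number of vertices, 24 the number of edges, 27 the input pointer.
  In the tree phase, 10 walks along a context, 14 is the deletion flag, 15 the neighbor, 16 its color,
  17 the context pointer, 18 the adjacency pointer, 19 the depth of the children and 20 the vertex of
  the current node; 11, 12, 13 and 21 are temporary.
  Real registers of the tree phase: 1 holds \<open>w\<close>, 2 holds \<open>w - 1\<close>, 3 holds 1, 6 the sum of the weights of
  the last evaluated node, 7 the product over the roots so far.
\<close>

definition scan_step :: prog where
  "scan_step = seqs [ld 11 10 0,
     If (NLe 11 15) (If (NLe 15 11)
       (seqs [ld 12 10 1,
          If (NLess 12 2)
            (seqs [Oper (NAdd 13 5 12), Oper (RLoad 4 13), Oper (RMul 4 4 1), Oper (RStore 13 4)])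
            (Oper (NConst 14 1))]) Skip) Skip,
     ld 10 10 2]"

definition scan_prog :: prog where "scan_prog = While (NLess 0 10) scan_step"

text \<open>One walk along the context serves two purposes: it multiplies the pins on the vertex
  into its \<open>k\<close> weight cells and detects whether the vertex has been deleted.\<close>

lemma wp_scan:
  assumes "is_ctx k b (nmem s) (nreg s 10) L" "nreg s 0 = 0" "nreg s 2 = k"
  shows "wp scan_prog (\<lambda>s' t'. nmem s' = nmem s \<and> same {9, 10, 11, 12, 13, 14} s s' \<and>
     (\<forall>i. i \<noteq> 4 \<longrightarrow> rreg s' i = rreg s i) \<and>
     nreg s' 14 = (if (nreg s 15, k) \<in> set L then 1 else nreg s 14) \<and>
     (\<forall>i<k. rmem s' (nreg s 5 + i) = rmem s (nreg s 5 + i) * rreg s 1 ^ count_list L (nreg s 15, i)) \<and>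
     (\<forall>x. x < nreg s 5 \<longrightarrow> rmem s' x = rmem s x) \<and>
     t' \<le> t + 30 * length L + 1) s t"
  using assms
proof (induction L arbitrary: s t)
  case Nil
  then show ?case unfolding scan_prog_def by (intro wp_While_False) (simp_all add: same_def)
next
  case (Cons a L)
  obtain v c where a: "a = (v, c)" by (cases a)
  have p: "0 < nreg s 10" "nmem s (nreg s 10) = v" "nmem s (nreg s 10 + 1) = c" "c \<le> k"
    "is_ctx k b (nmem s) (nmem s (nreg s 10 + 2)) L"
    using Cons.prems(1) by (simp_all add: a)
  show ?case (is "wp _ ?Q s t") unfolding scan_prog_def
  proof (rule wp_While_True)
    show "holds (NLess 0 10) s" using p Cons.prems by simp
    let ?X = "{9, 10, 11, 12, 13, 14 :: nat}"
    have "wp scan_step (\<lambda>s' t'. nmem s' = nmem s \<and> same ?X s s' \<and>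
       (\<forall>i. i \<noteq> 4 \<longrightarrow> rreg s' i = rreg s i) \<and> nreg s' 10 = nmem s (nreg s 10 + 2) \<and>
       nreg s' 14 = (if (nreg s 15, k) = (v, c) then 1 else nreg s 14) \<and>
       (\<forall>i<k. rmem s' (nreg s 5 + i) = rmem s (nreg s 5 + i) * rreg s 1 ^ (if (nreg s 15, i) = (v, c) then 1 else 0)) \<and>
       (\<forall>x. x < nreg s 5 \<longrightarrow> rmem s' x = rmem s x) \<and> t' \<le> t + 30) s (t + 1)"
      unfolding scan_step_def using p Cons.prems(2,3)
      by (auto simp: wp_simps same_def)
    then show "wp scan_step (wp (While (NLess 0 10) scan_step) ?Q) s (t + 1)"
    proof (rule wp_mono)
      fix s' t'
      assume h: "nmem s' = nmem s \<and> same ?X s s' \<and>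
       (\<forall>i. i \<noteq> 4 \<longrightarrow> rreg s' i = rreg s i) \<and> nreg s' 10 = nmem s (nreg s 10 + 2) \<and>
       nreg s' 14 = (if (nreg s 15, k) = (v, c) then 1 else nreg s 14) \<and>
       (\<forall>i<k. rmem s' (nreg s 5 + i) = rmem s (nreg s 5 + i) * rreg s 1 ^ (if (nreg s 15, i) = (v, c) then 1 else 0)) \<and>
       (\<forall>x. x < nreg s 5 \<longrightarrow> rmem s' x = rmem s x) \<and> t' \<le> t + 30"
      then have r: "nreg s' 0 = 0" "nreg s' 2 = k" "nreg s' 5 = nreg s 5" "nreg s' 15 = nreg s 15"
        "is_ctx k b (nmem s') (nreg s' 10) L" "rreg s' 1 = rreg s 1"
        using Cons.prems p by (simp_all add: same_def)
      show "wp (While (NLess 0 10) scan_step) ?Q s' t'"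
        by (rule wp_mono[OF Cons.IH[OF r(5,1,2), of t', unfolded scan_prog_def]])
           (use h r in \<open>auto simp: a same_def\<close>)
    qed
  qed
qed

section \<open>Building the recursion tree\<close>

lemma sameD: "same X s s' \<Longrightarrow> i \<notin> X \<Longrightarrow> nreg s' i = nreg s i"
  by (simp add: same_def)

lemma same_mono: "same X s s' \<Longrightarrow> X \<subseteq> Y \<Longrightarrow> same Y s s'"
  by (auto simp: same_def)

lemma same_trans: "same X s s' \<Longrightarrow> same Y s' s'' \<Longrightarrow> X \<subseteq> Z \<Longrightarrow> Y \<subseteq> Z \<Longrightarrow> same Z s s''"
  unfolding same_def by (metis subsetD)

lemma wp_delay: "wp c (\<lambda>s t. Q s (t + d)) s t = wp c Q s (t + d)"
  by (simp add: wp_def add_ac)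

text \<open>\<open>par\<close> and \<open>jp\<close> address the cell that the factor of the node
  multiplies: the weight of color \<open>jp\<close> in the record at \<open>par\<close>.
  \<open>dep\<close> is the remaining depth of the recursion.\<close>

datatype node = Node (vtx: nat) (col: nat) (ctx: "(nat \<times> nat) list") (par: nat) (jp: nat) (dep: nat)

definition init_prog :: "nat \<Rightarrow> prog" where "init_prog k = seqs (map (\<lambda>i. rst 5 i 3) [0..<k])"

lemma wp_init1:
  assumes "rreg s 3 = 1"
  shows "wp (init_prog k) (\<lambda>s' t'. (nmem s' = nmem s \<and> rreg s' = rreg s \<and> same {9} s s' \<and>
      (\<forall>i<k. rmem s' (nreg s 5 + i) = 1) \<and> (\<forall>x<nreg s 5. rmem s' x = rmem s x)) \<and> t' \<le> t + k * 4 + 1) s t"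
  unfolding init_prog_def
  by (rule wp_unrolled[where I = "\<lambda>m s'. nmem s' = nmem s \<and> rreg s' = rreg s \<and> same {9} s s' \<and>
      (\<forall>i<m. rmem s' (nreg s 5 + i) = 1) \<and> (\<forall>x<nreg s 5. rmem s' x = rmem s x)"])
     (use assms in \<open>auto simp: wp_rst same_def less_Suc_eq\<close>)

definition push_prog :: "nat \<Rightarrow> prog" where
  "push_prog j = seqs [st 5 0 15, st 5 1 16, st 5 2 17, st 5 3 15, st 5 4 2, st 5 5 17, st 5 6 6,
     Oper (NConst 21 j), st 5 7 21, st 5 8 19, Oper (NAdd 17 5 0), Oper (NAdd 5 5 22)]"

text \<open>Pin weights are written behind the last record before it is known whether the vertex is
  deleted; if it is, no record is added and the cells are free to be overwritten.\<close>

definition cand_prog :: "nat \<Rightarrow> nat \<Rightarrow> prog" where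
  "cand_prog k j = seqs [ld 15 18 1, ld 16 18 (2 + j),
     If (NLe 15 3)
       (seqs [init_prog k, Oper (NConst 14 0), Oper (NAdd 10 17 0), scan_prog, If (NLe 14 0) (push_prog j) Skip])
       Skip,
     ld 18 18 0]"

text \<open>Offset 3 is the deletion cell of the current node, so every color starts again from the
  context that merely lacks the current vertex.\<close>

definition row_prog :: "nat \<Rightarrow> nat \<Rightarrow> prog" where
  "row_prog k j = seqs [Oper (NConst 17 3), Oper (NAdd 17 6 17), Oper (NAdd 18 7 20), Oper (NLoad 18 18),
     While (NLess 0 18) (cand_prog k j)]"

definition expand_prog :: "nat \<Rightarrow> prog" where
  "expand_prog k = seqs [ld 19 6 8,
     If (NLess 0 19) (seqs [Oper (NSub 19 19 1), ld 20 6 0, seqs (map (row_prog k) [0..<k])]) Skip,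
     Oper (NAdd 6 6 22)]"

text \<open>
  A node record contains two context cells: the pin at offset 0 belongs to the contexts of the later
  siblings, the deletion at offset 3 to those of the descendants.
\<close>

definition is_node :: "nat \<Rightarrow> (nat \<Rightarrow> nat) \<Rightarrow> nat \<Rightarrow> node \<Rightarrow> bool" where
  "is_node k mem a x \<longleftrightarrow> mem a = vtx x \<and> mem (a + 1) = col x \<and> is_ctx k a mem (mem (a + 2)) (ctx x) \<and>
     mem (a + 3) = vtx x \<and> mem (a + 4) = k \<and> mem (a + 5) = mem (a + 2) \<and> mem (a + 6) = par x \<and>
     mem (a + 7) = jp x \<and> mem (a + 8) = dep x"

lemma is_node_cong:
  "is_node k mem a x \<Longrightarrow> (\<And>y. y < a + 9 \<Longrightarrow> mem' y = mem y) \<Longrightarrow> is_node k mem' a x"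
  unfolding is_node_def by (auto intro: is_ctx_cong)

text \<open>
  The record at \<open>p\<close> holds the address of the next record of the same vertex, the other endpoint, and
  the table of the color map along the edge.
\<close>

fun is_adj :: "(nat \<Rightarrow> nat \<Rightarrow> nat \<Rightarrow> nat) \<Rightarrow> nat \<Rightarrow> nat \<Rightarrow> nat \<Rightarrow> (nat \<Rightarrow> nat) \<Rightarrow> nat \<Rightarrow> nat \<Rightarrow> nat list \<Rightarrow> bool" where
  "is_adj sg k F b mem p u [] \<longleftrightarrow> p = 0"
| "is_adj sg k F b mem p u (v # vs) \<longleftrightarrow> 0 < p \<and> F \<le> p \<and> p + 2 + k \<le> b \<and> mem (p + 1) = v \<and>
    (\<forall>j<k. mem (p + 2 + j) = sg u v j) \<and> is_adj sg k F b mem (mem p) u vs"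

lemma is_adj_cong:
  "is_adj sg k F b mem p u vs \<Longrightarrow> (\<And>x. F \<le> x \<Longrightarrow> x < b \<Longrightarrow> mem' x = mem x) \<Longrightarrow> b \<le> b' \<Longrightarrow>
    is_adj sg k F b' mem' p u vs"
  by (induction vs arbitrary: p) auto

text \<open>\<open>mem0\<close> is the memory left by the reading phase. It stays fixed below
  \<open>base\<close>, so that all roots can use the same area above it for their trees.\<close>

locale ug_run = ug_graph +
  fixes base H F :: nat and mem0 :: "nat \<Rightarrow> nat"
  assumes base_pos: "0 < base"
    and heads: "H + ug_order G \<le> base"
    and adj: "u < ug_order G \<Longrightarrow> is_adj sig k F base mem0 (mem0 (H + u)) u (N u)"
begin

definition adr :: "nat \<Rightarrow> nat" where "adr q = base + q * (k + 9)"

lemma adr_less: "q < q' \<Longrightarrow> adr q + (k + 9) \<le> adr q'"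
  using mult_le_mono1[of "Suc q" q' "k + 9"] by (simp add: adr_def)

lemma adr_Suc: "adr (Suc q) = adr q + (k + 9)" by (simp add: adr_def)

lemma adr_inj: "adr q = adr q' \<longleftrightarrow> q = q'"
  using adr_less[of q q'] adr_less[of q' q] by (cases q q' rule: linorder_cases) auto

lemma adr_ge: "base \<le> adr q" by (simp add: adr_def)

definition env :: "state \<Rightarrow> bool" where
  "env s \<longleftrightarrow> nreg s 0 = 0 \<and> nreg s 1 = 1 \<and> nreg s 2 = k \<and> nreg s 4 = base \<and> nreg s 7 = H \<and>
     nreg s 22 = k + 9 \<and> rreg s 1 = w \<and> rreg s 2 = w - 1 \<and> rreg s 3 = 1 \<and> (\<forall>x<base. nmem s x = mem0 x)"

lemma env_same:
  assumes "env s" "same X s s'" "{0, 1, 2, 4, 7, 22} \<inter> X = {}"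
    "rreg s' 1 = w" "rreg s' 2 = w - 1" "rreg s' 3 = 1" "\<And>x. x < base \<Longrightarrow> nmem s' x = nmem s x"
  shows "env s'"
proof -
  have "nreg s' i = nreg s i" if "i \<in> {0, 1, 2, 4, 7, 22}" for i
    using sameD[OF assms(2)] assms(3) that by blast
  then show ?thesis using assms(1,4-7) by (simp add: env_def)
qed

definition pinw :: "node \<Rightarrow> nat \<Rightarrow> real" where
  "pinw x i = w ^ count_list (ctx x) (vtx x, i)"

definition nodes :: "node list \<Rightarrow> state \<Rightarrow> bool" where
  "nodes ns s \<longleftrightarrow> nreg s 5 = adr (length ns) \<and> (\<forall>q<length ns. is_node k (nmem s) (adr q) (ns ! q)) \<and>
     (\<forall>q<length ns. \<forall>i<k. rmem s (adr q + i) = pinw (ns ! q) i)"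

lemma nodes_push:
  assumes "nodes ns s" "\<And>y. y < adr (length ns) \<Longrightarrow> nmem s' y = nmem s y \<and> rmem s' y = rmem s y"
    and "is_node k (nmem s') (adr (length ns)) x" "\<And>i. i < k \<Longrightarrow> rmem s' (adr (length ns) + i) = pinw x i"
    and "nreg s' 5 = adr (length ns) + (k + 9)"
  shows "nodes (ns @ [x]) s'"
proof -
  have "is_node k (nmem s') (adr q) (ns ! q)" if "q < length ns" for q
    by (rule is_node_cong[of k "nmem s"]) (use that assms(1,2) adr_less[OF that] in \<open>auto simp: nodes_def\<close>)
  moreover have "rmem s' (adr q + i) = pinw (ns ! q) i" if "q < length ns" "i < k" for q i
    using that assms(1,2) adr_less[OF that(1)] by (auto simp: nodes_def)
  ultimately show ?thesis using assms(3-5) by (auto simp: nodes_def nth_append less_Suc_eq adr_Suc)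
qed

lemma nodes_same:
  assumes "nodes ns s" "\<And>y. y < adr (length ns) \<Longrightarrow> nmem s' y = nmem s y \<and> rmem s' y = rmem s y"
    and "nreg s' 5 = nreg s 5"
  shows "nodes ns s'"
proof -
  have "is_node k (nmem s') (adr q) (ns ! q)" if "q < length ns" for q
    by (rule is_node_cong[of k "nmem s"]) (use that assms(1,2) adr_less[OF that] in \<open>auto simp: nodes_def\<close>)
  moreover have "rmem s' (adr q + i) = pinw (ns ! q) i" if "q < length ns" "i < k" for q i
    using that assms(1,2) adr_less[OF that(1)] by (auto simp: nodes_def)
  ultimately show ?thesis using assms(1,3) by (auto simp: nodes_def)
qed

abbreviation kid_regs :: "nat set" where "kid_regs \<equiv> {5, 9, 10, 11, 12, 13, 14, 15, 16, 17, 18, 21}"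

lemma wp_push:
  assumes e: "env s" and n: "nodes ns s" and c: "is_ctx k (adr (length ns)) (nmem s) (nreg s 17) L"
    and col: "nreg s 16 < k"
    and rm: "\<And>i. i < k \<Longrightarrow> rmem s (adr (length ns) + i) = w ^ count_list L (nreg s 15, i)"
  shows "wp (push_prog j) (\<lambda>s' t'. env s' \<and> same {5, 9, 17, 21} s s' \<and> rreg s' = rreg s \<and>
     nodes (ns @ [Node (nreg s 15) (nreg s 16) L (nreg s 6) j (nreg s 19)]) s' \<and>
     is_ctx k (adr (Suc (length ns))) (nmem s') (nreg s' 17) ((nreg s 15, nreg s 16) # L) \<and>
     t' \<le> t + 50) s t"
proof -
  define T where "T = adr (length ns)"
  have T: "nreg s 5 = T" "base \<le> T" using n adr_ge by (auto simp: nodes_def T_def)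
  have r: "nreg s 0 = 0" "nreg s 2 = k" "nreg s 22 = k + 9" using e by (simp_all add: env_def)
  define M where "M = (nmem s)(T := nreg s 15, T + 1 := nreg s 16, T + 2 := nreg s 17,
     T + 3 := nreg s 15, T + 4 := k, T + 5 := nreg s 17, T + 6 := nreg s 6, T + 7 := j, T + 8 := nreg s 19)"
  have below: "M y = nmem s y" if "y < T" for y using that by (simp add: M_def)
  have cT: "is_ctx k T M (nreg s 17) L" by (rule is_ctx_cong[OF c[folded T_def]]) (auto simp: below)
  have at: "M T = nreg s 15" "M (T + 1) = nreg s 16" "M (T + 2) = nreg s 17" "M (T + 3) = nreg s 15"
    "M (T + 4) = k" "M (T + 5) = nreg s 17" "M (T + 6) = nreg s 6" "M (T + 7) = j" "M (T + 8) = nreg s 19"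
    by (simp_all add: M_def)
  have rec: "is_node k M T (Node (nreg s 15) (nreg s 16) L (nreg s 6) j (nreg s 19))"
    unfolding is_node_def node.sel at using cT by simp
  have "is_ctx k (T + (k + 9)) M T ((nreg s 15, nreg s 16) # L)"
    using is_ctx_cong[OF cT, of M "T + (k + 9)"] T base_pos col at(1-3) by auto
  then have ctx': "is_ctx k (adr (Suc (length ns))) M T ((nreg s 15, nreg s 16) # L)"
    by (simp add: T_def adr_Suc)
  have "wp (push_prog j) (\<lambda>s' t'. nmem s' = M \<and> rmem s' = rmem s \<and> rreg s' = rreg s \<and> nreg s' 5 = T + (k + 9) \<and>
     nreg s' 17 = T \<and> same {5, 9, 17, 21} s s' \<and> t' \<le> t + 50) s t"
    unfolding push_prog_def by (simp add: wp_simps T(1) r same_def M_def)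
  then show ?thesis
  proof (rule wp_mono)
    fix s' t'
    assume h: "nmem s' = M \<and> rmem s' = rmem s \<and> rreg s' = rreg s \<and> nreg s' 5 = T + (k + 9) \<and>
     nreg s' 17 = T \<and> same {5, 9, 17, 21} s s' \<and> t' \<le> t + 50"
    have "nodes (ns @ [Node (nreg s 15) (nreg s 16) L (nreg s 6) j (nreg s 19)]) s'"
      by (rule nodes_push[OF n]) (use h rec rm below in \<open>auto simp: T_def pinw_def\<close>)
    moreover have "env s'" using e h T below by (auto simp: env_def same_def)
    ultimately show "env s' \<and> same {5, 9, 17, 21} s s' \<and> rreg s' = rreg s \<and>
     nodes (ns @ [Node (nreg s 15) (nreg s 16) L (nreg s 6) j (nreg s 19)]) s' \<and>
     is_ctx k (adr (Suc (length ns))) (nmem s') (nreg s' 17) ((nreg s 15, nreg s 16) # L) \<and> t' \<le> t + 50"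
      using h ctx' by simp
  qed
qed

text \<open>Mirrors one equation of \<open>steps\<close>: an alive neighbor yields a record and a
  longer context, any other neighbor yields nothing.\<close>

lemma wp_cand:
  assumes e: "env s" and n: "nodes ns s" and c: "is_ctx k (adr (length ns)) (nmem s) (nreg s 17) L"
    and h: "is_adj sig k F base mem0 (nreg s 18) u (v # vs)" and j: "j < k" and sg: "sig u v j < k"
  defines "x \<equiv> Node v (sig u v j) L (nreg s 6) j (nreg s 19)"
  shows "wp (cand_prog k j) (\<lambda>s' t'. env s' \<and> same kid_regs s s' \<and> nreg s' 18 = mem0 (nreg s 18) \<and> rreg s' 7 = rreg s 7 \<and>
     (if v \<in> alive (Suc (nreg s 3)) L
      then nodes (ns @ [x]) s' \<and> is_ctx k (adr (Suc (length ns))) (nmem s') (nreg s' 17) ((v, sig u v j) # L)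
      else nodes ns s' \<and> is_ctx k (adr (length ns)) (nmem s') (nreg s' 17) L) \<and>
     t' \<le> t + (4 * k + 30 * length L + 80)) s t"
    (is "wp _ ?Q s t")
proof -
  define Q where "Q = ?Q"
  have dl: "wp (ld 18 18 0) (\<lambda>s' t'. Q s' (t' + 1)) s2 t2 = wp (ld 18 18 0) Q s2 (t2 + 1)" for s2 t2
    by (rule wp_delay)
  define p where "p = nreg s 18"
  have pb: "p + 2 + k \<le> base" using h by (simp add: p_def)
  have m: "nmem s y = mem0 y" if "y < base" for y using e that by (simp add: env_def)
  have mp: "nmem s (Suc p) = v" "nmem s (Suc (Suc (p + j))) = sig u v j" "nmem s p = mem0 p"
    using h j m pb by (auto simp: p_def)
  have r: "nreg s 0 = 0" "nreg s 2 = k" "rreg s 1 = w" "rreg s 3 = 1" "rreg s 2 = w - 1" using e by (simp_all add: env_def)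
  define s1 where "s1 = s\<lparr>nreg := (nreg s)(15 := v, 9 := Suc (Suc (p + j)), 16 := sig u v j)\<rparr>"
  have fin: "wp (ld 18 18 0) Q s2 t2"
    if "env s2" "same (kid_regs - {18}) s s2" "rreg s2 7 = rreg s 7"
      "if v \<in> alive (Suc (nreg s 3)) L
      then nodes (ns @ [x]) s2 \<and> is_ctx k (adr (Suc (length ns))) (nmem s2) (nreg s2 17) ((v, sig u v j) # L)
      else nodes ns s2 \<and> is_ctx k (adr (length ns)) (nmem s2) (nreg s2 17) L"
      "t2 \<le> t + (4 * k + 30 * length L + 75)" for s2 t2
  proof -
    have a: "nreg s2 18 = p" "nmem s2 p = mem0 p" using that(1,2) pb by (auto simp: same_def p_def env_def)
    let ?s3 = "s2\<lparr>nreg := (nreg s2)(9 := nreg s2 18 + 0, 18 := nmem s2 (nreg s2 18 + 0))\<rparr>"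
    have "env ?s3"
      by (rule env_same[OF that(1), of "{9, 18}"]) (use that(1) in \<open>simp_all add: env_def same_def\<close>)
    moreover have "nodes ms ?s3" if "nodes ms s2" for ms by (rule nodes_same[OF that]) auto
    moreover have "same kid_regs s ?s3" using that(2) by (simp add: same_def)
    moreover have "wp (ld 18 18 0) Q s2 t2 = Q ?s3 (t2 + 4)" by (rule wp_ld) simp
    ultimately show ?thesis using that(3-5) a p_def unfolding Q_def by (simp split: if_splits)
  qed
  \<comment> \<open>Both ways of rejecting the neighbor, an index beyond the root and a deletion
    found in the context, end here.\<close>
  have Skipcase: "wp (ld 18 18 0) Q s2 t2"
    if "\<not> v \<in> alive (Suc (nreg s 3)) L" "nmem s2 = nmem s" "same (kid_regs - {18, 17, 5}) s s2" "rreg s2 7 = rreg s 7"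
      "rreg s2 1 = w \<and> rreg s2 2 = w - 1 \<and> rreg s2 3 = 1"
      "\<And>y. y < adr (length ns) \<Longrightarrow> rmem s2 y = rmem s y" "t2 \<le> t + (4 * k + 30 * length L + 75)" for s2 t2
  proof -
    have "env s2" by (rule env_same[OF e that(3)]) (use that(2,5) in simp_all)
    moreover have "nodes ns s2"
      by (rule nodes_same[OF n]) (use that(2,6) sameD[OF that(3), of 5] in simp_all)
    moreover have "is_ctx k (adr (length ns)) (nmem s2) (nreg s2 17) L"
      using c that(2) sameD[OF that(3), of 17] by simp
    moreover have "same (kid_regs - {18}) s s2" by (rule same_mono[OF that(3)]) auto
    ultimately show ?thesis using that(1,4,7) by (intro fin) simp_all
  qed
  have T: "nreg s 5 = adr (length ns)" using n by (simp add: nodes_def)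
  let ?test = "seqs [init_prog k, Oper (NConst 14 0), Oper (NAdd 10 17 0), scan_prog, If (NLe 14 0) (push_prog j) Skip]"
    and ?K = "wp (ld 18 18 0) (\<lambda>s' t'. Q s' (t' + 1))"
  have body: "wp (?test)
      ?K s1 (t + 8 + 1)" if vr: "v \<le> nreg s 3"
  proof -
    have "wp (init_prog k) (\<lambda>s' t'. (nmem s' = nmem s1 \<and> rreg s' = rreg s1 \<and> same {9} s1 s' \<and>
      (\<forall>i<k. rmem s' (nreg s1 5 + i) = 1) \<and> (\<forall>x<nreg s1 5. rmem s' x = rmem s1 x)) \<and> t' \<le> t + 8 + 1 + k * 4 + 1) s1 (t + 8 + 1)"
      by (rule wp_init1) (simp add: s1_def r)
    then show ?thesis unfolding seqs.simps wp_Seq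
    proof (rule wp_mono, unfold wp_Oper)
      fix s2 t2
      assume h2: "(nmem s2 = nmem s1 \<and> rreg s2 = rreg s1 \<and> same {9} s1 s2 \<and>
      (\<forall>i<k. rmem s2 (nreg s1 5 + i) = 1) \<and> (\<forall>x<nreg s1 5. rmem s2 x = rmem s1 x)) \<and> t2 \<le> t + 8 + 1 + k * 4 + 1"
      define s3 where "s3 = step (NAdd 10 17 0) (step (NConst 14 0) s2)"
      have s3: "nmem s3 = nmem s" "rreg s3 = rreg s" "nreg s3 10 = nreg s 17" "nreg s3 14 = 0" "nreg s3 15 = v"
        "nreg s3 5 = adr (length ns)" "same {9, 10, 14, 15, 16} s s3" "nreg s3 16 = sig u v j"
        "\<And>i. i < k \<Longrightarrow> rmem s3 (adr (length ns) + i) = 1"  "\<And>y. y < adr (length ns) \<Longrightarrow> rmem s3 y = rmem s y"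
        using h2 r T by (simp_all add: s3_def s1_def same_def)
      have "wp scan_prog (\<lambda>s' t'. nmem s' = nmem s3 \<and> same {9, 10, 11, 12, 13, 14} s3 s' \<and>
         (\<forall>i. i \<noteq> 4 \<longrightarrow> rreg s' i = rreg s3 i) \<and>
         nreg s' 14 = (if (nreg s3 15, k) \<in> set L then 1 else nreg s3 14) \<and>
         (\<forall>i<k. rmem s' (nreg s3 5 + i) = rmem s3 (nreg s3 5 + i) * rreg s3 1 ^ count_list L (nreg s3 15, i)) \<and>
         (\<forall>x. x < nreg s3 5 \<longrightarrow> rmem s' x = rmem s3 x) \<and>
         t' \<le> t2 + 1 + 1 + 30 * length L + 1) s3 (t2 + 1 + 1)"
        by (rule wp_scan) (use c s3 r in \<open>simp_all add: same_def\<close>)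
      then show "wp scan_prog (wp (If (NLe 14 0) (push_prog j) Skip) (wp Skip ?K))
         (step (NAdd 10 17 0) (step (NConst 14 0) s2)) (t2 + 1 + 1)" unfolding s3_def[symmetric]
      proof (rule wp_mono)
        fix s4 t4
        assume h4: "nmem s4 = nmem s3 \<and> same {9, 10, 11, 12, 13, 14} s3 s4 \<and>
         (\<forall>i. i \<noteq> 4 \<longrightarrow> rreg s4 i = rreg s3 i) \<and>
         nreg s4 14 = (if (nreg s3 15, k) \<in> set L then 1 else nreg s3 14) \<and>
         (\<forall>i<k. rmem s4 (nreg s3 5 + i) = rmem s3 (nreg s3 5 + i) * rreg s3 1 ^ count_list L (nreg s3 15, i)) \<and>
         (\<forall>x. x < nreg s3 5 \<longrightarrow> rmem s4 x = rmem s3 x) \<and>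
         t4 \<le> t2 + 1 + 1 + 30 * length L + 1"
        have h4m: "nmem s4 = nmem s" "\<And>y. y < adr (length ns) \<Longrightarrow> rmem s4 y = rmem s y"
          "\<And>i. i < k \<Longrightarrow> rmem s4 (adr (length ns) + i) = w ^ count_list L (v, i)"
          "nreg s4 14 = (if (v, k) \<in> set L then 1 else 0)"
          "rreg s4 7 = rreg s 7" "rreg s4 1 = w" "rreg s4 2 = w - 1" "rreg s4 3 = 1"
          "nreg s4 15 = v" "nreg s4 16 = sig u v j"
          using h4 s3 r by (simp_all add: same_def)
        have same4: "same {9, 10, 11, 12, 13, 14, 15, 16} s s4"
          by (rule same_trans[OF s3(7)]) (use h4 in auto)
        have r4: "nreg s4 0 = 0" "nreg s4 5 = nreg s 5" "nreg s4 17 = nreg s 17" "nreg s4 6 = nreg s 6" "nreg s4 19 = nreg s 19"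
          using sameD[OF same4] r by simp_all
        have time: "t4 \<le> t + 4 * k + 30 * length L + 14" using h4 h2 by simp
        show "wp (If (NLe 14 0) (push_prog j) Skip) (wp Skip ?K) s4 t4"
        proof (cases "(v, k) \<in> set L")
          case True
          have "v \<notin> alive (Suc (nreg s 3)) L" using True by (simp add: alive_def)
          then have "wp (ld 18 18 0) Q s4 (t4 + 1 + 1 + 1 + 1)"
            by (rule Skipcase) (use h4m time same_mono[OF same4] in auto)
          then show ?thesis unfolding wp_If wp_Skip dl using True h4m(4) r4(1) by simp
        next
          case False
          have env4: "env s4" by (rule env_same[OF e same4]) (use h4m in simp_all)
          have nodes4: "nodes ns s4" by (rule nodes_same[OF n]) (use h4m r4 in auto)
          have "wp (push_prog j) (\<lambda>s' t'. env s' \<and> same {5, 9, 17, 21} s4 s' \<and> rreg s' = rreg s4 \<and>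
             nodes (ns @ [Node (nreg s4 15) (nreg s4 16) L (nreg s4 6) j (nreg s4 19)]) s' \<and>
             is_ctx k (adr (Suc (length ns))) (nmem s') (nreg s' 17) ((nreg s4 15, nreg s4 16) # L) \<and>
             t' \<le> t4 + 1 + 50) s4 (t4 + 1)"
            by (rule wp_push[OF env4 nodes4]) (use c h4m r4 sg in auto)
          then have "wp (push_prog j) (wp Skip ?K) s4 (t4 + 1)"
          proof (rule wp_mono)
            fix s5 t5
            assume h5: "env s5 \<and> same {5, 9, 17, 21} s4 s5 \<and> rreg s5 = rreg s4 \<and>
             nodes (ns @ [Node (nreg s4 15) (nreg s4 16) L (nreg s4 6) j (nreg s4 19)]) s5 \<and>
             is_ctx k (adr (Suc (length ns))) (nmem s5) (nreg s5 17) ((nreg s4 15, nreg s4 16) # L) \<and>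
             t5 \<le> t4 + 1 + 50"
            have "wp (ld 18 18 0) Q s5 (t5 + 1 + 1)"
              by (rule fin) (use h5 h4m r4 time False vr same_trans[OF same4, of "{5, 9, 17, 21}" s5]
                in \<open>auto simp: x_def alive_def\<close>)
            then show "wp Skip ?K s5 t5"
              unfolding wp_Skip dl by simp
          qed
          then show ?thesis using False h4m(4) r4(1) by (simp add: wp_If)
        qed
      qed
    qed
  qed
  have e1: "wp (cand_prog k j) Q s t = wp (If (NLe 15 3)
       (?test)
       Skip) ?K s1 (t + 8)"
  proof -
    have "wp Skip Q = (\<lambda>s' t'. Q s' (t' + 1))" by (intro ext) (rule wp_Skip)
    then show ?thesis unfolding cand_prog_def seqs.simps wp_Seq
      by (simp add: wp_ld s1_def p_def[symmetric] mp add.commute[of t])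
  qed
  have "wp (cand_prog k j) Q s t"
  proof (cases "v \<le> nreg s 3")
    case True
    then show ?thesis unfolding e1 wp_If using body by (simp add: s1_def)
  next
    case False
    then have "v \<notin> alive (Suc (nreg s 3)) L" by (simp add: alive_def)
    then have "wp (ld 18 18 0) Q s1 (t + 8 + 1 + 1 + 1)"
      by (rule Skipcase) (use r in \<open>simp_all add: s1_def same_def\<close>)
    then show ?thesis unfolding e1 wp_If wp_Skip dl using False by (simp add: s1_def)
  qed
  then show ?thesis unfolding Q_def .
qed

end

context ug_run begin

definition mk_node :: "nat \<Rightarrow> nat \<Rightarrow> nat \<Rightarrow> nat \<times> nat \<times> (nat \<times> nat) list \<Rightarrow> node" where
  "mk_node a j e = (\<lambda>(v, c, L). Node v c L a j e)"

text \<open>Each neighbor consumed lengthens the context by at most one entry, so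
  \<open>length L + length vs\<close> never increases and a single \<open>M\<close> bounds all walks
  of the loop.\<close>

lemma wp_nbrs:
  assumes "env s" "nodes ns s" "is_ctx k (adr (length ns)) (nmem s) (nreg s 17) L"
    and "is_adj sig k F base mem0 (nreg s 18) u vs" and j: "j < k"
    and "\<And>v. v \<in> set vs \<Longrightarrow> sig u v j < k" and "length L + length vs \<le> M"
  shows "wp (While (NLess 0 18) (cand_prog k j)) (\<lambda>s' t'. env s' \<and> same kid_regs s s' \<and> rreg s' 7 = rreg s 7 \<and>
     nodes (ns @ map (mk_node (nreg s 6) j (nreg s 19)) (steps (Suc (nreg s 3)) u j L vs)) s' \<and>
     t' \<le> t + length vs * (4 * k + 30 * M + 81) + 1) s t"
  using assms(1-4,6-)
proof (induction vs arbitrary: s t ns L)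
  case Nil
  then show ?case by (intro wp_While_False) (simp_all add: env_def same_def)
next
  case (Cons v vs)
  note adj = Cons.prems(4)
  have sg: "sig u v j < k" using Cons.prems(5) by simp
  show ?case (is "wp _ ?Q s t")
  proof (rule wp_While_True)
    show "holds (NLess 0 18) s" using adj Cons.prems(1) by (simp add: env_def)
    show "wp (cand_prog k j) (wp (While (NLess 0 18) (cand_prog k j)) ?Q) s (t + 1)"
    proof (rule wp_mono[OF wp_cand[OF Cons.prems(1-3) adj j sg]])
      fix s' t'
      let ?x = "Node v (sig u v j) L (nreg s 6) j (nreg s 19)"
      assume h: "env s' \<and> same kid_regs s s' \<and> nreg s' 18 = mem0 (nreg s 18) \<and> rreg s' 7 = rreg s 7 \<and>
       (if v \<in> alive (Suc (nreg s 3)) L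
        then nodes (ns @ [?x]) s' \<and> is_ctx k (adr (Suc (length ns))) (nmem s') (nreg s' 17) ((v, sig u v j) # L)
        else nodes ns s' \<and> is_ctx k (adr (length ns)) (nmem s') (nreg s' 17) L) \<and>
       t' \<le> t + 1 + (4 * k + 30 * length L + 80)"
      have r: "nreg s' 3 = nreg s 3" "nreg s' 6 = nreg s 6" "nreg s' 19 = nreg s 19"
        using sameD[of kid_regs s s'] h by simp_all
      have adj': "is_adj sig k F base mem0 (nreg s' 18) u vs" using adj h by simp
      have sg': "\<And>v. v \<in> set vs \<Longrightarrow> sig u v j < k" using Cons.prems(5) by simp
      have t': "t' + length vs * (4 * k + 30 * M + 81) + 1 \<le> t + length (v # vs) * (4 * k + 30 * M + 81) + 1"
        using h Cons.prems(6) by simp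
      show "wp (While (NLess 0 18) (cand_prog k j)) ?Q s' t'"
      proof (cases "v \<in> alive (Suc (nreg s 3)) L")
        case True
        then have "nodes (ns @ [?x]) s'" "is_ctx k (adr (length (ns @ [?x]))) (nmem s') (nreg s' 17) ((v, sig u v j) # L)"
          using h by simp_all
        from Cons.IH[OF _ this adj', of t'] sg' h Cons.prems(6)
        have "wp (While (NLess 0 18) (cand_prog k j)) (\<lambda>s'' t''. env s'' \<and> same kid_regs s' s'' \<and> rreg s'' 7 = rreg s' 7 \<and>
            nodes ((ns @ [?x]) @ map (mk_node (nreg s' 6) j (nreg s' 19)) (steps (Suc (nreg s' 3)) u j ((v, sig u v j) # L) vs)) s'' \<and>
            t'' \<le> t' + length vs * (4 * k + 30 * M + 81) + 1) s' t'" by simp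
        then show ?thesis
          by (rule wp_mono) (use t' True h r same_trans[of kid_regs s s' kid_regs] in \<open>auto simp: mk_node_def\<close>)
      next
        case False
        then have "nodes ns s'" "is_ctx k (adr (length ns)) (nmem s') (nreg s' 17) L"
          using h by simp_all
        from Cons.IH[OF _ this adj', of t'] sg' h Cons.prems(6)
        have "wp (While (NLess 0 18) (cand_prog k j)) (\<lambda>s'' t''. env s'' \<and> same kid_regs s' s'' \<and> rreg s'' 7 = rreg s' 7 \<and>
            nodes (ns @ map (mk_node (nreg s' 6) j (nreg s' 19)) (steps (Suc (nreg s' 3)) u j L vs)) s'' \<and>
            t'' \<le> t' + length vs * (4 * k + 30 * M + 81) + 1) s' t'" by simp
        then show ?thesis
          by (rule wp_mono) (use t' False h r same_trans[of kid_regs s s' kid_regs] in \<open>auto simp: mk_node_def\<close>)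
      qed
    qed
  qed
qed

definition kidsj :: "nat \<Rightarrow> node \<Rightarrow> nat \<Rightarrow> nat \<Rightarrow> nat \<Rightarrow> node list" where
  "kidsj a x r e j = map (mk_node a j e) (steps (Suc r) (vtx x) j ((vtx x, k) # ctx x) (N (vtx x)))"

definition kids :: "nat \<Rightarrow> node \<Rightarrow> nat \<Rightarrow> node list" where
  "kids a x r = (case dep x of 0 \<Rightarrow> [] | Suc e \<Rightarrow> concat (map (kidsj a x r e) [0..<k]))"

lemma wp_row:
  assumes e: "env s" and n: "nodes (ns @ ms) s" and h: "h < length ns" and a: "nreg s 6 = adr h"
    and u: "nreg s 20 = vtx (ns ! h)" "vtx (ns ! h) < ug_order G" and j: "j < k"
    and M: "length (ctx (ns ! h)) + 1 + \<Delta> \<le> M"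
  shows "wp (row_prog k j) (\<lambda>s' t'. env s' \<and> same kid_regs s s' \<and> rreg s' 7 = rreg s 7 \<and>
     nodes (ns @ ms @ kidsj (adr h) (ns ! h) (nreg s 3) (nreg s 19) j) s' \<and>
     t' \<le> t + (\<Delta> * (4 * k + 30 * M + 81) + 12)) s t"
proof -
  let ?x = "ns ! h"
  define s1 where "s1 = s\<lparr>nreg := (nreg s)(17 := adr h + 3, 18 := nmem s (H + vtx ?x))\<rparr>"
  have eq: "wp (row_prog k j) Q s t = wp (While (NLess 0 18) (cand_prog k j)) (wp Skip Q) s1 (t + 1 + 1 + 1 + 1)" for Q
    unfolding row_prog_def seqs.simps wp_Seq wp_Oper using e a u
    by (simp add: s1_def env_def add.commute[of t])
  have rec: "is_node k (nmem s) (adr h) ?x"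
    using n h by (auto simp: nodes_def nth_append dest: spec[of _ h])
  have hb: "adr h + (k + 9) \<le> adr (length (ns @ ms))" using h by (intro adr_less) simp
  have c: "is_ctx k (adr (length (ns @ ms))) (nmem s1) (nreg s1 17) ((vtx ?x, k) # ctx ?x)"
  proof -
    have "is_ctx k (adr h) (nmem s) (nmem s (adr h + 2)) (ctx ?x)" using rec by (simp add: is_node_def)
    then have "is_ctx k (adr (length (ns @ ms))) (nmem s) (nmem s (adr h + 5)) (ctx ?x)"
      using rec hb is_ctx_cong[of k "adr h" "nmem s" _ _ "nmem s"] by (simp add: is_node_def)
    then show ?thesis using rec hb by (simp add: s1_def is_node_def add.commute[of _ "adr h"])
  qed
  have "env s1" by (rule env_same[OF e, of "{17, 18}"]) (use e in \<open>simp_all add: s1_def same_def env_def\<close>)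
  moreover have "nodes (ns @ ms) s1" by (rule nodes_same[OF n]) (simp_all add: s1_def)
  moreover have "nmem s (H + vtx ?x) = mem0 (H + vtx ?x)" using e u heads by (simp add: env_def)
  then have "is_adj sig k F base mem0 (nreg s1 18) (vtx ?x) (N (vtx ?x))"
    using adj[OF u(2)] by (simp add: s1_def)
  ultimately have "wp (While (NLess 0 18) (cand_prog k j)) (\<lambda>s' t'. env s' \<and> same kid_regs s1 s' \<and> rreg s' 7 = rreg s1 7 \<and>
     nodes ((ns @ ms) @ map (mk_node (nreg s1 6) j (nreg s1 19)) (steps (Suc (nreg s1 3)) (vtx ?x) j ((vtx ?x, k) # ctx ?x) (N (vtx ?x)))) s' \<and>
     t' \<le> t + 1 + 1 + 1 + 1 + length (N (vtx ?x)) * (4 * k + 30 * M + 81) + 1) s1 (t + 1 + 1 + 1 + 1)"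
    by (rule wp_nbrs[OF _ _ c]) (use j sig_less[OF u(2)] M N_length[OF u(2)] in auto)
  moreover have "t + 1 + 1 + 1 + 1 + length (N (vtx ?x)) * (4 * k + 30 * M + 81) + 1 + 1 \<le>
      t + (\<Delta> * (4 * k + 30 * M + 81) + 12)"
    using mult_le_mono1[OF N_length[OF u(2)], of "4 * k + 30 * M + 81"] by linarith
  moreover have "same kid_regs s s1" by (simp add: s1_def same_def)
  moreover have "nreg s1 6 = adr h" "nreg s1 19 = nreg s 19" "nreg s1 3 = nreg s 3" "rreg s1 = rreg s"
    using a by (simp_all add: s1_def)
  ultimately show ?thesis unfolding eq
    by (elim wp_mono) (auto simp: wp_Skip kidsj_def intro: same_trans[of kid_regs s s1 kid_regs])
qed

abbreviation tree_regs :: "nat set" where "tree_regs \<equiv> {5, 6, 9, 10, 11, 12, 13, 14, 15, 16, 17, 18, 19, 20, 21}"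

lemma wp_expand:
  assumes e: "env s" and n: "nodes ns s" and h: "h < length ns" and a: "nreg s 6 = adr h"
    and u: "vtx (ns ! h) < ug_order G"
    and M: "length (ctx (ns ! h)) + 1 + \<Delta> \<le> M"
  shows "wp (expand_prog k) (\<lambda>s' t'. env s' \<and> same tree_regs s s' \<and> rreg s' 7 = rreg s 7 \<and> nreg s' 6 = adr (Suc h) \<and>
     nodes (ns @ kids (adr h) (ns ! h) (nreg s 3)) s' \<and>
     t' \<le> t + (k * (\<Delta> * (4 * k + 30 * M + 81) + 12) + 30)) s t"
    (is "wp _ ?Q s t")
proof -
  define Q where "Q = ?Q"
  let ?x = "ns ! h" and ?T = "\<Delta> * (4 * k + 30 * M + 81) + 12"
  have rec: "is_node k (nmem s) (adr h) ?x" using n h by (simp add: nodes_def)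
  define s1 where "s1 = s\<lparr>nreg := (nreg s)(9 := adr h + 8, 19 := dep ?x)\<rparr>"
  have r: "nreg s 0 = 0" "nreg s 1 = 1" "nreg s 22 = k + 9" using e by (simp_all add: env_def)
  have fin: "wp (Oper (NAdd 6 6 22)) (wp Skip Q) s2 t2"
    if "env s2" "same (tree_regs - {6}) s s2" "rreg s2 7 = rreg s 7"
      "nodes (ns @ kids (adr h) ?x (nreg s 3)) s2" "t2 \<le> t + (k * ?T + 25)" for s2 t2
  proof -
    let ?s3 = "s2\<lparr>nreg := (nreg s2)(6 := nreg s2 6 + nreg s2 22)\<rparr>"
    have "env ?s3" by (rule env_same[OF that(1), of "{6}"]) (use that(1) in \<open>simp_all add: env_def same_def\<close>)
    moreover have "nodes (ns @ kids (adr h) ?x (nreg s 3)) ?s3" by (rule nodes_same[OF that(4)]) simp_all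
    moreover have "same tree_regs s ?s3" using that(2) by (simp add: same_def)
    moreover have "nreg s2 6 = adr h" "nreg s2 22 = k + 9"
      using sameD[OF that(2), of 6] sameD[OF that(2), of 22] a r by simp_all
    ultimately show ?thesis unfolding wp_Oper wp_Skip Q_def using that(3,5) by (simp add: adr_Suc)
  qed
  have eq: "wp (expand_prog k) Q s t = wp (If (NLess 0 19) (seqs [Oper (NSub 19 19 1), ld 20 6 0, seqs (map (row_prog k) [0..<k])]) Skip)
     (wp (Oper (NAdd 6 6 22)) (wp Skip Q)) s1 (t + 4)"
    unfolding expand_prog_def seqs.simps wp_Seq wp_ld[of 6 19, simplified] using a rec
    by (simp add: s1_def is_node_def add.commute[of t])
  have "wp (expand_prog k) Q s t"
  proof (cases "dep ?x")
    case 0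
    have "env s1" by (rule env_same[OF e, of "{9, 19}"]) (use e in \<open>simp_all add: s1_def same_def env_def\<close>)
    moreover have "nodes ns s1" by (rule nodes_same[OF n]) (simp_all add: s1_def)
    moreover have "same (tree_regs - {6}) s s1" by (simp add: same_def s1_def)
    ultimately have "wp (Oper (NAdd 6 6 22)) (wp Skip Q) s1 (t + 4 + 1 + 1)"
      by (intro fin) (simp_all add: kids_def 0 s1_def)
    then show ?thesis unfolding eq wp_If wp_Skip using 0 r by (simp add: s1_def)
  next
    case (Suc e')
    define s2 where "s2 = s\<lparr>nreg := (nreg s)(19 := e', 9 := adr h, 20 := vtx ?x)\<rparr>"
    have "env s2" by (rule env_same[OF e, of "{9, 19, 20}"]) (use e in \<open>simp_all add: s2_def same_def env_def\<close>)
    moreover have "nodes ns s2" by (rule nodes_same[OF n]) (simp_all add: s2_def)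
    ultimately have "wp (seqs (map (row_prog k) [0..<k])) (\<lambda>s' t'. (env s' \<and> same kid_regs s2 s' \<and> rreg s' 7 = rreg s2 7 \<and>
        nodes (ns @ concat (map (kidsj (adr h) ?x (nreg s 3) e') [0..<k])) s') \<and> t' \<le> t + 10 + k * ?T + 1) s2 (t + 10)"
    proof (intro wp_unrolled[where I = "\<lambda>m s'. env s' \<and> same kid_regs s2 s' \<and> rreg s' 7 = rreg s2 7 \<and>
        nodes (ns @ concat (map (kidsj (adr h) ?x (nreg s 3) e') [0..<m])) s'"])
      fix j s3 t3
      assume j: "j < k" and h3: "env s3 \<and> same kid_regs s2 s3 \<and> rreg s3 7 = rreg s2 7 \<and>
        nodes (ns @ concat (map (kidsj (adr h) ?x (nreg s 3) e') [0..<j])) s3"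
      have r3: "nreg s3 6 = adr h" "nreg s3 20 = vtx ?x" "nreg s3 19 = e'" "nreg s3 3 = nreg s 3"
        using sameD[of kid_regs s2 s3] h3 a by (simp_all add: s2_def)
      from h3 have "wp (row_prog k j) (\<lambda>s' t'. env s' \<and> same kid_regs s3 s' \<and> rreg s' 7 = rreg s3 7 \<and>
         nodes (ns @ concat (map (kidsj (adr h) ?x (nreg s 3) e') [0..<j]) @ kidsj (adr h) ?x (nreg s3 3) (nreg s3 19) j) s' \<and>
         t' \<le> t3 + ?T) s3 t3"
        by (intro wp_row[OF _ _ h r3(1,2) u j M]) simp_all
      then show "wp (row_prog k j) (\<lambda>s' t'. (env s' \<and> same kid_regs s2 s' \<and> rreg s' 7 = rreg s2 7 \<and>
        nodes (ns @ concat (map (kidsj (adr h) ?x (nreg s 3) e') [0..<Suc j])) s') \<and> t' \<le> t3 + ?T) s3 t3"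
        by (elim wp_mono) (use h3 r3 same_trans[of kid_regs s2 s3 kid_regs] in auto)
    qed (simp_all add: same_def)
    then have "wp (seqs (map (row_prog k) [0..<k])) (wp Skip (wp (Oper (NAdd 6 6 22)) (wp Skip Q))) s2 (t + 10)"
    proof (rule wp_mono)
      fix s3 t3
      assume h3: "(env s3 \<and> same kid_regs s2 s3 \<and> rreg s3 7 = rreg s2 7 \<and>
        nodes (ns @ concat (map (kidsj (adr h) ?x (nreg s 3) e') [0..<k])) s3) \<and> t3 \<le> t + 10 + k * ?T + 1"
      have "same {9, 19, 20} s s2" by (simp add: same_def s2_def)
      then have "same (tree_regs - {6}) s s3" by (rule same_trans[of _ _ _ kid_regs]) (use h3 in auto)
      then show "wp Skip (wp (Oper (NAdd 6 6 22)) (wp Skip Q)) s3 t3"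
        unfolding wp_Skip[of "wp (Oper (NAdd 6 6 22)) (wp Skip Q)"] using h3
        by (intro fin) (simp_all add: s2_def kids_def Suc)
    qed
    moreover have "step (NSub 19 19 1) s1 = s\<lparr>nreg := (nreg s)(9 := adr h + 8, 19 := e')\<rparr>"
      using Suc r by (simp add: s1_def)
    ultimately show ?thesis unfolding eq wp_If seqs.simps wp_Seq wp_Oper[of "NSub 19 19 1"] wp_ld[of 6 20, simplified]
      using Suc r a rec by (simp add: s1_def s2_def is_node_def add.commute[of t] fun_upd_twist)
  qed
  then show ?thesis unfolding Q_def .
qed


section \<open>Size of the tree and the breadth-first search\<close>

primrec tree_size :: "nat \<Rightarrow> nat" where
  "tree_size 0 = 1"
| "tree_size (Suc e) = 1 + k * \<Delta> * tree_size e"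

text \<open>A context gains at most \<open>\<Delta>\<close> entries per level; the last conjunct
  turns this into a bound on the time of a walk.\<close>

definition vnode :: "nat \<Rightarrow> nat \<Rightarrow> node \<Rightarrow> bool" where
  "vnode r D x \<longleftrightarrow> good (Suc r) (ctx x) \<and> vtx x \<in> alive (Suc r) (ctx x) \<and> col x < k \<and> jp x < k \<and>
     dep x \<le> D \<and> length (ctx x) \<le> \<Delta> * (D - dep x)"

lemma vnode_vtx: "vnode r D x \<Longrightarrow> vtx x < ug_order G"
  using alive_bound by (auto simp: vnode_def)

lemma kids_props:
  assumes x: "vnode r D x" and y: "y \<in> set (kids a x r)"
  shows "vnode r D y" "par y = a"
proof -
  from y obtain e where e: "dep x = Suc e" by (cases "dep x") (auto simp: kids_def)
  with y obtain j where j: "j < k" "y \<in> set (kidsj a x r e j)" by (auto simp: kids_def)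
  then obtain v c M where m: "(v, c, M) \<in> set (steps (Suc r) (vtx x) j ((vtx x, k) # ctx x) (N (vtx x)))"
    "y = Node v c M a j e" by (auto simp: kidsj_def mk_node_def)
  have g: "good (Suc r) (ctx x)" "vtx x \<in> alive (Suc r) (ctx x)" using x by (simp_all add: vnode_def)
  note st = steps_good[OF g j(1) m(1)]
  have "length M \<le> \<Delta> * (D - Suc e) + \<Delta>" using st(4) x by (simp add: vnode_def e)
  also have "\<dots> = \<Delta> * Suc (D - Suc e)" by simp
  also have "Suc (D - Suc e) = D - e" using x[unfolded vnode_def e] by linarith
  finally show "vnode r D y" using st j x by (simp add: vnode_def m e)
  show "par y = a" by (simp add: m)
qed

lemma sum_list_le_bound: "(\<And>x. x \<in> set xs \<Longrightarrow> f x \<le> (c :: nat)) \<Longrightarrow> sum_list (map f xs) \<le> length xs * c"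
  by (induction xs) (fastforce intro: add_mono)+

lemma length_concat_bound: "(\<And>x. x \<in> set xs \<Longrightarrow> length (f x) \<le> c) \<Longrightarrow> length (concat (map f xs)) \<le> length xs * c"
  by (induction xs) (fastforce intro: add_mono)+

text \<open>Replacing a node by itself, now expanded and counted 1, and its children does not
  increase the potential in the last condition of \<open>bfs\<close>.\<close>

lemma kids_tree_size:
  assumes x: "vnode r D x"
  shows "Suc (\<Sum>y\<leftarrow>kids a x r. tree_size (dep y)) \<le> tree_size (dep x)"
proof (cases "dep x")
  case (Suc e)
  have u: "vtx x < ug_order G" using x by (rule vnode_vtx)
  have "length (kidsj a x r e j) \<le> \<Delta>" if "j < k" for j
  proof -
    have "length (kidsj a x r e j) = length (filter (\<lambda>v. v \<in> alive (Suc r) ((vtx x, k) # ctx x)) (N (vtx x)))"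
      unfolding kidsj_def length_map using sig_less[OF u _ that] by (intro length_steps)
    also have "\<dots> \<le> length (N (vtx x))" by (rule length_filter_le)
    finally show ?thesis using N_length[OF u] by simp
  qed
  then have l: "length (kids a x r) \<le> k * \<Delta>"
    using length_concat_bound[of "[0..<k]" "kidsj a x r e" \<Delta>] by (simp add: kids_def Suc)
  have "dep y = e" if "y \<in> set (kids a x r)" for y
    using that by (auto simp: kids_def Suc kidsj_def mk_node_def)
  then have "(\<Sum>y\<leftarrow>kids a x r. tree_size (dep y)) \<le> length (kids a x r) * tree_size e"
    by (intro sum_list_le_bound) simp
  also have "\<dots> \<le> k * \<Delta> * tree_size e" using l by (rule mult_le_mono1)
  finally show ?thesis by (simp add: Suc)
qed (simp add: kids_def)

text \<open>
  In this breadth-first search the nodes before \<open>h\<close> are expanded; the last condition bounds the final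
  number of nodes.
\<close>

definition bfs :: "nat \<Rightarrow> nat \<Rightarrow> nat \<Rightarrow> node list \<Rightarrow> bool" where
  "bfs r D h ns \<longleftrightarrow> h \<le> length ns \<and> ns \<noteq> [] \<and> ns ! 0 = Node r 0 [] 0 0 D \<and> (\<forall>x\<in>set ns. vnode r D x) \<and>
     (\<forall>q<length ns. par (ns ! q) = 0 \<and> jp (ns ! q) = 0 \<or> (\<exists>q'<q. par (ns ! q) = adr q')) \<and>
     (\<forall>q<h. filter (\<lambda>x. par x = adr q) ns = kids (adr q) (ns ! q) r) \<and>
     (\<forall>q\<ge>h. filter (\<lambda>x. par x = adr q) ns = []) \<and>
     h + (\<Sum>x\<leftarrow>drop h ns. tree_size (dep x)) \<le> tree_size D"

lemma bfs_step:
  assumes b: "bfs r D h ns" and h: "h < length ns"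
  shows "bfs r D (Suc h) (ns @ kids (adr h) (ns ! h) r)" "h < tree_size D"
proof -
  let ?K = "kids (adr h) (ns ! h) r"
  have x: "vnode r D (ns ! h)" using b h by (simp add: bfs_def)
  have par: "par y = adr h" if "y \<in> set ?K" for y using kids_props[OF x that] by simp
  have f: "filter (\<lambda>x. par x = adr q) ?K = (if q = h then ?K else [])" for q
    using par by (auto simp: filter_id_conv filter_empty_conv adr_inj)
  have "drop h ns = ns ! h # drop (Suc h) ns" using h by (simp add: Cons_nth_drop_Suc)
  then have s: "h + (tree_size (dep (ns ! h)) + (\<Sum>x\<leftarrow>drop (Suc h) ns. tree_size (dep x))) \<le> tree_size D"
    using b by (simp add: bfs_def)
  then have "Suc h + (\<Sum>x\<leftarrow>drop (Suc h) (ns @ ?K). tree_size (dep x)) \<le> tree_size D"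
    using kids_tree_size[OF x, of "adr h"] h by simp
  moreover have "\<forall>q<length (ns @ ?K). par ((ns @ ?K) ! q) = 0 \<and> jp ((ns @ ?K) ! q) = 0 \<or> (\<exists>q'<q. par ((ns @ ?K) ! q) = adr q')"
  proof (intro allI impI)
    fix q assume q: "q < length (ns @ ?K)"
    show "par ((ns @ ?K) ! q) = 0 \<and> jp ((ns @ ?K) ! q) = 0 \<or> (\<exists>q'<q. par ((ns @ ?K) ! q) = adr q')"
    proof (cases "q < length ns")
      case True
      then show ?thesis using b by (simp add: bfs_def nth_append)
    next
      case False
      then have "par ((ns @ ?K) ! q) = adr h" using q by (intro par) (simp add: nth_append)
      then show ?thesis using False h by (intro disjI2 exI[of _ h]) simp
    qed
  qed
  moreover have "\<forall>x\<in>set (ns @ ?K). vnode r D x" using b kids_props(1)[OF x] by (auto simp: bfs_def)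
  ultimately show "bfs r D (Suc h) (ns @ ?K)"
    using b h unfolding bfs_def by (auto simp: f nth_append less_Suc_eq)
  have "0 < tree_size e" for e by (cases e) simp_all
  then show "h < tree_size D" using s by (metis add_gr_0 less_add_same_cancel1 order_less_le_trans)
qed

lemma bfs_start:
  assumes "r < ug_order G"
  shows "bfs r D 0 [Node r 0 [] 0 0 D]"
  using assms k3 base_pos adr_ge good_Nil[of "Suc r"]
  by (auto simp: bfs_def vnode_def alive_def adr_def)

text \<open>Every expansion moves \<open>h\<close> up by one, and \<open>h\<close> stays below
  \<open>tree_size D\<close> as long as a node is unexpanded; their difference is the measure of the
  induction.\<close>

lemma wp_forward:
  assumes "env s" "nodes ns s" "bfs (nreg s 3) D h ns" "nreg s 6 = adr h"
  defines "TE \<equiv> k * (\<Delta> * (4 * k + 30 * (\<Delta> * D + 1 + \<Delta>) + 81) + 12) + 31"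
  shows "wp (While (NLess 6 5) (expand_prog k)) (\<lambda>s' t'. env s' \<and> same tree_regs s s' \<and> rreg s' 7 = rreg s 7 \<and>
     (\<exists>ns'. nodes ns' s' \<and> bfs (nreg s 3) D (length ns') ns') \<and> t' \<le> t + (tree_size D - h) * TE + 1) s t"
  using assms(1-4)
proof (induction "tree_size D - h" arbitrary: s ns h t rule: less_induct)
  case less
  have T: "nreg s 5 = adr (length ns)" using less.prems by (simp add: nodes_def)
  show ?case (is "wp _ ?Q s t")
  proof (cases "h < length ns")
    case True
    let ?ns = "ns @ kids (adr h) (ns ! h) (nreg s 3)"
    note st = bfs_step[OF less.prems(3) True]
    have x: "vnode (nreg s 3) D (ns ! h)" using less.prems(3) True by (simp add: bfs_def)
    have M: "length (ctx (ns ! h)) + 1 + \<Delta> \<le> \<Delta> * D + 1 + \<Delta>"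
      using x[unfolded vnode_def] mult_le_mono2[of "D - dep (ns ! h)" D \<Delta>] by linarith
    show ?thesis
    proof (rule wp_While_True)
      show "holds (NLess 6 5) s" using T less.prems(4) adr_less[OF True] by simp
      show "wp (expand_prog k) (wp (While (NLess 6 5) (expand_prog k)) ?Q) s (t + 1)"
      proof (rule wp_mono[OF wp_expand[OF less.prems(1,2) True less.prems(4) vnode_vtx[OF x] M]])
        fix s' t'
        assume h': "env s' \<and> same tree_regs s s' \<and> rreg s' 7 = rreg s 7 \<and> nreg s' 6 = adr (Suc h) \<and> nodes ?ns s' \<and>
          t' \<le> t + 1 + (k * (\<Delta> * (4 * k + 30 * (\<Delta> * D + 1 + \<Delta>) + 81) + 12) + 30)"
        have r: "nreg s' 3 = nreg s 3" using h' sameD[of tree_regs s s' 3] by simp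
        have "(tree_size D - h) * TE = TE + (tree_size D - Suc h) * TE" using st(2) by (metis Suc_diff_Suc mult_Suc)
        then have t': "t' + (tree_size D - Suc h) * TE + 1 \<le> t + (tree_size D - h) * TE + 1"
          using h' by (simp add: TE_def)
        have "wp (While (NLess 6 5) (expand_prog k)) (\<lambda>s'' t''. env s'' \<and> same tree_regs s' s'' \<and> rreg s'' 7 = rreg s' 7 \<and>
         (\<exists>ns'. nodes ns' s'' \<and> bfs (nreg s' 3) D (length ns') ns') \<and> t'' \<le> t' + (tree_size D - Suc h) * TE + 1) s' t'"
          by (rule less.hyps) (use h' st r in auto)
        then show "wp (While (NLess 6 5) (expand_prog k)) ?Q s' t'"
          by (rule wp_mono) (use h' t' r same_trans[of tree_regs s s' tree_regs] in auto)
      qed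
    qed
  next
    case False
    then have "h = length ns" using less.prems(3) by (simp add: bfs_def)
    then show ?thesis using less.prems T by (intro wp_While_False) (auto simp: same_def)
  qed
qed

end

section \<open>Evaluating the recursion tree\<close>

text \<open>Takes the last record left, normalizes its weights and sends its factor to the parent.
  As the root comes last, the sum that finally remains in real register 6 is the one the product
  over the roots needs.\<close>

definition pull_prog :: "nat \<Rightarrow> prog" where
  "pull_prog k = seqs [Oper (NSub 5 5 22), Oper (RSub 6 3 3),
     seqs (map (\<lambda>i. seqs [rld 4 5 i, Oper (RAdd 6 6 4)]) [0..<k]),
     ld 16 5 1, Oper (NAdd 13 5 16), Oper (RLoad 4 13), Oper (RDiv 4 4 6), Oper (RMul 4 4 2),
     Oper (RAdd 4 4 3), ld 11 5 6, ld 12 5 7, Oper (NAdd 13 11 12), Oper (RLoad 5 13),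
     Oper (RMul 5 5 4), Oper (RStore 13 5)]"

lemma wp_pull:
  fixes k :: nat and s :: state
  assumes "rreg s 3 = 1"
  defines "a \<equiv> nreg s 5 - nreg s 22"
  defines "S \<equiv> \<Sum>i<k. rmem s (a + i)"
  defines "p \<equiv> nmem s (a + 6) + nmem s (a + 7)"
  shows "wp (pull_prog k) (\<lambda>s' t'. nmem s' = nmem s \<and> same {5, 9, 11, 12, 13, 16} s s' \<and> nreg s' 5 = a \<and>
     (\<forall>i. i \<notin> {4, 5, 6} \<longrightarrow> rreg s' i = rreg s i) \<and> rreg s' 6 = S \<and>
     rmem s' = (rmem s)(p := rmem s p * (1 + rreg s 2 * (rmem s (a + nmem s (a + 1)) / S))) \<and>
     t' \<le> t + (6 * k + 30)) s t"
    (is "wp _ ?Q s t")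
proof -
  define s1 where "s1 = s\<lparr>nreg := (nreg s)(5 := a), rreg := (rreg s)(6 := 0)\<rparr>"
  let ?I = "\<lambda>m s'. nmem s' = nmem s \<and> rmem s' = rmem s \<and> same {9} s1 s' \<and>
     (\<forall>i. i \<notin> {4, 6} \<longrightarrow> rreg s' i = rreg s i) \<and> rreg s' 6 = (\<Sum>i<m. rmem s (a + i))"
  let ?rest = "seqs [ld 16 5 1, Oper (NAdd 13 5 16), Oper (RLoad 4 13), Oper (RDiv 4 4 6), Oper (RMul 4 4 2),
     Oper (RAdd 4 4 3), ld 11 5 6, ld 12 5 7, Oper (NAdd 13 11 12), Oper (RLoad 5 13),
     Oper (RMul 5 5 4), Oper (RStore 13 5)]"
  have "wp (seqs (map (\<lambda>i. seqs [rld 4 5 i, Oper (RAdd 6 6 4)]) [0..<k])) (\<lambda>s' t'. ?I k s' \<and> t' \<le> t + 2 + k * 6 + 1) s1 (t + 2)"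
  proof (rule wp_unrolled)
    fix i s2 t2 assume "i < k" and h: "?I i s2"
    have "nreg s2 5 = a" using sameD[of "{9}" s1 s2 5] h by (simp add: s1_def)
    then show "wp (seqs [rld 4 5 i, Oper (RAdd 6 6 4)]) (\<lambda>s' t'. ?I (Suc i) s' \<and> t' \<le> t2 + 6) s2 t2"
      using h by (simp add: wp_simps same_def)
  qed (simp add: s1_def same_def)
  then have "wp (seqs (map (\<lambda>i. seqs [rld 4 5 i, Oper (RAdd 6 6 4)]) [0..<k]))
     (wp ?rest ?Q) s1 (t + 2)"
  proof (rule wp_mono)
    fix s2 t2 assume h: "?I k s2 \<and> t2 \<le> t + 2 + k * 6 + 1"
    have n: "nreg s2 i = (if i = 5 then a else nreg s i)" if "i \<noteq> 9" for i
      using sameD[of "{9}" s1 s2 i] h that by (simp add: s1_def)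
    have r: "rreg s2 6 = S" "rreg s2 2 = rreg s 2" "rreg s2 3 = 1" using h assms(1) by (simp_all add: S_def)
    show "wp ?rest ?Q s2 t2"
      using h r by (simp add: wp_simps n same_def p_def mult.commute add.commute)
  qed
  then show ?thesis unfolding pull_prog_def
    using assms(1) by (simp add: wp_Seq wp_Oper s1_def a_def[symmetric])
qed

definition root_prog :: "nat \<Rightarrow> prog" where
  "root_prog k = seqs [Oper (NAdd 6 4 0), Oper (NAdd 5 4 0), st 5 0 3, st 5 1 0, st 5 2 0, st 5 3 3, st 5 4 2,
     st 5 5 0, st 5 6 0, st 5 7 0, st 5 8 8, init_prog k, Oper (NAdd 5 5 22),
     While (NLess 6 5) (expand_prog k), While (NLess 4 5) (pull_prog k), Oper (RMul 7 7 6), Oper (NAdd 3 3 1)]"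

context ug_run begin

definition kid_factor :: "nat \<Rightarrow> node \<Rightarrow> real" where
  "kid_factor r x = 1 + (w - 1) * est_marg (dep x) (Suc r) (ctx x) (vtx x) (col x)"

lemma filter_kidsj:
  "filter (\<lambda>y. jp y = i) (concat (map (kidsj a x r e) [0..<m])) = (if i < m then kidsj a x r e i else [])"
proof -
  have "filter (\<lambda>y. jp y = i) (kidsj a x r e j) = (if i = j then kidsj a x r e j else [])" for j
    by (auto simp: kidsj_def mk_node_def filter_empty_conv filter_id_conv)
  then show ?thesis by (induction m) (auto simp: less_Suc_eq)
qed

lemma est_kids:
  assumes "i < k"
  shows "est (dep x) (Suc r) (ctx x) (vtx x) i =
    pinw x i * (\<Prod>y\<leftarrow>filter (\<lambda>y. jp y = i) (kids a x r). kid_factor r y)"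
proof (cases "dep x")
  case 0
  then show ?thesis by (simp add: kids_def pinw_def)
next
  case (Suc e)
  have "map (kid_factor r) (kidsj a x r e i) = map (\<lambda>(v, c, M). 1 + (w - 1) * est_marg e (Suc r) M v c)
     (steps (Suc r) (vtx x) i ((vtx x, k) # ctx x) (N (vtx x)))"
    by (auto simp: kidsj_def kid_factor_def mk_node_def)
  then show ?thesis unfolding Suc est_Suc using assms by (simp add: kids_def Suc filter_kidsj pinw_def)
qed

text \<open>The records from \<open>m\<close> on have been pulled already, so the cells of an
  earlier record hold its pin weights times the factors of its children among them.\<close>

definition pushed :: "nat \<Rightarrow> node list \<Rightarrow> nat \<Rightarrow> state \<Rightarrow> bool" where
  "pushed r ns m s \<longleftrightarrow> nreg s 5 = adr m \<and> (\<forall>q<length ns. is_node k (nmem s) (adr q) (ns ! q)) \<and>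
     (\<forall>q<m. \<forall>i<k. rmem s (adr q + i) =
       pinw (ns ! q) i * (\<Prod>y\<leftarrow>filter (\<lambda>y. par y = adr q \<and> jp y = i) (drop m ns). kid_factor r y))"

lemma nodes_pushed: "nodes ns s \<Longrightarrow> pushed r ns (length ns) s"
  by (simp add: nodes_def pushed_def)

text \<open>
  All children of a node come after it in the list, so its weights are complete when it is reached
  from the end.
\<close>

lemma wp_backward:
  assumes b: "bfs r D (length ns) ns" and "env s" "pushed r ns m s" "m \<le> length ns"
    and "m = 0 \<Longrightarrow> rreg s 6 = (\<Sum>j<k. est D (Suc r) [] r j)"
  shows "wp (While (NLess 4 5) (pull_prog k)) (\<lambda>s' t'. env s' \<and> same tree_regs s s' \<and> rreg s' 7 = rreg s 7 \<and>
     rreg s' 6 = (\<Sum>j<k. est D (Suc r) [] r j) \<and> t' \<le> t + m * (6 * k + 31) + 1) s t"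
  using assms(2-)
proof (induction m arbitrary: s t)
  case 0
  then show ?case by (intro wp_While_False) (auto simp: env_def pushed_def adr_def same_def)
next
  case (Suc m)
  let ?x = "ns ! m"
  have m: "m < length ns" using Suc.prems by simp
  have e: "nreg s 5 = adr m + (k + 9)" "nreg s 22 = k + 9" "nreg s 4 = base" "rreg s 3 = 1" "rreg s 2 = w - 1"
    using Suc.prems(1,2) by (simp_all add: pushed_def env_def adr_Suc)
  have a: "nreg s 5 - nreg s 22 = adr m" by (simp add: e)
  have rec: "is_node k (nmem s) (adr m) ?x" using Suc.prems(2) m by (simp add: pushed_def)
  then have cell: "nmem s (adr m + 1) = col ?x" "nmem s (adr m + 6) = par ?x" "nmem s (adr m + 7) = jp ?x"
    by (simp_all add: is_node_def)
  have x: "vnode r D ?x" using b m by (simp add: bfs_def)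
  have parx: "par ?x = 0 \<and> jp ?x = 0 \<or> (\<exists>q<m. par ?x = adr q)" using b m by (simp add: bfs_def)
  have "filter (\<lambda>y. par y = adr m) (take (Suc m) ns) = []"
  proof -
    have "par (ns ! q) \<noteq> adr m" if "q \<le> m" for q
    proof -
      have "q < length ns" using that m by simp
      then have "par (ns ! q) = 0 \<or> (\<exists>q'<q. par (ns ! q) = adr q')" using b unfolding bfs_def by blast
      then show ?thesis using adr_ge[of m] base_pos that by (auto simp: adr_inj)
    qed
    then show ?thesis by (auto simp: filter_empty_conv in_set_conv_nth)
  qed
  moreover have "filter (\<lambda>y. par y = adr m) ns = kids (adr m) ?x r" using b m by (simp add: bfs_def)
  ultimately have kf: "filter (\<lambda>y. par y = adr m) (drop (Suc m) ns) = kids (adr m) ?x r"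
    by (metis append_take_drop_id filter_append self_append_conv2)
  have R: "rmem s (adr m + i) = est (dep ?x) (Suc r) (ctx ?x) (vtx ?x) i" if "i < k" for i
  proof -
    have "filter (\<lambda>y. par y = adr m \<and> jp y = i) (drop (Suc m) ns) = filter (\<lambda>y. jp y = i) (kids (adr m) ?x r)"
      unfolding kf[symmetric] by (simp add: conj_commute)
    then show ?thesis using Suc.prems(2) that unfolding est_kids[OF that, of ?x r "adr m"] by (simp add: pushed_def)
  qed
  define S where "S = (\<Sum>i<k. rmem s (adr m + i))"
  have S: "S = (\<Sum>i<k. est (dep ?x) (Suc r) (ctx ?x) (vtx ?x) i)" unfolding S_def using R by simp
  define p where "p = par ?x + jp ?x"
  have kid_factor: "1 + (w - 1) * (rmem s (adr m + col ?x) / S) = kid_factor r ?x"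
    using R[of "col ?x"] x unfolding kid_factor_def est_marg_def S by (simp add: vnode_def)
  have dr: "drop m ns = ?x # drop (Suc m) ns" using m by (simp add: Cons_nth_drop_Suc)
  show ?case (is "wp _ ?Q s t")
  proof (rule wp_While_True)
    show "holds (NLess 4 5) s" using e adr_ge[of m] k3 by simp
    show "wp (pull_prog k) (wp (While (NLess 4 5) (pull_prog k)) ?Q) s (t + 1)"
    proof (rule wp_mono[OF wp_pull[where k = k, OF e(4), unfolded a cell S_def[symmetric] e(5) kid_factor p_def[symmetric]]])
      fix s' t'
      assume h: "nmem s' = nmem s \<and> same {5, 9, 11, 12, 13, 16} s s' \<and> nreg s' 5 = adr m \<and>
         (\<forall>i. i \<notin> {4, 5, 6} \<longrightarrow> rreg s' i = rreg s i) \<and> rreg s' 6 = S \<and>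
         rmem s' = (rmem s)(p := rmem s p * kid_factor r ?x) \<and> t' \<le> t + 1 + (6 * k + 30)"
      have "env s'" by (rule env_same[OF Suc.prems(1), of "{5, 9, 11, 12, 13, 16}"])
          (use h Suc.prems(1) in \<open>simp_all add: env_def\<close>)
      moreover have "pushed r ns m s'"
      proof -
        have "rmem s' (adr q + i) = pinw (ns ! q) i *
            (\<Prod>y\<leftarrow>filter (\<lambda>y. par y = adr q \<and> jp y = i) (drop m ns). kid_factor r y)" if q: "q < m" "i < k" for q i
        proof -
          have eq: "rmem s (adr q + i) = pinw (ns ! q) i *
            (\<Prod>y\<leftarrow>filter (\<lambda>y. par y = adr q \<and> jp y = i) (drop (Suc m) ns). kid_factor r y)"
            using Suc.prems(2) q by (simp add: pushed_def)
          \<comment> \<open>Weight cells of different records are disjoint because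
            \<open>jp ?x\<close> is below the record size. The root sends its factor to address 0,
            which lies outside the node area.\<close>
          have "adr q + i = p \<longleftrightarrow> par ?x = adr q \<and> jp ?x = i"
            using parx
          proof
            assume "par ?x = 0 \<and> jp ?x = 0"
            then show ?thesis using base_pos adr_ge[of q] by (simp add: p_def)
          next
            assume "\<exists>q'<m. par ?x = adr q'"
            then obtain q' where q': "par ?x = adr q'" by blast
            have j: "jp ?x < k" using x by (simp add: vnode_def)
            show ?thesis using adr_less[of q q'] adr_less[of q' q] q' j q(2)
              by (cases q q' rule: linorder_cases) (auto simp: p_def adr_inj)
          qed
          then show ?thesis using eq h by (auto simp: dr)
        qed
        then show ?thesis using h Suc.prems(2) by (simp add: pushed_def)
      qed
      moreover have "m = 0 \<Longrightarrow> rreg s' 6 = (\<Sum>j<k. est D (Suc r) [] r j)"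
        using b h S by (simp add: bfs_def)
      ultimately have "wp (While (NLess 4 5) (pull_prog k)) (\<lambda>s'' t''. env s'' \<and> same tree_regs s' s'' \<and> rreg s'' 7 = rreg s' 7 \<and>
          rreg s'' 6 = (\<Sum>j<k. est D (Suc r) [] r j) \<and> t'' \<le> t' + m * (6 * k + 31) + 1) s' t'"
        using m by (intro Suc.IH) simp_all
      then show "wp (While (NLess 4 5) (pull_prog k)) ?Q s' t'"
        by (rule wp_mono) (use h same_trans[of "{5, 9, 11, 12, 13, 16}" s s' tree_regs _ tree_regs] in auto)
    qed
  qed
qed

definition root_time :: "nat \<Rightarrow> nat" where
  "root_time D = tree_size D * (k * (\<Delta> * (4 * k + 30 * (\<Delta> * D + 1 + \<Delta>) + 81) + 12) + 31 + 6 * k + 31) + 4 * k + 60"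

lemma wp_rootp:
  assumes e: "env s" and r: "nreg s 3 = r" "r < ug_order G" and D: "nreg s 8 = D"
  shows "wp (root_prog k) (\<lambda>s' t'. env s' \<and> same (insert 3 tree_regs) s s' \<and> nreg s' 3 = Suc r \<and>
     rreg s' 7 = rreg s 7 * (\<Sum>j<k. est D (Suc r) [] r j) \<and> t' \<le> t + root_time D) s t"
    (is "wp _ ?Q s t")
proof -
  have rg: "nreg s 0 = 0" "nreg s 1 = 1" "nreg s 2 = k" "nreg s 22 = k + 9" "nreg s 4 = base" "rreg s 3 = 1"
    using e by (simp_all add: env_def)
  let ?x = "Node r 0 [] 0 0 D" and ?TE = "k * (\<Delta> * (4 * k + 30 * (\<Delta> * D + 1 + \<Delta>) + 81) + 12) + 31"
  define M where "M = (nmem s)(base := r, base + 1 := 0, base + 2 := 0, base + 3 := r, base + 4 := k,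
     base + 5 := 0, base + 6 := 0, base + 7 := 0, base + 8 := D)"
  let ?rest = "[While (NLess 6 5) (expand_prog k), While (NLess 4 5) (pull_prog k), Oper (RMul 7 7 6), Oper (NAdd 3 3 1)]"
  let ?s1 = "s\<lparr>nreg := (nreg s)(6 := base, 5 := base, 9 := base + 8), nmem := M\<rparr>"
  have at: "M base = r" "M (base + 1) = 0" "M (base + 2) = 0" "M (base + 3) = r"
    "M (base + 4) = k" "M (base + 5) = 0" "M (base + 6) = 0" "M (base + 7) = 0" "M (base + 8) = D"
    by (simp_all add: M_def)
  have below: "M y = nmem s y" if "y < base" for y using that by (simp add: M_def)
  define t0 where "t0 = t + 1 + 1 + 4 + 4 + 4 + 4 + 4 + 4 + 4 + 4 + 4"
  have t0: "t0 = t + 38" by (simp add: t0_def)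
  have eq: "wp (root_prog k) ?Q s t = wp (init_prog k) (wp (Oper (NAdd 5 5 22)) (wp (seqs ?rest) ?Q)) ?s1 t0"
    proof -
    have "wp (Seq c d) Q = wp c (wp d Q)" for c d Q by (intro ext) (rule wp_Seq)
    then show ?thesis unfolding root_prog_def M_def t0_def by (simp add: wp_Oper wp_st rg r D)
  qed
  have "wp (init_prog k) (\<lambda>s' t'. (nmem s' = nmem ?s1 \<and> rreg s' = rreg ?s1 \<and> same {9} ?s1 s' \<and>
      (\<forall>i<k. rmem s' (nreg ?s1 5 + i) = 1) \<and> (\<forall>x<nreg ?s1 5. rmem s' x = rmem ?s1 x)) \<and> t' \<le> t0 + k * 4 + 1) ?s1 t0"
    by (rule wp_init1) (simp add: rg)
  then have "wp (init_prog k) (wp (Oper (NAdd 5 5 22)) (wp (seqs ?rest) ?Q)) ?s1 t0"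
  proof (rule wp_mono)
    fix s2 t2
    assume h2: "(nmem s2 = nmem ?s1 \<and> rreg s2 = rreg ?s1 \<and> same {9} ?s1 s2 \<and>
      (\<forall>i<k. rmem s2 (nreg ?s1 5 + i) = 1) \<and> (\<forall>x<nreg ?s1 5. rmem s2 x = rmem ?s1 x)) \<and> t2 \<le> t0 + k * 4 + 1"
    define s3 where "s3 = step (NAdd 5 5 22) s2"
    have n3: "nreg s3 i = (if i = 5 then base + (k + 9) else if i = 6 then base else nreg s i)" if "i \<noteq> 9" for i
      using sameD[of "{9}" ?s1 s2] h2 rg that by (simp add: s3_def)
    have m3: "nmem s3 = M" "rreg s3 = rreg s" "\<And>i. i < k \<Longrightarrow> rmem s3 (base + i) = 1"
      using h2 by (simp_all add: s3_def)
    have same3: "same tree_regs s s3" using n3 by (simp add: same_def)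
    have e3: "env s3" by (rule env_same[OF e same3]) (use e m3 below in \<open>simp_all add: env_def\<close>)
    have "is_node k M base ?x" unfolding is_node_def at by simp
    then have nodes3: "nodes [?x] s3" using m3 by (simp add: nodes_def adr_def n3 pinw_def)
    have "wp (While (NLess 6 5) (expand_prog k)) (\<lambda>s' t'. env s' \<and> same tree_regs s3 s' \<and> rreg s' 7 = rreg s3 7 \<and>
     (\<exists>ns'. nodes ns' s' \<and> bfs (nreg s3 3) D (length ns') ns') \<and> t' \<le> t2 + 1 + (tree_size D - 0) * ?TE + 1) s3 (t2 + 1)"
      by (rule wp_forward[OF e3 nodes3]) (use bfs_start r in \<open>simp_all add: n3 adr_def\<close>)
    then have "wp (seqs ?rest) ?Q s3 (t2 + 1)" unfolding seqs.simps wp_Seq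
    proof (rule wp_mono)
      fix s4 t4
      assume h4: "env s4 \<and> same tree_regs s3 s4 \<and> rreg s4 7 = rreg s3 7 \<and>
       (\<exists>ns'. nodes ns' s4 \<and> bfs (nreg s3 3) D (length ns') ns') \<and> t4 \<le> t2 + 1 + (tree_size D - 0) * ?TE + 1"
      then obtain ns where ns: "nodes ns s4" "bfs r D (length ns) ns" using r by (auto simp: n3)
      have len: "length ns \<le> tree_size D" "length ns \<noteq> 0" using ns(2) by (simp_all add: bfs_def)
      have "wp (While (NLess 4 5) (pull_prog k)) (\<lambda>s' t'. env s' \<and> same tree_regs s4 s' \<and> rreg s' 7 = rreg s4 7 \<and>
         rreg s' 6 = (\<Sum>j<k. est D (Suc r) [] r j) \<and> t' \<le> t4 + length ns * (6 * k + 31) + 1) s4 t4"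
        by (rule wp_backward[OF ns(2) _ nodes_pushed[OF ns(1)]]) (use h4 len in simp_all)
      then show "wp (While (NLess 4 5) (pull_prog k)) (wp (Oper (RMul 7 7 6)) (wp (Oper (NAdd 3 3 1)) (wp Skip ?Q))) s4 t4"
      proof (rule wp_mono)
        fix s5 t5
        assume h5: "env s5 \<and> same tree_regs s4 s5 \<and> rreg s5 7 = rreg s4 7 \<and>
         rreg s5 6 = (\<Sum>j<k. est D (Suc r) [] r j) \<and> t5 \<le> t4 + length ns * (6 * k + 31) + 1"
        have "length ns * (6 * k + 31) \<le> tree_size D * (6 * k + 31)" using len(1) by (rule mult_le_mono1)
        moreover have "t5 \<le> t4 + length ns * (6 * k + 31) + 1" "t4 \<le> t2 + 1 + tree_size D * ?TE + 1" "t2 \<le> t + 38 + k * 4 + 1"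
          using h5 h4 h2 t0 by simp_all
        ultimately have time: "t5 + 4 \<le> t + root_time D"
          unfolding root_time_def distrib_left[of "tree_size D"] by (simp add: algebra_simps)
        have "same tree_regs s3 s5" using h4 h5 same_trans[of tree_regs s3 s4 tree_regs s5 tree_regs] by simp
        then have same5: "same tree_regs s s5" using same3 same_trans[of tree_regs s s3 tree_regs s5 tree_regs] by simp
        have e5: "nreg s5 1 = 1" "nreg s5 3 = r" using h5 sameD[OF same5, of 3] r by (simp_all add: env_def)
        define s6 where "s6 = step (NAdd 3 3 1) (step (RMul 7 7 6) s5)"
        have "env s6" by (rule env_same[of s5 "{3}"]) (use h5 in \<open>simp_all add: s6_def same_def env_def\<close>)
        moreover have "same (insert 3 tree_regs) s s6" using same5 by (simp add: s6_def same_def)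
        ultimately show "wp (Oper (RMul 7 7 6)) (wp (Oper (NAdd 3 3 1)) (wp Skip ?Q)) s5 t5"
          unfolding wp_Oper wp_Skip s6_def[symmetric]
          using time e5 h5 h4 m3 by (simp add: s6_def)
      qed
    qed
    then show "wp (Oper (NAdd 5 5 22)) (wp (seqs ?rest) ?Q) s2 t2" unfolding wp_Oper s3_def .
  qed
  then show ?thesis unfolding eq .
qed

lemma wp_roots:
  assumes "env s" "nreg s 3 = r" "r \<le> ug_order G" "nreg s 8 = D" "nreg s 23 = ug_order G"
    and "rreg s 7 = (\<Prod>i<r. \<Sum>j<k. est D (Suc i) [] i j)"
  shows "wp (While (NLess 3 23) (root_prog k)) (\<lambda>s' t'. rreg s' 7 = approx D \<and>
     t' \<le> t + (ug_order G - r) * (root_time D + 1) + 1) s t"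
  using assms
proof (induction "ug_order G - r" arbitrary: s t r)
  case 0
  then show ?case by (intro wp_While_False) (simp_all add: approx_def)
next
  case (Suc d)
  then have r: "r < ug_order G" "d = ug_order G - Suc r" by simp_all
  show ?case (is "wp _ ?Q s t")
  proof (rule wp_While_True)
    show "holds (NLess 3 23) s" using Suc.prems r by simp
    show "wp (root_prog k) (wp (While (NLess 3 23) (root_prog k)) ?Q) s (t + 1)"
    proof (rule wp_mono[OF wp_rootp[OF Suc.prems(1,2) r(1) Suc.prems(4)]])
      fix s' t'
      assume h: "env s' \<and> same (insert 3 tree_regs) s s' \<and> nreg s' 3 = Suc r \<and>
        rreg s' 7 = rreg s 7 * (\<Sum>j<k. est D (Suc r) [] r j) \<and> t' \<le> t + 1 + root_time D"
      have "wp (While (NLess 3 23) (root_prog k)) (\<lambda>s' t''. rreg s' 7 = approx D \<and>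
       t'' \<le> t' + (ug_order G - Suc r) * (root_time D + 1) + 1) s' t'"
        by (rule Suc.hyps(1)[OF r(2)])
           (use h Suc.prems r sameD[of "insert 3 tree_regs" s s' 8] sameD[of "insert 3 tree_regs" s s' 23] in simp_all)
      moreover have "(ug_order G - r) * (root_time D + 1) = (root_time D + 1) + (ug_order G - Suc r) * (root_time D + 1)"
        using r by (metis Suc.hyps(2) mult_Suc)
      ultimately show "wp (While (NLess 3 23) (root_prog k)) ?Q s' t'"
        by (elim wp_mono) (use h in auto)
    qed
  qed
qed

end

section \<open>Reading the instance\<close>

definition half_edge_prog :: "nat \<Rightarrow> nat \<Rightarrow> prog" where
  "half_edge_prog a b = seqs [Oper (NAdd 12 7 a), Oper (NLoad 13 12), st 4 0 13, Oper (NStore 12 4), st 4 1 b]"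

definition copy_prog :: "nat \<Rightarrow> prog" where
  "copy_prog k = seqs (map (\<lambda>j. seqs [ld 13 27 (2 + j), st 4 (2 + j) 13]) [0..<k])"

definition copy_inv_prog :: "nat \<Rightarrow> prog" where
  "copy_inv_prog k = seqs (map (\<lambda>j. seqs [ld 13 27 (2 + j), Oper (NAdd 13 4 13), Oper (NConst 14 j), st 13 2 14]) [0..<k])"

definition edge_prog :: "nat \<Rightarrow> prog" where
  "edge_prog k = seqs [ld 10 27 0, ld 11 27 1, half_edge_prog 10 11, copy_prog k, Oper (NAdd 4 4 25),
     half_edge_prog 11 10, copy_inv_prog k, Oper (NAdd 4 4 25), Oper (NAdd 27 27 25)]"

lemma wp_half:
  assumes "a \<in> {10, 11}" "b \<in> {10, 11}"
  shows "wp (half_edge_prog a b) (\<lambda>s' t'. rreg s' = rreg s \<and> same {9, 12, 13} s s' \<and>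
     nmem s' = (nmem s)(nreg s 4 := nmem s (nreg s 7 + nreg s a), nreg s 7 + nreg s a := nreg s 4, nreg s 4 + 1 := nreg s b) \<and>
     t' \<le> t + 20) s t"
  using assms unfolding half_edge_prog_def by (auto simp: wp_simps same_def)

lemma wp_copy:
  assumes "nreg s 27 + 2 + k \<le> nreg s 4"
  shows "wp (copy_prog k) (\<lambda>s' t'. (rreg s' = rreg s \<and> same {9, 13} s s' \<and>
     (\<forall>y<nreg s 4 + 2. nmem s' y = nmem s y) \<and> (\<forall>j<k. nmem s' (nreg s 4 + 2 + j) = nmem s (nreg s 27 + 2 + j))) \<and>
     t' \<le> t + k * 9 + 1) s t"
  unfolding copy_prog_def
proof (rule wp_unrolled[where I = "\<lambda>m s'. rreg s' = rreg s \<and> same {9, 13} s s' \<and>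
     (\<forall>y<nreg s 4 + 2. nmem s' y = nmem s y) \<and> (\<forall>j<m. nmem s' (nreg s 4 + 2 + j) = nmem s (nreg s 27 + 2 + j))"])
  fix i s1 t1
  assume i: "i < k" and h: "rreg s1 = rreg s \<and> same {9, 13} s s1 \<and>
     (\<forall>y<nreg s 4 + 2. nmem s1 y = nmem s y) \<and> (\<forall>j<i. nmem s1 (nreg s 4 + 2 + j) = nmem s (nreg s 27 + 2 + j))"
  have r: "nreg s1 4 = nreg s 4" "nreg s1 27 = nreg s 27" using h sameD[of "{9, 13}" s s1] by simp_all
  have "nmem s1 (nreg s 27 + (2 + i)) = nmem s (nreg s 27 + 2 + i)" using h i assms by (simp add: add.assoc)
  then show "wp (seqs [ld 13 27 (2 + i), st 4 (2 + i) 13]) (\<lambda>s' t'. (rreg s' = rreg s \<and> same {9, 13} s s' \<and>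
     (\<forall>y<nreg s 4 + 2. nmem s' y = nmem s y) \<and>
     (\<forall>j<Suc i. nmem s' (nreg s 4 + 2 + j) = nmem s (nreg s 27 + 2 + j))) \<and> t' \<le> t1 + 9) s1 t1"
    using h r by (simp add: wp_simps same_def less_Suc_eq)
qed (simp add: same_def)

text \<open>Injectivity of \<open>\<pi>\<close> prevents a later write from destroying an earlier
  entry; the copied table lies below the record and is not touched.\<close>

lemma wp_copyinv:
  assumes "nreg s 27 + 2 + k \<le> nreg s 4" "\<And>j. j < k \<Longrightarrow> nmem s (nreg s 27 + 2 + j) = \<pi> j" "inj \<pi>"
  shows "wp (copy_inv_prog k) (\<lambda>s' t'. (rreg s' = rreg s \<and> same {9, 13, 14} s s' \<and>
     (\<forall>y<nreg s 4 + 2. nmem s' y = nmem s y) \<and> (\<forall>j<k. nmem s' (nreg s 4 + 2 + \<pi> j) = j)) \<and>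
     t' \<le> t + k * 11 + 1) s t"
  unfolding copy_inv_prog_def
proof (rule wp_unrolled[where I = "\<lambda>m s'. rreg s' = rreg s \<and> same {9, 13, 14} s s' \<and>
     (\<forall>y<nreg s 4 + 2. nmem s' y = nmem s y) \<and> (\<forall>j<m. nmem s' (nreg s 4 + 2 + \<pi> j) = j)"])
  fix i s1 t1
  assume i: "i < k" and h: "rreg s1 = rreg s \<and> same {9, 13, 14} s s1 \<and>
     (\<forall>y<nreg s 4 + 2. nmem s1 y = nmem s y) \<and> (\<forall>j<i. nmem s1 (nreg s 4 + 2 + \<pi> j) = j)"
  have r: "nreg s1 4 = nreg s 4" "nreg s1 27 = nreg s 27" using h sameD[of "{9, 13, 14}" s s1] by simp_all
  have "nmem s1 (nreg s 27 + (2 + i)) = \<pi> i" using h i assms(1) assms(2)[OF i] by (simp add: add.assoc)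
  then show "wp (seqs [ld 13 27 (2 + i), Oper (NAdd 13 4 13), Oper (NConst 14 i), st 13 2 14])
     (\<lambda>s' t'. (rreg s' = rreg s \<and> same {9, 13, 14} s s' \<and>
     (\<forall>y<nreg s 4 + 2. nmem s' y = nmem s y) \<and> (\<forall>j<Suc i. nmem s' (nreg s 4 + 2 + \<pi> j) = j)) \<and> t' \<le> t1 + 11) s1 t1"
    using h r injD[OF assms(3)] by (auto simp: wp_simps same_def less_Suc_eq)
qed (simp add: same_def)

text \<open>The new record goes to the front of the list of \<open>u\<close>. Old records lie
  between \<open>F\<close> and \<open>f\<close>, whereas writes below \<open>f\<close> hit only the
  head of \<open>u\<close>, which is below \<open>F\<close>.\<close>

lemma is_adj_insert:
  assumes "\<And>x. x < n \<Longrightarrow> is_adj sg k F f mem (mem (H + x)) x (N x)"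
    and "F = H + n" "F \<le> f" "0 < F" "u < n"
    and "mem' f = mem (H + u)" "mem' (f + 1) = v" "\<And>j. j < k \<Longrightarrow> mem' (f + 2 + j) = sg u v j"
    and "mem' (H + u) = f" "\<And>y. y < f \<Longrightarrow> y \<noteq> H + u \<Longrightarrow> mem' y = mem y"
    and x: "x < n"
  shows "is_adj sg k F (f + (k + 2)) mem' (mem' (H + x)) x ((N(u := v # N u)) x)"
proof -
  have old: "is_adj sg k F (f + (k + 2)) mem' (mem (H + x)) x (N x)" if "x < n" for x
    by (rule is_adj_cong[OF assms(1)[OF that]]) (use assms(2,5,10) in auto)
  show ?thesis using old[OF x] old[OF assms(5)] assms x by auto
qed

section \<open>The encoded edge list and its adjacency lists\<close>

fun is_input :: "ug \<Rightarrow> nat \<Rightarrow> (nat \<Rightarrow> nat) \<Rightarrow> nat \<Rightarrow> (nat \<times> nat) list \<Rightarrow> bool" where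
  "is_input G k mem p [] \<longleftrightarrow> True"
| "is_input G k mem p ((u, v) # es) \<longleftrightarrow> mem p = u \<and> mem (p + 1) = v \<and>
    (\<forall>j<k. mem (p + 2 + j) = ug_perm G u v j) \<and> is_input G k mem (p + (k + 2)) es"

lemma is_input_cong:
  "is_input G k mem p es \<Longrightarrow> (\<And>y. y < p + length es * (k + 2) \<Longrightarrow> mem' y = mem y) \<Longrightarrow> is_input G k mem' p es"
proof (induction es arbitrary: p)
  case (Cons a es)
  have "is_input G k mem' (p + (k + 2)) es" by (rule Cons.IH) (use Cons.prems in \<open>cases a; simp\<close>)+
  then show ?case using Cons.prems by (cases a) auto
qed simp

lemma is_input_concat:
  assumes "\<And>i. i < length (concat (map (\<lambda>(u, v). u # v # map (ug_perm G u v) [0..<k]) es)) \<Longrightarrow>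
    mem (p + i) = concat (map (\<lambda>(u, v). u # v # map (ug_perm G u v) [0..<k]) es) ! i"
  shows "is_input G k mem p es"
  using assms
proof (induction es arbitrary: p)
  case (Cons a es)
  obtain u v where a: "a = (u, v)" by (cases a)
  let ?c = "concat (map (\<lambda>(u, v). u # v # map (ug_perm G u v) [0..<k]) es)"
  let ?b = "u # v # map (ug_perm G u v) [0..<k]"
  have m: "mem (p + i) = (?b @ ?c) ! i" if "i < k + 2 + length ?c" for i
    using Cons.prems[of i] that by (simp add: a)
  have "is_input G k mem (p + (k + 2)) es"
  proof (rule Cons.IH)
    fix i assume "i < length ?c"
    then show "mem (p + (k + 2) + i) = ?c ! i" using m[of "k + 2 + i"] by (simp add: nth_append add.assoc)
  qed
  moreover have "mem (p + 2 + j) = ug_perm G u v j" if "j < k" for j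
    using m[of "2 + j"] that by (simp add: nth_append)
  ultimately show ?case using m[of 0] m[of 1] by (simp add: a)
qed simp

lemma length_encode: "length (concat (map (\<lambda>(u, v). u # v # map (ug_perm G u v) [0..<k]) es)) = length es * (k + 2)"
  by (induction es) auto

text \<open>The order in \<open>N\<close> is left open, as it depends on the order in which the
  input lists the edges.\<close>

definition adjacency :: "ug \<Rightarrow> nat \<Rightarrow> nat \<Rightarrow> nat \<Rightarrow> (nat \<times> nat) set \<Rightarrow> (nat \<Rightarrow> nat) \<Rightarrow> bool" where
  "adjacency G k H f A mem \<longleftrightarrow> (\<exists>N. \<forall>x<ug_order G. is_adj (edge_map G) k (H + ug_order G) f mem (mem (H + x)) x (N x) \<and>
     distinct (N x) \<and> set (N x) = {y. (x, y) \<in> A \<or> (y, x) \<in> A})"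

definition prepared :: "ug \<Rightarrow> nat \<Rightarrow> state \<Rightarrow> bool" where
  "prepared G k s \<longleftrightarrow> nreg s 0 = 0 \<and> nreg s 1 = 1 \<and> nreg s 2 = k \<and> nreg s 22 = k + 9 \<and> nreg s 23 = ug_order G \<and>
     nreg s 25 = k + 2 \<and> 2 \<le> nreg s 7 \<and> nreg s 7 + ug_order G \<le> nreg s 4"

lemma wp_edge:
  assumes inst: "ug_instance k G" and E: "(u, v) \<in> ug_edges G" "(u, v) \<notin> A" "(v, u) \<notin> A"
    and p: "prepared G k s" and inp: "is_input G k (nmem s) (nreg s 27) ((u, v) # es)"
    and H: "nreg s 27 + length ((u, v) # es) * (k + 2) = nreg s 7"
    and adj: "adjacency G k (nreg s 7) (nreg s 4) A (nmem s)"
  shows "wp (edge_prog k) (\<lambda>s' t'. prepared G k s' \<and> rreg s' = rreg s \<and> nreg s' 7 = nreg s 7 \<and> nreg s' 27 = nreg s 27 + (k + 2) \<and>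
     is_input G k (nmem s') (nreg s' 27) es \<and> adjacency G k (nreg s' 7) (nreg s' 4) (insert (u, v) A) (nmem s') \<and>
     t' \<le> t + (20 * k + 80)) s t"
    (is "wp _ ?Q s t")
proof -
  define n H f p where nHfp: "n = ug_order G" "H = nreg s 7" "f = nreg s 4" "p = nreg s 27"
  have uv: "u < n" "v < n" "u \<noteq> v" "(v, u) \<notin> ug_edges G" "ug_perm G u v permutes {..<k}"
    using inst E(1) by (auto simp: ug_instance_def nHfp)
  have ph: "p + (k + 2) \<le> H" using H by (simp add: nHfp)
  have rs: "2 \<le> H" "H + n \<le> f" "nreg s 25 = k + 2" using p by (simp_all add: prepared_def nHfp)
  have cell: "nmem s p = u" "nmem s (p + 1) = v" "\<And>j. j < k \<Longrightarrow> nmem s (p + 2 + j) = ug_perm G u v j"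
    "is_input G k (nmem s) (p + (k + 2)) es" using inp by (simp_all add: nHfp)
  obtain N where N: "\<And>x. x < n \<Longrightarrow> is_adj (edge_map G) k (H + n) f (nmem s) (nmem s (H + x)) x (N x)"
    "\<And>x. x < n \<Longrightarrow> distinct (N x)" "\<And>x. x < n \<Longrightarrow> set (N x) = {y. (x, y) \<in> A \<or> (y, x) \<in> A}"
    using adj unfolding adjacency_def nHfp by blast
  define s1 where "s1 = s\<lparr>nreg := (nreg s)(10 := u, 9 := p + 1, 11 := v)\<rparr>"
  let ?X = "{9, 10, 11, 12, 13, 14 :: nat}"
  have n1: "nreg s1 10 = u" "nreg s1 11 = v" "nreg s1 7 = H" "nreg s1 4 = f" "nreg s1 27 = p" "nmem s1 = nmem s"
    "rreg s1 = rreg s" "same ?X s s1" by (simp_all add: s1_def nHfp same_def)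
  let ?rest = "seqs [half_edge_prog 11 10, copy_inv_prog k, Oper (NAdd 4 4 25), Oper (NAdd 27 27 25)]"
  have e1: "wp (edge_prog k) ?Q s t = wp (half_edge_prog 10 11) (wp (copy_prog k) (wp (Oper (NAdd 4 4 25)) (wp (?rest) ?Q))) s1 (t + 8)"
  proof -
    have "wp (Seq c d) Q = wp c (wp d Q)" for c d Q by (intro ext) (rule wp_Seq)
    then show ?thesis unfolding edge_prog_def using cell
      by (simp add: wp_ld s1_def nHfp add.commute[of t])
  qed
  have "wp (half_edge_prog 10 11) (wp (copy_prog k) (wp (Oper (NAdd 4 4 25)) (wp (?rest) ?Q))) s1 (t + 8)"
  proof (rule wp_mono[OF wp_half[where a = 10 and b = 11 and s = s1, unfolded n1]])
    fix s2 t2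
    let ?m2 = "(nmem s)(f := nmem s (H + u), H + u := f, f + 1 := v)"
    assume h2: "rreg s2 = rreg s \<and> same {9, 12, 13} s1 s2 \<and> nmem s2 = ?m2 \<and> t2 \<le> t + 8 + 20"
    have same2: "same ?X s s2" using n1(8) h2 same_trans[of ?X s s1 "{9, 12, 13}" s2 ?X] by simp
    have n2: "nreg s2 10 = u" "nreg s2 11 = v" "nreg s2 4 = f" "nreg s2 27 = p"
      using sameD[of "{9, 12, 13}" s1 s2] h2 n1 by simp_all
    show "wp (copy_prog k) (wp (Oper (NAdd 4 4 25)) (wp (?rest) ?Q)) s2 t2"
    proof (rule wp_mono[OF wp_copy[where s = s2, unfolded n2]])
      show "p + 2 + k \<le> f" using ph rs by simp
      fix s3 t3
      assume h3: "(rreg s3 = rreg s2 \<and> same {9, 13} s2 s3 \<and>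
        (\<forall>y<f + 2. nmem s3 y = nmem s2 y) \<and> (\<forall>j<k. nmem s3 (f + 2 + j) = nmem s2 (p + 2 + j))) \<and>
        t3 \<le> t2 + k * 9 + 1"
      have same3: "same ?X s s3" using same2 h3 same_trans[of ?X s s2 "{9, 13}" s3 ?X] by simp
      define g where "g = f + (k + 2)"
      have m3: "nmem s3 f = nmem s (H + u)" "nmem s3 (f + 1) = v" "nmem s3 (H + u) = f"
        "\<And>y. y < f \<Longrightarrow> y \<noteq> H + u \<Longrightarrow> nmem s3 y = nmem s y"
        using h3 h2 rs uv by auto
      have t3: "nmem s3 (f + 2 + j) = edge_map G u v j" if "j < k" for j
        using h3 h2 rs uv ph cell(3)[OF that] E that by (simp add: edge_map_def)
      have adj3: "is_adj (edge_map G) k (H + n) g (nmem s3) (nmem s3 (H + x)) x ((N(u := v # N u)) x)" if "x < n" for x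
        unfolding g_def by (rule is_adj_insert[where n = n and H = H and mem = "nmem s" and N = N and u = u and v = v and f = f, OF N(1)]) (use m3 t3 rs uv that in simp_all)
      define s4 where "s4 = step (NAdd 4 4 25) s3"
      have n4: "nreg s4 10 = u" "nreg s4 11 = v" "nreg s4 7 = H" "nreg s4 4 = g" "nreg s4 27 = p"
        "nmem s4 = nmem s3" "rreg s4 = rreg s" "same (insert 4 ?X) s s4"
        using sameD[of "{9, 13}" s2 s3] h3 h2 n2 sameD[OF same3, of 7] sameD[OF same3, of 25] rs same3
        by (simp_all add: s4_def nHfp g_def same_def)
      have "wp (half_edge_prog 11 10) (wp (copy_inv_prog k) (wp (Oper (NAdd 4 4 25)) (wp (Oper (NAdd 27 27 25)) (wp Skip ?Q)))) s4 (t3 + 1)"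
      proof (rule wp_mono[OF wp_half[where a = 11 and b = 10 and s = s4, unfolded n4]])
        fix s5 t5
        let ?m5 = "(nmem s3)(g := nmem s3 (H + v), H + v := g, g + 1 := u)"
        assume h5: "rreg s5 = rreg s \<and> same {9, 12, 13} s4 s5 \<and> nmem s5 = ?m5 \<and> t5 \<le> t3 + 1 + 20"
        have same5: "same (insert 4 ?X) s s5" using n4(8) h5 same_trans[of "insert 4 ?X" s s4 "{9, 12, 13}" s5 "insert 4 ?X"] by simp
        have n5: "nreg s5 4 = g" "nreg s5 27 = p" using sameD[of "{9, 12, 13}" s4 s5] h5 n4 by simp_all
        have gb: "H + n < g" "f < g" "f + 1 < g" using rs by (simp_all add: g_def)
        have m5: "nmem s5 y = nmem s3 y" if "y < g" "y \<noteq> H + v" for y using h5 that by simp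
        show "wp (copy_inv_prog k) (wp (Oper (NAdd 4 4 25)) (wp (Oper (NAdd 27 27 25)) (wp Skip ?Q))) s5 t5"
        proof (rule wp_mono[OF wp_copyinv[where \<pi> = "ug_perm G u v" and s = s5, unfolded n5]])
          show "p + 2 + k \<le> g" using ph rs gb by simp
          show "nmem s5 (p + 2 + j) = ug_perm G u v j" if "j < k" for j
            using m5[of "p + 2 + j"] m3(4)[of "p + 2 + j"] cell(3)[OF that] that ph rs gb by simp
          show "inj (ug_perm G u v)" using uv(5) by (rule permutes_inj)
          fix s6 t6
          assume h6: "(rreg s6 = rreg s5 \<and> same {9, 13, 14} s5 s6 \<and> (\<forall>y<g + 2. nmem s6 y = nmem s5 y) \<and>
            (\<forall>j<k. nmem s6 (g + 2 + ug_perm G u v j) = j)) \<and> t6 \<le> t5 + k * 11 + 1"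
          have same6: "same (insert 4 ?X) s s6" using same5 h6 same_trans[of "insert 4 ?X" s s5 "{9, 13, 14}" s6 "insert 4 ?X"] by simp
          have m6: "nmem s6 g = nmem s3 (H + v)" "nmem s6 (g + 1) = u" "nmem s6 (H + v) = g"
            "\<And>y. y < g \<Longrightarrow> y \<noteq> H + v \<Longrightarrow> nmem s6 y = nmem s3 y"
            using h6 h5 gb uv by auto
          have t6: "nmem s6 (g + 2 + j) = edge_map G v u j" if "j < k" for j
          proof -
            have "inv (ug_perm G u v) j < k" "ug_perm G u v (inv (ug_perm G u v) j) = j"
              using permutes_in_image[OF permutes_inv[OF uv(5)], of j] permutes_inverses(1)[OF uv(5)] that by simp_all
            then have "nmem s6 (g + 2 + j) = inv (ug_perm G u v) j" using h6 by metis
            then show ?thesis using uv(4) by (simp add: edge_map_def)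
          qed
          let ?N = "(N(u := v # N u))(v := u # (N(u := v # N u)) v)"
          have adj6: "is_adj (edge_map G) k (H + n) (g + (k + 2)) (nmem s6) (nmem s6 (H + x)) x (?N x)" if "x < n" for x
            by (rule is_adj_insert[where n = n and H = H and mem = "nmem s3" and N = "N(u := v # N u)" and u = v and v = u and f = g, OF adj3]) (use m6 t6 rs uv gb that in simp_all)
          have dist: "distinct (?N x) \<and> set (?N x) = {y. (x, y) \<in> insert (u, v) A \<or> (y, x) \<in> insert (u, v) A}" if "x < n" for x
            using N(2,3)[OF that] uv E by auto
          have "adjacency G k H (g + (k + 2)) (insert (u, v) A) (nmem s6)"
            unfolding adjacency_def using adj6 dist by (intro exI[of _ ?N]) (simp add: nHfp)
          moreover have "is_input G k (nmem s6) (p + (k + 2)) es"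
          proof (rule is_input_cong[OF cell(4)])
            fix y assume "y < p + (k + 2) + length es * (k + 2)"
            then have "y < H" using H by (simp add: nHfp)
            then show "nmem s6 y = nmem s y" using m6(4)[of y] m3(4)[of y] rs gb by simp
          qed
          moreover have n6: "nreg s6 i = nreg s i" if "i \<notin> insert 4 ?X" for i using same6 that by (rule sameD)
          moreover have "nreg s6 4 = g" using sameD[of "{9, 13, 14}" s5 s6 4] h6 n5 by simp
          moreover have "rreg s6 = rreg s" using h6 h5 by simp
          moreover have "t6 + 3 \<le> t + (20 * k + 80)" using h6 h5 h3 h2 by simp
          ultimately show "wp (Oper (NAdd 4 4 25)) (wp (Oper (NAdd 27 27 25)) (wp Skip ?Q)) s6 t6"
            using p gb by (simp add: wp_Oper wp_Skip prepared_def nHfp[symmetric] g_def)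
        qed
      qed simp_all
      then show "wp (Oper (NAdd 4 4 25)) (wp (?rest) ?Q) s3 t3"
        unfolding wp_Oper[of "NAdd 4 4 25"] s4_def[symmetric] seqs.simps wp_Seq .
    qed
  qed simp_all
  then show ?thesis unfolding e1 .
qed

lemma wp_edges:
  assumes inst: "ug_instance k G" and "prepared G k s" "is_input G k (nmem s) (nreg s 27) es"
    and "nreg s 27 + length es * (k + 2) = nreg s 7"
    and "adjacency G k (nreg s 7) (nreg s 4) (set ds) (nmem s)"
    and "distinct (ds @ es)" "set (ds @ es) = ug_edges G"
  shows "wp (While (NLess 27 7) (edge_prog k)) (\<lambda>s' t'. prepared G k s' \<and> rreg s' = rreg s \<and>
     adjacency G k (nreg s' 7) (nreg s' 4) (ug_edges G) (nmem s') \<and>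
     t' \<le> t + length es * (20 * k + 81) + 1) s t"
  using assms(2-)
proof (induction es arbitrary: s t ds)
  case Nil
  then show ?case by (intro wp_While_False) simp_all
next
  case (Cons a es)
  obtain u v where a: "a = (u, v)" by (cases a)
  have E: "(u, v) \<in> ug_edges G" using Cons.prems(6) by (auto simp: a)
  then have "(v, u) \<notin> ug_edges G" using inst by (auto simp: ug_instance_def)
  then have E': "(u, v) \<notin> set ds" "(v, u) \<notin> set ds" using Cons.prems(5,6) by (auto simp: a)
  show ?case (is "wp _ ?Q s t")
  proof (rule wp_While_True)
    show "holds (NLess 27 7) s" using Cons.prems(3) by simp
    show "wp (edge_prog k) (wp (While (NLess 27 7) (edge_prog k)) ?Q) s (t + 1)"
    proof (rule wp_mono[OF wp_edge[OF inst E E' Cons.prems(1) Cons.prems(2,3,4)[unfolded a]]])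
      fix s' t'
      assume h: "prepared G k s' \<and> rreg s' = rreg s \<and> nreg s' 7 = nreg s 7 \<and> nreg s' 27 = nreg s 27 + (k + 2) \<and>
        is_input G k (nmem s') (nreg s' 27) es \<and> adjacency G k (nreg s' 7) (nreg s' 4) (insert (u, v) (set ds)) (nmem s') \<and>
        t' \<le> t + 1 + (20 * k + 80)"
      have "wp (While (NLess 27 7) (edge_prog k)) (\<lambda>s'' t''. prepared G k s'' \<and> rreg s'' = rreg s' \<and>
        adjacency G k (nreg s'' 7) (nreg s'' 4) (ug_edges G) (nmem s'') \<and>
        t'' \<le> t' + length es * (20 * k + 81) + 1) s' t'"
        by (rule Cons.IH[of _ "ds @ [a]"]) (use h Cons.prems in \<open>auto simp: a\<close>)
      then show "wp (While (NLess 27 7) (edge_prog k)) ?Q s' t'"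
        by (rule wp_mono) (use h in auto)
    qed
  qed
qed

section \<open>Depth, edge weight and the whole program\<close>

text \<open>Without products, the end of the input is found by adding the edge record size once per
  edge. The heads are placed there, and the adjacency records behind them.\<close>

definition setup_prog :: "nat \<Rightarrow> prog" where
  "setup_prog k = seqs [Oper (NConst 1 1), Oper (NConst 2 k), ld 23 0 0, ld 24 0 1, Oper (NConst 22 (k + 9)),
     Oper (NConst 7 2), Oper (NConst 25 (k + 2)), Oper (NConst 26 0),
     While (NLess 26 24) (seqs [Oper (NAdd 7 7 25), Oper (NAdd 26 26 1)]),
     Oper (NAdd 4 7 23), Oper (NConst 27 2)]"

text \<open>Doubling \<alpha> until it reaches \<open>4 * k * n\<close> replaces a logarithm. At
  depth \<open>D\<close> the approximate weight costs at most \<open>k * n / 2 ^ D\<close> and the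
  truncation at most \<open>2 * k * n / 2 ^ D\<close>, so 4 leaves room.\<close>

definition depth_prog :: prog where
  "depth_prog = seqs [Oper (RNat 3 1), Oper (RNat 1 23), Oper (RNat 2 2), Oper (NConst 10 4), Oper (RNat 4 10),
     Oper (RMul 1 1 2), Oper (RMul 1 1 4), Oper (NConst 8 0),
     While (RLess 0 1) (seqs [Oper (RAdd 0 0 0), Oper (NAdd 8 8 1)])]"

definition ln_prog :: "nat \<Rightarrow> prog" where
  "ln_prog k = seqs [Oper (RDiv 4 3 2), Oper (RSub 4 3 4), Oper (RNat 5 1), Oper (RSub 6 3 3),
     Oper (NConst 11 0), Oper (NConst 10 0),
     While (NLess 10 8) (seqs [seqs (map (\<lambda>_. seqs [Oper (NAdd 11 11 1), Oper (RMul 5 5 4), Oper (RNat 7 11),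
       Oper (RDiv 7 5 7), Oper (RAdd 6 6 7)]) [0..<k]), Oper (NAdd 10 10 1)])]"

definition weight_prog :: "nat \<Rightarrow> prog" where
  "weight_prog \<Delta> = seqs [Oper (RSub 6 6 3), Oper (RSub 5 3 3), If (RLess 6 5) (Oper (RSub 6 3 3)) Skip,
     Oper (NConst 10 \<Delta>), Oper (RNat 4 10), Oper (RDiv 2 6 4), Oper (RAdd 1 3 2), Oper (RNat 7 1), Oper (NConst 3 0)]"

definition ug_prog :: "nat \<Rightarrow> nat \<Rightarrow> prog" where
  "ug_prog k \<Delta> = seqs [setup_prog k, While (NLess 27 7) (edge_prog k), depth_prog, ln_prog k, weight_prog \<Delta>,
     While (NLess 3 23) (root_prog k), Oper (RSub 0 0 0), Oper (RAdd 0 0 7)]"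

section \<open>Correctness of the setup and of the depth\<close>

lemma wp_count:
  assumes "nreg s 1 = 1" "nreg s 26 \<le> nreg s 24"
  shows "wp (While (NLess 26 24) (seqs [Oper (NAdd 7 7 25), Oper (NAdd 26 26 1)]))
     (\<lambda>s' t'. nmem s' = nmem s \<and> rreg s' = rreg s \<and> same {7, 26} s s' \<and>
       nreg s' 7 = nreg s 7 + (nreg s 24 - nreg s 26) * nreg s 25 \<and> t' \<le> t + (nreg s 24 - nreg s 26) * 4 + 1) s t"
  using assms
proof (induction "nreg s 24 - nreg s 26" arbitrary: s t)
  case 0
  then show ?case by (intro wp_While_False) (simp_all add: same_def)
next
  case (Suc d)
  let ?s = "s\<lparr>nreg := (nreg s)(7 := nreg s 7 + nreg s 25, 26 := nreg s 26 + 1)\<rparr>"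
  show ?case (is "wp (While _ ?B) ?Q s t")
  proof (rule wp_While_True)
    show "holds (NLess 26 24) s" using Suc.hyps(2) by simp
    have "wp (While (NLess 26 24) ?B)
     (\<lambda>s' t'. nmem s' = nmem ?s \<and> rreg s' = rreg ?s \<and> same {7, 26} ?s s' \<and>
       nreg s' 7 = nreg ?s 7 + (nreg ?s 24 - nreg ?s 26) * nreg ?s 25 \<and>
       t' \<le> t + 1 + 1 + 1 + 1 + (nreg ?s 24 - nreg ?s 26) * 4 + 1) ?s (t + 1 + 1 + 1 + 1)"
      by (rule Suc.hyps(1)) (use Suc.hyps(2) Suc.prems in simp_all)
    moreover have "nreg s 24 - nreg s 26 = Suc (nreg s 24 - Suc (nreg s 26))" using Suc.hyps(2) by simp
    ultimately show "wp ?B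
      (wp (While (NLess 26 24) ?B) ?Q) s (t + 1)"
      unfolding seqs.simps wp_Seq wp_Oper wp_Skip using Suc.prems
      by (auto simp: same_def elim!: wp_mono)
  qed
qed

lemma wp_setup:
  assumes inst: "ug_instance k G"
  shows "wp (setup_prog k) (\<lambda>s' t'. (prepared G k s' \<and> is_input G k (nmem s') (nreg s' 27) es \<and>
     nreg s' 27 + length es * (k + 2) = nreg s' 7 \<and> adjacency G k (nreg s' 7) (nreg s' 4) {} (nmem s') \<and>
     rreg s' 0 = \<alpha>) \<and> t' \<le> t + (length es * 4 + 30)) (init_state \<alpha> (ug_encode k G es)) t"
    (is "wp _ ?Q ?s t")
proof -
  let ?c = "concat (map (\<lambda>(u, v). u # v # map (ug_perm G u v) [0..<k]) es)"
  let ?m = "nmem ?s"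
  have m: "?m 0 = ug_order G" "?m 1 = length es" by (simp_all add: init_state_def ug_encode_def)
  have lenx: "length (ug_encode k G es) = 2 + length es * (k + 2)" by (simp add: ug_encode_def length_encode)
  have inp: "is_input G k ?m 2 es"
    by (rule is_input_concat) (simp add: init_state_def ug_encode_def)
  have zero: "?m y = 0" if "2 + length es * (k + 2) \<le> y" for y
    using that lenx by (simp add: init_state_def)
  define s1 where "s1 = ?s\<lparr>nreg := (\<lambda>_. 0)(1 := 1, 2 := k, 23 := ug_order G, 9 := 1, 24 := length es, 22 := k + 9,
     7 := 2, 25 := k + 2, 26 := 0)\<rparr>"
  have s0: "nreg ?s = (\<lambda>_. 0)" "rreg ?s 0 = \<alpha>" by (simp_all add: init_state_def)
  have eq: "wp (setup_prog k) ?Q ?s t = wp (While (NLess 26 24) (seqs [Oper (NAdd 7 7 25), Oper (NAdd 26 26 1)]))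
     (wp (Oper (NAdd 4 7 23)) (wp (Oper (NConst 27 2)) (wp Skip ?Q))) s1 (t + 1 + 1 + 4 + 4 + 1 + 1 + 1 + 1)"
  proof -
    have "wp (Seq c d) Q = wp c (wp d Q)" for c d Q by (intro ext) (rule wp_Seq)
    then show ?thesis unfolding setup_prog_def s1_def using m s0
      by (simp add: wp_Oper wp_ld)
  qed
  have n1: "nreg s1 0 = 0" "nreg s1 1 = 1" "nreg s1 2 = k" "nreg s1 7 = 2" "nreg s1 22 = k + 9" "nreg s1 23 = ug_order G"
    "nreg s1 24 = length es" "nreg s1 25 = k + 2" "nreg s1 26 = 0" "nmem s1 = ?m" "rreg s1 = rreg ?s"
    by (simp_all add: s1_def)
  show ?thesis unfolding eq
  proof (rule wp_mono[OF wp_count[where s = s1]])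
    fix s2 t2
    assume h: "nmem s2 = nmem s1 \<and> rreg s2 = rreg s1 \<and> same {7, 26} s1 s2 \<and>
       nreg s2 7 = nreg s1 7 + (nreg s1 24 - nreg s1 26) * nreg s1 25 \<and>
       t2 \<le> t + 1 + 1 + 4 + 4 + 1 + 1 + 1 + 1 + (nreg s1 24 - nreg s1 26) * 4 + 1"
    have n2: "nreg s2 i = nreg s1 i" if "i \<notin> {7, 26}" for i using h that sameD by blast
    define H where "H = 2 + length es * (k + 2)"
    have n7: "nreg s2 7 = H" "nmem s2 = ?m" using h n1 by (simp_all add: H_def)
    \<comment> \<open>Memory behind the input is 0, the end marker, so all heads already describe
      empty lists.\<close>
    have "adjacency G k H (H + ug_order G) {} ?m"
      unfolding adjacency_def by (intro exI[of _ "\<lambda>_. []"]) (simp add: zero H_def)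
    then show "wp (Oper (NAdd 4 7 23)) (wp (Oper (NConst 27 2)) (wp Skip ?Q)) s2 t2"
      unfolding wp_Oper wp_Skip using h n1 n7 inp s0 by (simp add: n2 prepared_def H_def)
  qed (use n1 in simp_all)
qed

lemma wp_depth_loop:
  assumes "d \<le> D" "\<And>d. d < D \<Longrightarrow> \<alpha> * 2 ^ d < X" "X \<le> \<alpha> * 2 ^ D"
    and "nreg s 1 = 1" "nreg s 8 = d" "rreg s 0 = \<alpha> * 2 ^ d" "rreg s 1 = X"
  shows "wp (While (RLess 0 1) (seqs [Oper (RAdd 0 0 0), Oper (NAdd 8 8 1)]))
     (\<lambda>s' t'. nmem s' = nmem s \<and> same {8} s s' \<and> (\<forall>i. i \<noteq> 0 \<longrightarrow> rreg s' i = rreg s i) \<and>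
       nreg s' 8 = D \<and> t' \<le> t + (D - d) * 4 + 1) s t"
  using assms(1,4-)
proof (induction "D - d" arbitrary: d s t)
  case 0
  then show ?case using assms(3) by (intro wp_While_False) (simp_all add: same_def)
next
  case (Suc m)
  let ?s = "s\<lparr>rreg := (rreg s)(0 := rreg s 0 + rreg s 0), nreg := (nreg s)(8 := nreg s 8 + 1)\<rparr>"
  show ?case (is "wp (While _ ?B) ?Q s t")
  proof (rule wp_While_True)
    show "holds (RLess 0 1) s" using Suc.hyps(2) Suc.prems assms(2)[of d] by simp
    have "wp (While (RLess 0 1) ?B)
     (\<lambda>s' t'. nmem s' = nmem ?s \<and> same {8} ?s s' \<and> (\<forall>i. i \<noteq> 0 \<longrightarrow> rreg s' i = rreg ?s i) \<and>
       nreg s' 8 = D \<and> t' \<le> t + 1 + 1 + 1 + 1 + (D - Suc d) * 4 + 1) ?s (t + 1 + 1 + 1 + 1)"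
      by (rule Suc.hyps(1)) (use Suc.hyps(2) Suc.prems in simp_all)
    moreover have "D - d = Suc (D - Suc d)" using Suc.hyps(2) by simp
    ultimately show "wp ?B
      (wp (While (RLess 0 1) ?B) ?Q) s (t + 1)"
      unfolding seqs.simps wp_Seq wp_Oper wp_Skip using Suc.prems
      by (auto simp: same_def elim!: wp_mono)
  qed
qed

lemma wp_depth:
  assumes p: "prepared G k s" and "rreg s 0 = \<alpha>"
    and D: "\<And>d. d < D \<Longrightarrow> \<alpha> * 2 ^ d < 4 * real k * real (ug_order G)" "4 * real k * real (ug_order G) \<le> \<alpha> * 2 ^ D"
  shows "wp depth_prog (\<lambda>s' t'. nmem s' = nmem s \<and> same {8, 10} s s' \<and> nreg s' 8 = D \<and> rreg s' 2 = real k \<and>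
     rreg s' 3 = 1 \<and> t' \<le> t + (D * 4 + 12)) s t"
    (is "wp _ ?Q s t")
proof -
  define s1 where "s1 = s\<lparr>rreg := (rreg s)(3 := 1, 2 := real k, 4 := 4, 1 := real (ug_order G) * real k * 4),
     nreg := (nreg s)(10 := 4, 8 := 0)\<rparr>"
  have n: "nreg s 1 = 1" "nreg s 2 = k" "nreg s 23 = ug_order G" using p by (simp_all add: prepared_def)
  have eq: "wp depth_prog ?Q s t = wp (While (RLess 0 1) (seqs [Oper (RAdd 0 0 0), Oper (NAdd 8 8 1)]))
     (wp Skip ?Q) s1 (t + 1 + 1 + 1 + 1 + 1 + 1 + 1 + 1)"
  proof -
    have "wp (Seq c d) Q = wp c (wp d Q)" for c d Q by (intro ext) (rule wp_Seq)
    then show ?thesis unfolding depth_prog_def s1_def using n by (simp add: wp_Oper)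
  qed
  show ?thesis unfolding eq
  proof (rule wp_mono[OF wp_depth_loop[where s = s1 and d = 0 and D = D and \<alpha> = \<alpha>, OF _ D]])
    fix s2 t2
    assume h: "nmem s2 = nmem s1 \<and> same {8} s1 s2 \<and> (\<forall>i. i \<noteq> 0 \<longrightarrow> rreg s2 i = rreg s1 i) \<and>
       nreg s2 8 = D \<and> t2 \<le> t + 1 + 1 + 1 + 1 + 1 + 1 + 1 + 1 + (D - 0) * 4 + 1"
    have "same {8, 10} s s1" by (simp add: s1_def same_def)
    then have "same {8, 10} s s2" using h same_trans[of "{8, 10}" s s1 "{8}" s2 "{8, 10}"] by simp
    then show "wp Skip ?Q s2 t2" unfolding wp_Skip using h by (simp add: s1_def)
  qed (use n assms(2) in \<open>simp_all add: s1_def\<close>)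
qed

section \<open>Approximation of the logarithm by the series of \<open>- ln (1 - x)\<close> at
  \<open>1 - 1 / k\<close>\<close>

definition ln_sum :: "nat \<Rightarrow> nat \<Rightarrow> real" where
  "ln_sum k J = (\<Sum>j<J. (1 - 1 / real k) ^ Suc j / real (Suc j))"

text \<open>The remainder \<open>g\<close> vanishes at 0 and has derivative
  \<open>x ^ J / (1 - x)\<close>, which between 0 and \<open>?q\<close> is nonnegative and at most
  \<open>k * ?q ^ J\<close>. The mean value theorem gives both bounds.\<close>

lemma ln_sum_bounds:
  assumes k: "k \<ge> 3"
  shows "ln_sum k J \<le> ln (real k)" "ln (real k) \<le> ln_sum k J + real k * (1 - 1 / real k) ^ J"
proof -
  let ?q = "1 - 1 / real k"
  define g where "g = (\<lambda>x::real. - ln (1 - x) - (\<Sum>j<J. x ^ Suc j / real (Suc j)))"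
  have q: "0 < ?q" "?q < 1" using k by simp_all
  have der: "(g has_real_derivative x ^ J / (1 - x)) (at x)" if "0 \<le> x" "x \<le> ?q" for x
  proof -
    have x: "x < 1" using that q by linarith
    have "((\<lambda>x. x ^ Suc j / real (Suc j)) has_real_derivative x ^ j) (at x)" for j
      by (auto intro!: derivative_eq_intros simp del: power_Suc)
    then have "(g has_real_derivative (1 / (1 - x) - (\<Sum>j<J. x ^ j))) (at x)"
      unfolding g_def using x by (auto intro!: derivative_eq_intros DERIV_sum simp: field_simps simp del: of_nat_Suc power_Suc)
    moreover have "(\<Sum>j<J. x ^ j) = (1 - x ^ J) / (1 - x)"
      using x by (simp add: sum_gp_strict)
    ultimately show ?thesis by (simp add: diff_divide_distrib)
  qed
  then obtain z where z: "0 < z" "z < ?q" "g ?q - g 0 = (?q - 0) * (z ^ J / (1 - z))"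
    using MVT2[OF q(1), of g "\<lambda>x. x ^ J / (1 - x)"] by blast
  have z1: "z < 1" using z(2) q(2) by linarith
  have g: "g ?q = ln (real k) - ln_sum k J" "g 0 = 0"
    using k by (simp_all add: g_def ln_sum_def ln_div)
  have zq: "0 \<le> z ^ J / (1 - z)"
    by (rule divide_nonneg_pos) (use z(1) z1 in simp_all)
  have "0 \<le> ?q * (z ^ J / (1 - z))" by (rule mult_nonneg_nonneg[OF less_imp_le[OF q(1)] zq])
  then show "ln_sum k J \<le> ln (real k)" using z(3) g by simp
  have zle: "z ^ J / (1 - z) \<le> ?q ^ J / (1 / real k)"
    by (intro frac_le power_mono) (use z k q in auto)
  have "?q * (z ^ J / (1 - z)) \<le> 1 * (?q ^ J / (1 / real k))"
    by (rule mult_mono[OF _ zle]) (use q zq in auto)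
  then show "ln (real k) \<le> ln_sum k J + real k * ?q ^ J" using z(3) g by (simp add: mult.commute)
qed

lemma wp_ln:
  assumes "nreg s 1 = 1" "nreg s 8 = D" "rreg s 2 = real k" "rreg s 3 = 1"
  shows "wp (ln_prog k) (\<lambda>s' t'. nmem s' = nmem s \<and> same {10, 11} s s' \<and> rreg s' 3 = 1 \<and>
     rreg s' 6 = ln_sum k (k * D) \<and> t' \<le> t + (D * (6 * k + 5) + 10)) s t"
    (is "wp _ ?Q s t")
proof -
  let ?q = "1 - 1 / real k"
  let ?I = "\<lambda>J s'. nmem s' = nmem s \<and> same {10, 11} s s' \<and> rreg s' 3 = 1 \<and> rreg s' 4 = ?q \<and> nreg s' 11 = J \<and>
     rreg s' 5 = ?q ^ J \<and> rreg s' 6 = ln_sum k J"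
  let ?step = "seqs [Oper (NAdd 11 11 1), Oper (RMul 5 5 4), Oper (RNat 7 11), Oper (RDiv 7 5 7), Oper (RAdd 6 6 7)]"
  let ?body = "seqs [seqs (map (\<lambda>_. ?step) [0..<k]), Oper (NAdd 10 10 1)]"
  have body: "wp ?body Q s' t' = wp (seqs (map (\<lambda>_. ?step) [0..<k])) (wp (seqs [Oper (NAdd 10 10 1)]) Q) s' t'" for Q s' t'
    by (simp only: seqs.simps(2)[of "seqs _"] wp_Seq)
  have loop: "wp (While (NLess 10 8) ?body) (\<lambda>s' t'. ?I (k * D) s' \<and> t' \<le> t1 + (D - i) * (6 * k + 5) + 1) s1 t1"
    if "i \<le> D" "?I (k * i) s1" "nreg s1 10 = i" for i s1 t1
    using that
  proof (induction "D - i" arbitrary: i s1 t1)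
    case 0
    then show ?case using assms(2) sameD[of "{10, 11}" s s1 8] by (intro wp_While_False) simp_all
  next
    case (Suc d)
    have i: "i < D" using Suc.hyps(2) by simp
    show ?case (is "wp _ ?Q1 s1 t1")
    proof (rule wp_While_True)
      show "holds (NLess 10 8) s1" using i Suc.prems assms(2) sameD[of "{10, 11}" s s1 8] by simp
      have "wp (seqs (map (\<lambda>_. ?step) [0..<k])) (\<lambda>s' t'. (?I (k * i + k) s' \<and> nreg s' 10 = i) \<and> t' \<le> t1 + 1 + k * 6 + 1) s1 (t1 + 1)"
      proof (rule wp_unrolled[where I = "\<lambda>j s'. ?I (k * i + j) s' \<and> nreg s' 10 = i"])
        fix j s2 t2 assume h: "?I (k * i + j) s2 \<and> nreg s2 10 = i"
        have "nreg s2 1 = 1" using h assms(1) sameD[of "{10, 11}" s s2 1] by simp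
        then show "wp ?step (\<lambda>s' t'. (?I (k * i + Suc j) s' \<and> nreg s' 10 = i) \<and> t' \<le> t2 + 6) s2 t2"
          using h by (simp add: wp_simps same_def ln_sum_def)
      qed (use Suc.prems in simp)
      then show "wp ?body (wp (While (NLess 10 8) ?body) ?Q1) s1 (t1 + 1)"
        unfolding body
      proof (rule wp_mono)
        fix s2 t2
        assume h: "(?I (k * i + k) s2 \<and> nreg s2 10 = i) \<and> t2 \<le> t1 + 1 + k * 6 + 1"
        let ?s3 = "s2\<lparr>nreg := (nreg s2)(10 := Suc i)\<rparr>"
        have n2: "nreg s2 1 = 1" using h assms(1) sameD[of "{10, 11}" s s2 1] by simp
        have incr: "wp (seqs [Oper (NAdd 10 10 1)]) Q s2 t2 = Q ?s3 (t2 + 1 + 1)" for Q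
          using n2 h by (simp add: wp_Seq wp_Oper wp_Skip)
        have "wp (While (NLess 10 8) ?body) (\<lambda>s' t'. ?I (k * D) s' \<and> t' \<le> t2 + 1 + 1 + (D - Suc i) * (6 * k + 5) + 1) ?s3 (t2 + 1 + 1)"
          by (rule Suc.hyps(1)) (use Suc.hyps(2) h i in \<open>simp_all add: same_def add.commute\<close>)
        then have "wp (While (NLess 10 8) ?body) ?Q1 ?s3 (t2 + 1 + 1)"
        proof (rule wp_mono)
          fix s' t'
          assume h': "?I (k * D) s' \<and> t' \<le> t2 + 1 + 1 + (D - Suc i) * (6 * k + 5) + 1"
          have "(D - i) * (6 * k + 5) = (6 * k + 5) + (D - Suc i) * (6 * k + 5)" using i by (metis Suc_diff_Suc mult_Suc)
          then show "?I (k * D) s' \<and> t' \<le> t1 + (D - i) * (6 * k + 5) + 1" using h h' by simp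
        qed
        then show "wp (seqs [Oper (NAdd 10 10 1)]) (wp (While (NLess 10 8) ?body) ?Q1) s2 t2"
          unfolding incr .
      qed
    qed
  qed
  define s1 where "s1 = s\<lparr>rreg := (rreg s)(4 := ?q, 5 := 1, 6 := 0), nreg := (nreg s)(11 := 0, 10 := 0)\<rparr>"
  have eq: "wp (ln_prog k) ?Q s t = wp (While (NLess 10 8) ?body) (wp Skip ?Q) s1 (t + 1 + 1 + 1 + 1 + 1 + 1)"
  proof -
    have "wp (Seq c d) Q = wp c (wp d Q)" for c d Q by (intro ext) (rule wp_Seq)
    then show ?thesis unfolding ln_prog_def s1_def using assms by (simp add: wp_Oper)
  qed
  have "wp (While (NLess 10 8) ?body) (\<lambda>s' t'. ?I (k * D) s' \<and> t' \<le> t + 1 + 1 + 1 + 1 + 1 + 1 + (D - 0) * (6 * k + 5) + 1)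
     s1 (t + 1 + 1 + 1 + 1 + 1 + 1)"
    by (rule loop) (use assms in \<open>simp_all add: s1_def same_def ln_sum_def\<close>)
  then show ?thesis unfolding eq by (rule wp_mono) (simp add: wp_Skip)
qed

text \<open>A short partial sum may be below 1; clipping at 0 keeps the weight at least 1.\<close>

definition lam_approx :: "nat \<Rightarrow> nat \<Rightarrow> real" where "lam_approx k D = max 0 (ln_sum k (k * D) - 1)"

lemma wp_weight:
  assumes "nreg s 1 = 1" "rreg s 3 = 1" "rreg s 6 = ln_sum k (k * D)"
  shows "wp (weight_prog \<Delta>) (\<lambda>s' t'. nmem s' = nmem s \<and> same {3, 10} s s' \<and> nreg s' 3 = 0 \<and>
     rreg s' 3 = 1 \<and> rreg s' 2 = lam_approx k D / real \<Delta> \<and> rreg s' 1 = 1 + lam_approx k D / real \<Delta> \<and> rreg s' 7 = 1 \<and> t' \<le> t + 15) s t"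
  using assms unfolding weight_prog_def
  by (auto simp: wp_simps same_def lam_approx_def max_def)


text \<open>The series converges slowly, but \<open>(1 - 1 / k) ^ k\<close> is at most
  \<open>1 / e\<close>, so every block of \<open>k\<close> terms at least halves the error
  bound.\<close>

lemma lam_approx_bounds:
  assumes k: "k \<ge> 3"
  shows "0 \<le> lam_approx k D" "lam_approx k D \<le> ln (real k) - 1" "ln (real k) - 1 \<le> lam_approx k D + real k * (1 / 2) ^ D"
proof -
  have "exp 1 \<le> real k" using exp_le k by linarith
  then have ln1: "1 \<le> ln (real k)" using k by (simp add: ln_ge_iff)
  show "0 \<le> lam_approx k D" by (simp add: lam_approx_def)
  show "lam_approx k D \<le> ln (real k) - 1" using ln1 ln_sum_bounds(1)[OF k] by (simp add: lam_approx_def)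
  have "(1 - 1 / real k) ^ k \<le> exp (- (1 / real k)) ^ k"
    using k exp_ge_add_one_self[of "- (1 / real k)"] by (intro power_mono) auto
  also have "\<dots> = exp (- 1)" using k by (simp add: exp_of_nat_mult[symmetric])
  also have "\<dots> \<le> 1 / 2"
    using exp_ge_add_one_self[of "1::real"] by (simp add: exp_minus field_simps)
  finally have "((1 - 1 / real k) ^ k) ^ D \<le> (1 / 2) ^ D" using k by (intro power_mono) auto
  then have "real k * (1 - 1 / real k) ^ (k * D) \<le> real k * (1 / 2) ^ D"
    by (simp add: power_mult mult_left_mono)
  then show "ln (real k) - 1 \<le> lam_approx k D + real k * (1 / 2) ^ D"
    using ln_sum_bounds(2)[OF k, of "k * D"] by (simp add: lam_approx_def)
qed

section \<open>Time of one root and correctness of the whole program\<close>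

context ug_run begin

lemma tree_size_bounds: "1 \<le> tree_size e" "tree_size e \<le> (1 + k * \<Delta>) ^ e"
proof -
  show 1: "1 \<le> tree_size e" for e by (cases e) simp_all
  show "tree_size e \<le> (1 + k * \<Delta>) ^ e"
  proof (induction e)
    case (Suc e)
    have "tree_size (Suc e) \<le> (1 + k * \<Delta>) * tree_size e" using 1[of e] by simp
    also have "\<dots> \<le> (1 + k * \<Delta>) * (1 + k * \<Delta>) ^ e" using Suc by (rule mult_le_mono2)
    finally show ?case by simp
  qed simp
qed

lemma root_time_le: "root_time D \<le> (1 + k * \<Delta>) ^ D * (52 * ((k * \<Delta>) * (k * \<Delta>) * (D + 1)))"
proof -
  define K where "K = k * \<Delta>"
  define X where "X = K * (D + 1)"
  have "3 * 3 \<le> k * \<Delta>" using k3 D3 by (intro mult_le_mono)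
  then have K9: "9 \<le> K" by (simp add: K_def)
  have kK: "k \<le> K" "\<Delta> \<le> K" using k3 D3 by (simp_all add: K_def)
  have KX: "K \<le> X" by (simp add: X_def)
  have "\<Delta> * (D + 1) \<le> X" unfolding X_def using kK by (intro mult_le_mono1)
  then have "4 * k + 30 * (\<Delta> * D + 1 + \<Delta>) + 81 \<le> 47 * X" using kK KX K9 by simp
  then have "K * (4 * k + 30 * (\<Delta> * D + 1 + \<Delta>) + 81) \<le> K * (47 * X)" by (rule mult_le_mono2)
  moreover have "k * (\<Delta> * (4 * k + 30 * (\<Delta> * D + 1 + \<Delta>) + 81) + 12) =
      K * (4 * k + 30 * (\<Delta> * D + 1 + \<Delta>) + 81) + 12 * k"
    by (simp only: K_def distrib_left mult.assoc mult.commute[of k 12])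
  moreover have "9 * X \<le> K * X" using K9 by (rule mult_le_mono1)
  moreover have "K * (47 * X) = 47 * (K * X)" by simp
  ultimately have "k * (\<Delta> * (4 * k + 30 * (\<Delta> * D + 1 + \<Delta>) + 81) + 12) + 31 + 6 * k + 31 \<le> 50 * (K * X)"
    using kK KX K9 by linarith
  then have "tree_size D * (k * (\<Delta> * (4 * k + 30 * (\<Delta> * D + 1 + \<Delta>) + 81) + 12) + 31 + 6 * k + 31) \<le> tree_size D * (50 * (K * X))"
    by (rule mult_le_mono2)
  moreover have "4 * k + 60 \<le> 2 * (K * X)"
    using kK KX K9 \<open>9 * X \<le> K * X\<close> by linarith
  moreover have "2 * (K * X) \<le> tree_size D * (2 * (K * X))" using tree_size_bounds(1)[of D] by simp
  ultimately have "root_time D \<le> tree_size D * (50 * (K * X)) + tree_size D * (2 * (K * X))" unfolding root_time_def by linarith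
  also have "\<dots> = tree_size D * (52 * (K * X))" by (simp flip: distrib_left)
  also have "\<dots> \<le> (1 + K) ^ D * (52 * (K * X))" using tree_size_bounds(2)[of D] unfolding K_def by (rule mult_le_mono1)
  finally show ?thesis by (simp only: K_def X_def mult.assoc)
qed

end

definition total_time :: "nat \<Rightarrow> nat \<Rightarrow> nat \<Rightarrow> nat \<Rightarrow> nat \<Rightarrow> nat" where
  "total_time k \<Delta> n m D = (m * 4 + 30) + (m * (20 * k + 81) + 1) + (D * 4 + 12) + (D * (6 * k + 5) + 10) + 15 +
     (n * ((1 + k * \<Delta>) ^ D * (52 * ((k * \<Delta>) * (k * \<Delta>) * (D + 1))) + 1) + 1) + 3"

lemma wp_ug_prog:
  assumes k: "k \<ge> 3" and \<Delta>: "\<Delta> \<ge> 3" and inst: "ug_instance k G" and deg: "\<forall>u<ug_order G. ug_degree G u \<le> \<Delta>"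
    and es: "edge_enumeration G es"
    and D: "\<And>d. d < D \<Longrightarrow> \<alpha> * 2 ^ d < 4 * real k * real (ug_order G)" "4 * real k * real (ug_order G) \<le> \<alpha> * 2 ^ D"
  shows "wp (ug_prog k \<Delta>) (\<lambda>s' t'. (\<exists>N. ug_graph k \<Delta> G N (lam_approx k D) \<and>
     rreg s' 0 = ug_graph.approx k \<Delta> G N (lam_approx k D) D) \<and> t' \<le> total_time k \<Delta> (ug_order G) (length es) D)
     (init_state \<alpha> (ug_encode k G es)) 0"
    (is "wp _ ?Q ?s 0")
  unfolding ug_prog_def seqs.simps wp_Seq
proof (rule wp_mono[OF wp_setup[OF inst, of es]])
  fix s1 t1
  assume h1: "(prepared G k s1 \<and> is_input G k (nmem s1) (nreg s1 27) es \<and>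
     nreg s1 27 + length es * (k + 2) = nreg s1 7 \<and> adjacency G k (nreg s1 7) (nreg s1 4) {} (nmem s1) \<and>
     rreg s1 0 = \<alpha>) \<and> t1 \<le> 0 + (length es * 4 + 30)"
  show "wp (While (NLess 27 7) (edge_prog k)) (wp depth_prog (wp (ln_prog k) (wp (weight_prog \<Delta>)
      (wp (While (NLess 3 23) (root_prog k)) (wp (Oper (RSub 0 0 0)) (wp (Oper (RAdd 0 0 7)) (wp Skip ?Q))))))) s1 t1"
  proof (rule wp_mono[OF wp_edges[OF inst, where ds = "[]" and es = es]])
    fix s2 t2
    assume h2: "prepared G k s2 \<and> rreg s2 = rreg s1 \<and> adjacency G k (nreg s2 7) (nreg s2 4) (ug_edges G) (nmem s2) \<and>
      t2 \<le> t1 + length es * (20 * k + 81) + 1"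
    have p2: "prepared G k s2" and r2: "rreg s2 0 = \<alpha>" using h1 h2 by simp_all
    obtain N where N: "\<forall>x<ug_order G. is_adj (edge_map G) k (nreg s2 7 + ug_order G) (nreg s2 4) (nmem s2) (nmem s2 (nreg s2 7 + x)) x (N x) \<and>
     distinct (N x) \<and> set (N x) = {y. (x, y) \<in> ug_edges G \<or> (y, x) \<in> ug_edges G}"
      using h2 unfolding adjacency_def by blast
    \<comment> \<open>From here on the input, the heads and the adjacency records stay fixed; the
      node area begins at the first free address.\<close>
    interpret ug_run k \<Delta> G N "lam_approx k D" "nreg s2 4" "nreg s2 7" "nreg s2 7 + ug_order G" "nmem s2"
      by unfold_locales (use k \<Delta> inst deg N lam_approx_bounds[OF k] p2 in \<open>simp_all add: prepared_def\<close>)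
    have graph: "ug_graph k \<Delta> G N (lam_approx k D)" by (rule ug_graph_axioms)
    have n2: "nreg s2 0 = 0" "nreg s2 1 = 1" "nreg s2 2 = k" "nreg s2 22 = k + 9" "nreg s2 23 = ug_order G"
      using p2 by (simp_all add: prepared_def)
    show "wp depth_prog (wp (ln_prog k) (wp (weight_prog \<Delta>)
      (wp (While (NLess 3 23) (root_prog k)) (wp (Oper (RSub 0 0 0)) (wp (Oper (RAdd 0 0 7)) (wp Skip ?Q)))))) s2 t2"
    proof (rule wp_mono[OF wp_depth[OF p2 r2 D]])
      fix s3 t3
      assume h3: "nmem s3 = nmem s2 \<and> same {8, 10} s2 s3 \<and> nreg s3 8 = D \<and> rreg s3 2 = real k \<and>
        rreg s3 3 = 1 \<and> t3 \<le> t2 + (D * 4 + 12)"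
      have n3: "nreg s3 i = nreg s2 i" if "i \<notin> {8, 10}" for i using h3 that sameD by blast
      show "wp (ln_prog k) (wp (weight_prog \<Delta>)
      (wp (While (NLess 3 23) (root_prog k)) (wp (Oper (RSub 0 0 0)) (wp (Oper (RAdd 0 0 7)) (wp Skip ?Q))))) s3 t3"
      proof (rule wp_mono[OF wp_ln[where s = s3 and D = D]])
        fix s4 t4
        assume h4: "nmem s4 = nmem s3 \<and> same {10, 11} s3 s4 \<and> rreg s4 3 = 1 \<and>
          rreg s4 6 = ln_sum k (k * D) \<and> t4 \<le> t3 + (D * (6 * k + 5) + 10)"
        have n4: "nreg s4 i = nreg s3 i" if "i \<notin> {10, 11}" for i using h4 that sameD by blast
        show "wp (weight_prog \<Delta>)
      (wp (While (NLess 3 23) (root_prog k)) (wp (Oper (RSub 0 0 0)) (wp (Oper (RAdd 0 0 7)) (wp Skip ?Q)))) s4 t4"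
        proof (rule wp_mono[OF wp_weight[where s = s4 and k = k and D = D]])
          fix s5 t5
          assume h5: "nmem s5 = nmem s4 \<and> same {3, 10} s4 s5 \<and> nreg s5 3 = 0 \<and>
             rreg s5 3 = 1 \<and> rreg s5 2 = lam_approx k D / real \<Delta> \<and> rreg s5 1 = 1 + lam_approx k D / real \<Delta> \<and> rreg s5 7 = 1 \<and> t5 \<le> t4 + 15"
          have n5: "nreg s5 i = nreg s4 i" if "i \<notin> {3, 10}" for i using h5 that sameD by blast
          have "env s5" unfolding env_def using h5 h4 h3 n2 by (simp add: n5 n4 n3 w_def)
          then have "wp (While (NLess 3 23) (root_prog k)) (\<lambda>s' t'. rreg s' 7 = approx D \<and>
             t' \<le> t5 + (ug_order G - 0) * (root_time D + 1) + 1) s5 t5"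
            by (rule wp_roots) (use h5 h3 n2 in \<open>simp_all add: n5 n4 n3\<close>)
          then show "wp (While (NLess 3 23) (root_prog k)) (wp (Oper (RSub 0 0 0)) (wp (Oper (RAdd 0 0 7)) (wp Skip ?Q))) s5 t5"
          proof (rule wp_mono)
            fix s6 :: state and t6 :: nat
            assume h6: "rreg s6 7 = approx D \<and> t6 \<le> t5 + (ug_order G - 0) * (root_time D + 1) + 1"
            have "root_time D \<le> (1 + k * \<Delta>) ^ D * (52 * ((k * \<Delta>) * (k * \<Delta>) * (D + 1)))"
              by (rule root_time_le)
            then have "ug_order G * (root_time D + 1) \<le>
                ug_order G * ((1 + k * \<Delta>) ^ D * (52 * ((k * \<Delta>) * (k * \<Delta>) * (D + 1))) + 1)"
              by (intro mult_le_mono2) simp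
            moreover have "t1 \<le> length es * 4 + 30" "t2 \<le> t1 + length es * (20 * k + 81) + 1" "t3 \<le> t2 + (D * 4 + 12)"
              "t4 \<le> t3 + (D * (6 * k + 5) + 10)" "t5 \<le> t4 + 15" "t6 \<le> t5 + ug_order G * (root_time D + 1) + 1"
              using h1 h2 h3 h4 h5 h6 by simp_all
            ultimately have "t6 + 3 \<le> total_time k \<Delta> (ug_order G) (length es) D"
              unfolding total_time_def by linarith
            then show "wp (Oper (RSub 0 0 0)) (wp (Oper (RAdd 0 0 7)) (wp Skip ?Q)) s6 t6"
              unfolding wp_Oper wp_Skip using graph h6 by auto
          qed
        qed (use n2 h4 in \<open>simp_all add: n4 n3\<close>)
      qed (use n2 h3 in \<open>simp_all add: n3\<close>)
    qed
  qed (use h1 es in \<open>simp_all add: edge_enumeration_def\<close>)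
qed

section \<open>Running time and accuracy\<close>

text \<open>As \<open>K = k * \<Delta>\<close> is at least 9, powers of \<open>K\<close> absorb
  everything: \<open>2 * D\<close> in the exponent comes from \<open>(1 + K) ^ D\<close>,
  \<open>D\<close> from \<open>D + 1\<close>, two units from polynomial factors and two from the
  constant 81.\<close>

lemma total_time_le:
  assumes k: "k \<ge> 3" and \<Delta>: "\<Delta> \<ge> 3" and n: "n \<ge> 1" and m: "m \<le> n * \<Delta>"
  shows "total_time k \<Delta> n m D \<le> n * (k * \<Delta>) ^ (3 * D + 4)"
proof -
  define K where "K = k * \<Delta>"
  define X where "X = K * (D + 1)"
  define Z where "Z = (1 + K) ^ D"
  have "3 * 3 \<le> k * \<Delta>" using k \<Delta> by (intro mult_le_mono)
  then have K9: "9 \<le> K" by (simp add: K_def)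
  have kK: "k \<le> K" "3 * \<Delta> \<le> K" using k \<Delta> by (simp_all add: K_def)
  have KX: "K \<le> X" "K * D \<le> X" by (simp_all add: X_def)
  have Z1: "1 \<le> Z" by (simp add: Z_def)
  have "m * (20 * k + 85) \<le> n * \<Delta> * (20 * k + 85)" using m by (rule mult_le_mono1)
  also have "\<dots> = n * (20 * K + 85 * \<Delta>)" by (simp add: K_def distrib_left mult_ac)
  also have "\<dots> \<le> n * (49 * X)" using kK KX by (intro mult_le_mono2) linarith
  finally have 1: "m * (20 * k + 85) \<le> n * (49 * X)" .
  have "D * (6 * k + 9) \<le> D * (7 * K)" using kK K9 by (intro mult_le_mono2) linarith
  also have "\<dots> \<le> 7 * X" using KX(2) by (simp add: mult.commute[of D])
  also have "\<dots> \<le> n * (7 * X)" using n by simp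
  finally have 2: "D * (6 * k + 9) \<le> n * (7 * X)" .
  have "72 \<le> 8 * X" using K9 KX by linarith
  also have "\<dots> \<le> n * (8 * X)" using n by simp
  finally have 3: "72 \<le> n * (8 * X)" .
  have "1 \<le> X" using K9 KX by linarith
  then have 4: "n \<le> n * X" by simp
  have "total_time k \<Delta> n m D = m * (20 * k + 85) + D * (6 * k + 9) + 72 + n + n * (Z * (52 * (K * X)))"
    by (simp add: total_time_def K_def X_def Z_def algebra_simps)
  also have "\<dots> \<le> n * (49 * X) + n * (7 * X) + n * (8 * X) + n * X + n * (Z * (52 * (K * X)))"
    using 1 2 3 4 by linarith
  also have "\<dots> = n * (65 * X + Z * (52 * (K * X)))" by (simp add: algebra_simps)
  also have "\<dots> \<le> n * (K * K * (K * X) * Z)"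
  proof (rule mult_le_mono2)
    have a: "9 * X \<le> K * X" using K9 by (rule mult_le_mono1)
    have b: "K * X \<le> Z * (K * X)" using Z1 by simp
    have "9 * 9 \<le> K * K" using K9 by (intro mult_le_mono)
    then have "81 * (Z * (K * X)) \<le> K * K * (Z * (K * X))" by (intro mult_le_mono1) simp
    moreover have "K * K * (Z * (K * X)) = K * K * (K * X) * Z" by (simp only: mult_ac)
    moreover have "Z * (52 * (K * X)) = 52 * (Z * (K * X))" by simp
    then have "65 * X + Z * (52 * (K * X)) \<le> 81 * (Z * (K * X))" using a b by linarith
    ultimately show "65 * X + Z * (52 * (K * X)) \<le> K * K * (K * X) * Z" by linarith
  qed
  also have "\<dots> \<le> n * (K * K * (K * (K * K ^ D)) * (K * K) ^ D)"
  proof -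
    have "D + 1 \<le> 2 ^ D" by (induction D) simp_all
    also have "(2 :: nat) ^ D \<le> K ^ D" using K9 by (intro power_mono) auto
    finally have "X \<le> K * K ^ D" unfolding X_def by (rule mult_le_mono2)
    moreover have "1 + K \<le> K * K" using mult_le_mono1[OF K9, of K] K9 by linarith
    then have "Z \<le> (K * K) ^ D" unfolding Z_def by (intro power_mono) auto
    ultimately show ?thesis by (intro mult_le_mono order_refl)
  qed
  also have "\<dots> = n * K ^ (3 * D + 4)"
    by (simp add: power_add power_mult power_mult_distrib eval_nat_numeral mult_ac)
  finally show ?thesis by (simp add: K_def)
qed

text \<open>Since \<open>ln 2\<close> is at least 1/2, \<open>D\<close> is at most
  \<open>2 * ln B\<close>, and \<open>1 \<le> ln B\<close> turns \<open>3 * D + 4\<close> into at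
  most \<open>10 * ln B\<close>. The 20 arises because \<open>k * \<Delta>\<close> is at most the
  square of \<open>\<Delta> * sqrt k\<close>.\<close>

lemma time_exponent:
  fixes B :: real
  assumes k: "k \<ge> 3" and \<Delta>: "\<Delta> \<ge> 3" and D: "2 ^ D \<le> B" and B: "exp 1 \<le> B"
  shows "(real k * real \<Delta>) ^ (3 * D + 4) \<le> exp (20 * ln B * ln (real \<Delta> * sqrt (real k)))"
proof -
  have B0: "0 < B" using B by (meson exp_gt_zero order_less_le_trans)
  have lnB: "1 \<le> ln B" using B B0 by (simp add: ln_ge_iff)
  have "real D * ln 2 = ln (2 ^ D)" by (simp add: ln_realpow)
  also have "\<dots> \<le> ln B" using D B0 by (simp add: ln_le_cancel_iff)
  finally have "real D * ln 2 \<le> ln B" .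
  moreover have "1 / 2 \<le> ln (2 :: real)" using ln_le_minus_one[of "1 / 2"] by (simp add: ln_div)
  then have "real D * (1 / 2) \<le> real D * ln 2" by (intro mult_left_mono) auto
  ultimately have e: "real (3 * D + 4) \<le> 10 * ln B" using lnB by simp
  have k0: "0 < real k" "0 < real \<Delta>" using k \<Delta> by simp_all
  have l: "ln (real \<Delta> * sqrt (real k)) = ln (real \<Delta>) + ln (real k) / 2"
    using k0 by (simp add: ln_mult ln_sqrt)
  have nn: "0 \<le> ln (real \<Delta>)" "0 \<le> ln (real k)" using k \<Delta> by simp_all
  have "(real k * real \<Delta>) ^ (3 * D + 4) = exp (real (3 * D + 4) * ln (real k * real \<Delta>))"
    unfolding exp_of_nat_mult using k0 by simp
  also have "\<dots> \<le> exp (10 * ln B * (2 * ln (real \<Delta> * sqrt (real k))))"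
  proof -
    have "ln (real k * real \<Delta>) \<le> 2 * ln (real \<Delta> * sqrt (real k))"
      unfolding l using k0 nn by (simp add: ln_mult)
    moreover have "0 \<le> ln (real k * real \<Delta>)" using k0 nn by (simp add: ln_mult)
    ultimately show ?thesis using e lnB unfolding exp_le_cancel_iff by (intro mult_mono) auto
  qed
  finally show ?thesis by (simp add: mult.assoc)
qed

text \<open>Composes two errors: \<open>a\<close> for the weight, one-sided because the weight used
  does not exceed the prescribed one, and \<open>b\<close> for the truncation, two-sided.\<close>

lemma ratio_bounds:
  fixes Z Zh \<xi> :: real
  assumes "0 < \<xi>" "Zh \<le> Z" "Z \<le> exp a * Zh" "Zh \<le> exp b * \<xi>" "\<xi> \<le> exp b * Zh" "a + b \<le> \<alpha>" "0 \<le> a"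
  shows "exp (- \<alpha>) \<le> Z / \<xi> \<and> Z / \<xi> \<le> exp \<alpha>"
proof
  have "Z \<le> exp a * (exp b * \<xi>)" by (rule order_trans[OF assms(3) mult_left_mono[OF assms(4)]]) simp
  also have "\<dots> = exp (a + b) * \<xi>" by (simp add: exp_add)
  also have "\<dots> \<le> exp \<alpha> * \<xi>" using assms(1,6) by (intro mult_right_mono) auto
  finally show "Z / \<xi> \<le> exp \<alpha>" using assms(1) by (simp add: pos_divide_le_eq)
  have "\<xi> \<le> exp b * Z" by (rule order_trans[OF assms(5) mult_left_mono[OF assms(2)]]) simp
  then have "exp (- b) * \<xi> \<le> exp (- b) * (exp b * Z)" by (intro mult_left_mono) auto
  also have "exp (- b) * (exp b * Z) = Z" by (simp add: mult.assoc[symmetric] exp_add[symmetric])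
  finally have "exp (- b) * \<xi> \<le> Z" .
  moreover have "exp (- \<alpha>) * \<xi> \<le> exp (- b) * \<xi>" using assms(1,6,7) by (intro mult_right_mono) auto
  ultimately have "exp (- \<alpha>) * \<xi> \<le> Z" by linarith
  then show "exp (- \<alpha>) \<le> Z / \<xi>" using assms(1) by (simp add: pos_le_divide_eq)
qed

lemma depth_exists:
  fixes \<alpha> X :: real
  assumes "0 < \<alpha>"
  obtains D where "\<And>d. d < D \<Longrightarrow> \<alpha> * 2 ^ d < X" "X \<le> \<alpha> * 2 ^ D"
proof -
  obtain D0 where "X / \<alpha> < 2 ^ D0" using real_arch_pow[of 2 "X / \<alpha>"] by auto
  then have "X \<le> \<alpha> * 2 ^ D0" using assms by (simp add: field_simps)
  then have "X \<le> \<alpha> * 2 ^ (LEAST D. X \<le> \<alpha> * 2 ^ D)" by (rule LeastI)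
  moreover have "\<alpha> * 2 ^ d < X" if "d < (LEAST D. X \<le> \<alpha> * 2 ^ D)" for d
    using not_less_Least[OF that] by simp
  ultimately show ?thesis using that by blast
qed

theorem theorem2p3:
  fixes f\<^sub>1 :: "nat \<Rightarrow> real"
  assumes "f\<^sub>1 \<in> O(\<lambda>k. (ln (real k))\<^sup>2)"
  shows "\<exists>f\<^sub>2 f\<^sub>3 :: nat \<Rightarrow> real.
    f\<^sub>2 \<in> O(\<lambda>k. (ln (real k))\<^sup>2) \<and> f\<^sub>3 \<in> O(\<lambda>k. (ln (real k))\<^sup>2) \<and>
    (\<forall>k \<Delta> :: nat. k \<ge> 3 \<longrightarrow> \<Delta> \<ge> 3 \<longrightarrow>
      (let w = 1 + (ln (real k) - 1) / real \<Delta> in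
       \<exists>P :: prog. \<forall>(\<alpha> :: real) (n :: nat) (G :: ug) es.
         ug_instance k G \<longrightarrow> ug_order G = n \<longrightarrow> (\<forall>u < n. ug_degree G u \<le> \<Delta>) \<longrightarrow>
         edge_enumeration G es \<longrightarrow>
         0 < \<alpha> \<longrightarrow> \<alpha> < 2 * real n / (exp 1 * real \<Delta>) * exp (f\<^sub>1 k) \<longrightarrow>
         (\<exists>\<xi> :: real.
            computes_within P \<alpha> (ug_encode k G es) \<xi>
              (real n * exp (exp (f\<^sub>2 k) * ln (real n * real \<Delta> / \<alpha> * exp (f\<^sub>3 k))
                 * ln (real \<Delta> * sqrt (real k)))) \<and>
            exp (- \<alpha>) \<le> ug_partition k G w / \<xi> \<and>
            ug_partition k G w / \<xi> \<le> exp \<alpha>)))"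
proof -
  \<comment> \<open>The constant 20 of \<open>time_exponent\<close>.\<close>
  define f\<^sub>2 :: "nat \<Rightarrow> real" where "f\<^sub>2 = (\<lambda>_. ln 20)"
  \<comment> \<open>The absolute value absorbs \<open>exp (f\<^sub>1 k)\<close> from the range of
    \<alpha>; the second term contributes the \<open>k ^ 2\<close> needed against the numerical
    constants and the \<open>k\<close> in the depth.\<close>
  define f\<^sub>3 where "f\<^sub>3 = (\<lambda>k. \<bar>f\<^sub>1 k\<bar> + 2 * ln (real k))"
  have ln1: "1 \<le> ln (real k)" if "3 \<le> k" for k :: nat
  proof -
    have "exp 1 \<le> real k" using exp_le that by linarith
    then show ?thesis using that by (simp add: ln_ge_iff)
  qed
  have ev: "\<forall>\<^sub>F k in sequentially. 1 \<le> ln (real k)"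
    using eventually_ge_at_top[of 3] by eventually_elim (rule ln1)
  have O2: "f\<^sub>2 \<in> O(\<lambda>k. (ln (real k))\<^sup>2)" unfolding f\<^sub>2_def
  proof (rule bigoI[where c = "ln 20"])
    show "\<forall>\<^sub>F k in sequentially. norm (ln 20 :: real) \<le> ln 20 * norm ((ln (real k))\<^sup>2)"
      using ev by eventually_elim (simp add: one_le_power)
  qed
  have "(\<lambda>k. ln (real k)) \<in> O(\<lambda>k. (ln (real k))\<^sup>2)"
  proof (rule bigoI[where c = 1])
    show "\<forall>\<^sub>F k in sequentially. norm (ln (real k)) \<le> 1 * norm ((ln (real k))\<^sup>2)"
      using ev by eventually_elim (simp add: power2_eq_square)
  qed
  then have O3: "f\<^sub>3 \<in> O(\<lambda>k. (ln (real k))\<^sup>2)" unfolding f\<^sub>3_def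
    using assms by (intro sum_in_bigo) simp_all
  have main: "\<exists>\<xi>. computes_within (ug_prog k \<Delta>) \<alpha> (ug_encode k G es) \<xi>
              (real n * exp (exp (f\<^sub>2 k) * ln (real n * real \<Delta> / \<alpha> * exp (f\<^sub>3 k)) * ln (real \<Delta> * sqrt (real k)))) \<and>
            exp (- \<alpha>) \<le> ug_partition k G (1 + (ln (real k) - 1) / real \<Delta>) / \<xi> \<and>
            ug_partition k G (1 + (ln (real k) - 1) / real \<Delta>) / \<xi> \<le> exp \<alpha>"
    if k: "k \<ge> 3" and \<Delta>: "\<Delta> \<ge> 3" and inst: "ug_instance k G" and order: "ug_order G = n"
      and deg: "\<forall>u<n. ug_degree G u \<le> \<Delta>" and es: "edge_enumeration G es"
      and \<alpha>: "0 < \<alpha>" "\<alpha> < 2 * real n / (exp 1 * real \<Delta>) * exp (f\<^sub>1 k)"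
    for k \<Delta> n :: nat and \<alpha> :: real and G es
  proof -
    \<comment> \<open>For \<open>n = 0\<close> the two bounds on \<alpha> contradict each
      other.\<close>
    have n: "n \<ge> 1" using \<alpha> by (cases n) auto
    obtain D where D: "\<And>d. d < D \<Longrightarrow> \<alpha> * 2 ^ d < 4 * real k * real n" "4 * real k * real n \<le> \<alpha> * 2 ^ D"
      using depth_exists[OF \<alpha>(1)] by blast
    have "wp (ug_prog k \<Delta>) (\<lambda>s' t'. (\<exists>N. ug_graph k \<Delta> G N (lam_approx k D) \<and>
       rreg s' 0 = ug_graph.approx k \<Delta> G N (lam_approx k D) D) \<and> t' \<le> total_time k \<Delta> n (length es) D)
       (init_state \<alpha> (ug_encode k G es)) 0"
      using wp_ug_prog[OF k \<Delta> inst _ es] deg D unfolding order by blast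
    then obtain t s N where run: "exec (ug_prog k \<Delta>) (init_state \<alpha> (ug_encode k G es)) t s"
      and t: "t \<le> total_time k \<Delta> n (length es) D"
      and N: "ug_graph k \<Delta> G N (lam_approx k D)" "rreg s 0 = ug_graph.approx k \<Delta> G N (lam_approx k D) D"
      unfolding wp_def by auto
    interpret ug_graph k \<Delta> G N "lam_approx k D" by (rule N(1))
    define w' where "w' = 1 + (ln (real k) - 1) / real \<Delta>"
    note lb = lam_approx_bounds[OF k, of D]
    \<comment> \<open>The first bound rests on the upper bound for \<alpha>, the second on the
      minimality of \<open>D\<close>.\<close>
    have B: "exp 1 \<le> real n * real \<Delta> / \<alpha> * exp (f\<^sub>3 k)" "2 ^ D \<le> real n * real \<Delta> / \<alpha> * exp (f\<^sub>3 k)"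
    proof -
      have ef: "exp (f\<^sub>3 k) = exp \<bar>f\<^sub>1 k\<bar> * (real k)\<^sup>2"
        using k by (simp add: f\<^sub>3_def exp_add exp_double flip: powr_numeral)
      have "\<alpha> * exp 1 * real \<Delta> < 2 * real n * exp (f\<^sub>1 k)" using \<alpha>(2) \<Delta> by (simp add: field_simps)
      also have "\<dots> \<le> 2 * real n * exp \<bar>f\<^sub>1 k\<bar>" by (intro mult_left_mono) auto
      finally have a: "\<alpha> * exp 1 * real \<Delta> \<le> 2 * (real n * exp \<bar>f\<^sub>1 k\<bar>)" by simp
      have k9: "9 \<le> (real k)\<^sup>2" using power_mono[of 3 "real k" 2] k by simp
      have "\<alpha> * exp 1 \<le> \<alpha> * exp 1 * real \<Delta>" using \<alpha>(1) \<Delta> by simp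
      also have "\<dots> \<le> 2 * (real n * exp \<bar>f\<^sub>1 k\<bar>)" by (rule a)
      also have "\<dots> \<le> (real \<Delta> * (real k)\<^sup>2) * (real n * exp \<bar>f\<^sub>1 k\<bar>)"
        using \<Delta> k9 mult_mono[of 1 "real \<Delta>" 9 "(real k)\<^sup>2"] by (intro mult_right_mono) auto
      finally show 1: "exp 1 \<le> real n * real \<Delta> / \<alpha> * exp (f\<^sub>3 k)"
        unfolding ef using \<alpha>(1) by (simp add: field_simps)
      show "2 ^ D \<le> real n * real \<Delta> / \<alpha> * exp (f\<^sub>3 k)"
      proof (cases D)
        case 0
        have "(1 :: real) \<le> exp 1" by simp
        then have "1 \<le> real n * real \<Delta> / \<alpha> * exp (f\<^sub>3 k)" using 1 by (rule order_trans)
        then show ?thesis by (simp only: 0 power_0)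
      next
        case (Suc d)
        \<comment> \<open>One doubling less misses the target \<open>4 * k * n\<close>;
          \<open>\<Delta> * k ^ 2\<close> then dominates \<open>8 * k\<close>, as both
          \<open>\<Delta>\<close> and \<open>k\<close> are at least 3.\<close>
        have "\<alpha> * 2 ^ D < 8 * real k * real n" using D(1)[of d] Suc by simp
        also have "\<dots> \<le> (real \<Delta> * (real k)\<^sup>2) * exp \<bar>f\<^sub>1 k\<bar> * real n"
        proof -
          have "8 * real k \<le> 3 * (3 * real k)" by simp
          also have "\<dots> \<le> real \<Delta> * (real k * real k)"
            using \<Delta> k by (intro mult_mono) auto
          also have "\<dots> \<le> (real \<Delta> * (real k)\<^sup>2) * exp \<bar>f\<^sub>1 k\<bar>"
            using mult_left_mono[of 1 "exp \<bar>f\<^sub>1 k\<bar>" "real \<Delta> * (real k)\<^sup>2"]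
            by (simp add: power2_eq_square)
          finally show ?thesis by (intro mult_right_mono) auto
        qed
        finally show ?thesis unfolding ef using \<alpha>(1) by (simp add: field_simps)
      qed
    qed
    have time: "real t \<le> real n * exp (exp (f\<^sub>2 k) * ln (real n * real \<Delta> / \<alpha> * exp (f\<^sub>3 k)) * ln (real \<Delta> * sqrt (real k)))"
    proof -
      have "length es \<le> n * \<Delta>"
        using es card_edges order by (metis edge_enumeration_def distinct_card)
      then have "t \<le> n * (k * \<Delta>) ^ (3 * D + 4)"
        using t total_time_le[OF k \<Delta> n] le_trans by blast
      then have "real t \<le> real n * (real k * real \<Delta>) ^ (3 * D + 4)"
        by (metis of_nat_le_iff of_nat_mult of_nat_power)
      also have "\<dots> \<le> real n * exp (20 * ln (real n * real \<Delta> / \<alpha> * exp (f\<^sub>3 k)) * ln (real \<Delta> * sqrt (real k)))"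
        using time_exponent[OF k \<Delta> B(2,1)] by (rule mult_left_mono) simp
      finally show ?thesis by (simp add: f\<^sub>2_def)
    qed
    have ww: "1 \<le> w" "w \<le> w'" using w_ge1 lb(2) \<Delta> by (simp_all add: w_def w'_def divide_right_mono)
    have ratio: "exp (- \<alpha>) \<le> ug_partition k G w' / rreg s 0 \<and> ug_partition k G w' / rreg s 0 \<le> exp \<alpha>"
    proof (rule ratio_bounds[OF _ partition_mono(2,3)[OF ww]])
      show "0 < rreg s 0" unfolding N(2) by (rule approx_close(3))
      show "ug_partition k G w \<le> exp (real (ug_order G) * (lam_approx k D * 2 * (1 / 2) ^ D)) * rreg s 0"
        unfolding N(2) by (rule approx_close(1))
      show "rreg s 0 \<le> exp (real (ug_order G) * (lam_approx k D * 2 * (1 / 2) ^ D)) * ug_partition k G w"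
        unfolding N(2) by (rule approx_close(2))
      show "0 \<le> real (ug_order G) * real \<Delta> * (w' - w)" using ww by simp
      have "real \<Delta> * (w' - w) = ln (real k) - 1 - lam_approx k D"
        using \<Delta> by (simp add: w_def w'_def field_simps)
      also have "\<dots> \<le> real k * (1 / 2) ^ D" using lb(3) by simp
      finally have 1: "real \<Delta> * (w' - w) \<le> real k * (1 / 2) ^ D" .
      have "lam_approx k D \<le> real k" using lb(2) ln_le_minus_one[of "real k"] k by simp
      then have "lam_approx k D * 2 * (1 / 2) ^ D \<le> real k * 2 * (1 / 2) ^ D" by (intro mult_right_mono) auto
      moreover have "0 \<le> real k * (1 / 2) ^ D" by simp
      ultimately have "real \<Delta> * (w' - w) + lam_approx k D * 2 * (1 / 2) ^ D \<le> 4 * real k * (1 / 2) ^ D"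
        using 1 by linarith
      then have "real n * (real \<Delta> * (w' - w) + lam_approx k D * 2 * (1 / 2) ^ D) \<le> real n * (4 * real k * (1 / 2) ^ D)"
        by (rule mult_left_mono) simp
      also have "\<dots> \<le> \<alpha>" using D(2) by (simp add: power_divide field_simps)
      finally show "real (ug_order G) * real \<Delta> * (w' - w) + real (ug_order G) * (lam_approx k D * 2 * (1 / 2) ^ D) \<le> \<alpha>"
        by (simp add: order distrib_left mult.assoc)
    qed
    show ?thesis
    proof (intro exI conjI)
      show "computes_within (ug_prog k \<Delta>) \<alpha> (ug_encode k G es) (rreg s 0)
        (real n * exp (exp (f\<^sub>2 k) * ln (real n * real \<Delta> / \<alpha> * exp (f\<^sub>3 k)) * ln (real \<Delta> * sqrt (real k))))"
        unfolding computes_within_def using run time by blast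
    qed (use ratio in \<open>simp_all add: w'_def\<close>)
  qed
  show ?thesis unfolding Let_def
    by (intro exI[of _ f\<^sub>2] exI[of _ f\<^sub>3] conjI O2 O3 allI impI, rule exI[of _ "ug_prog _ _"]) (use main in blast)
qed

end
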